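(* Let $S$ be a closed coisotropic submanifold of a Jacobi manifold, equipped with a fat tubular neighborhood, so that the ambient Jacobi manifold is identified with $(NS,L,J\equiv\{-,-\})$, $L=L_{NS}=\pi^*\ell$. A formal deformation $s(\varepsilon)=\sum_{i\ge0}\varepsilon^is_i\in\Gamma(NS)[[\varepsilon]]$, $s_0=0$, of $S$ is coisotropic (i.e. $P(\exp\mathcal L_{I(s(\varepsilon))}J)=0$) if and only if $-s(\varepsilon)$ is a solution of the (formal) Maurer-Cartan equation $$MC(-s(\varepsilon)):=\sum_{k=1}^\infty\frac1{k!}\mathfrak m_k(-s(\varepsilon),\dots,-s(\varepsilon))=0 .$$
   Context: Everything is smooth. **Multi-differential operators.** For a line bundle $L\to M$, a derivation of $L$ is an $\mathbb R$-linear $\Delta:\Gamma(L)\to\Gamma(L)$ with $\Delta(f\lambda)=\sigma(\Delta)(f)\lambda+f\Delta\lambda$ for a vector field $\sigma(\Delta)$, its symbol. $J^1L$ is the first jet bundle, $J_1L:=(J^1L)^*$. $\mathcal D^kL:=\Gamma(\wedge^kJ_1L\otimes L)$ is the space of alternating maps $\Gamma(L)^k\to\Gamma(L)$ that are first order differential operators in each entry, equivalently of $L$-valued alternating $k$-forms on $J^1L$; $\mathcal D^0L=\Gamma(L)$, $\mathcal D^1L=\mathcal DL$ the derivations. Elements of $\mathcal D^kL$ have degree $k-1$ in $(\mathcal D^\bullet L)[1]$. The Schouten-Jacobi bracket is $[\square,\square']^{SJ}:=(-1)^{kk'}\square\circ\square'-\square'\circ\square$ for $\square\in\mathcal D^{k+1}L$,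 $\square'\in\mathcal D^{k'+1}L$, where $(\square\circ\square')(\lambda_1,\dots,\lambda_{k+k'+1})=\sum_{\tau\in S_{k'+1,k}}(-1)^\tau\square(\square'(\lambda_{\tau(1)},\dots,\lambda_{\tau(k'+1)}),\lambda_{\tau(k'+2)},\dots,\lambda_{\tau(k+k'+1)})$ (sum over unshuffles). **Jacobi manifolds.** A Jacobi manifold $(M,L,J\equiv\{-,-\})$ is a manifold with a line bundle $L$ and a Lie bracket on $\Gamma(L)$ that is a first order differential operator in each entry; $J\in\mathcal D^2L$ denotes the bracket; $X_\lambda$ is the symbol of $\{\lambda,-\}$. A submanifold $S$ is coisotropic if $\Lambda_J^\#(T^0S\otimes L)\subset TS$, where $\Lambda_J^\#(df\otimes\lambda)=X_{f\lambda}-fX_\lambda$ and $T^0S$ is the annihilator of $TS$. **Normal data.** $\ell=L|_S$, $NS=TM|_S/TS$ with projection $\pi:NS\to S$, $N_\ell S=NS\otimes\ell^*$, $N_\ell{}^*S=N^*S\otimes\ell$, embedded in $J^1L|_S$ by $\gamma(df\otimes\lambda)=j^1(f\lambda)-fj^1\lambda$. $P:(\mathcal D^\bullet L)[1]\to\Gamma(\wedge^\bullet N_\ell S\otimes\ell)[1]$ sends $\square\in\mathcal D^kL$ to the restriction to $S$ of the $k$-form $\square$, pulled back along $\gamma:N_\ell{}^*S\to J^1L|_S$ (here $\Gamma(\wedge^kN_\ell S\otimes\ell)$ = $\ell$-valued alternating $k$-forms on $N_\ell{}^*S$; for $k=1$ it is $\Gamma(NS)$). A fat tubular neighborhood is a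 line bundle embedding $\tau:L_{NS}:=\pi^*\ell\hookrightarrow L$ covering a tubular neighborhood $NS\hookrightarrow M$ and restricting to the inclusion $\ell\hookrightarrow L$ over the zero section; via $\tau$ one replaces $(M,L,J)$ by the induced Jacobi structure $(L=L_{NS},J)$ on $NS$, with $S$ the zero section. **The map $I$ and the $L_\infty$-algebra.** For $\nu\in\Gamma(NS)$, $\pi^*\nu$ is the corresponding fiberwise constant vertical vector field; $\mathbb D$ is the flat connection in $L=\pi^*\ell$ along vertical vector fields with $\mathbb D_X\pi^*\lambda=0$, $\lambda\in\Gamma(\ell)$. Put $I(\nu)=\mathbb D_{\pi^*\nu}$, $I_0(\nu\otimes\varphi)=I(\nu)\otimes\pi^*\varphi$ ($\varphi\in\Gamma(\ell^* )$), $I(\lambda)=\pi^*\lambda$, $I(\xi_1\wedge\dots\wedge\xi_k\otimes\lambda)=I_0(\xi_1)\wedge\dots\wedge I_0(\xi_k)\otimes\pi^*\lambda$. Then $\mathfrak m_k(\xi_1,\dots,\xi_k):=P[\cdots[[J,I(\xi_1)]^{SJ},I(\xi_2)]^{SJ}\cdots,I(\xi_k)]^{SJ}$, extended $\mathbb R[[\varepsilon]]$-multilinearly to formal power series. **Formal deformations.** $\varepsilon$ is a formal parameter. A formal deformation of $S$ is a series $s(\varepsilon)=\sum_{i\ge0}\varepsilon^is_i$, $s_i\in\Gamma(NS)$, $s_0=0$; $I(s(\varepsilon))=\sum_i\varepsilon^iI(s_i)$. For $\xi(\varepsilon)\in(\mathcal DL)[[\varepsilon]]$, $\mathcal L_{\xi(\varepsilon)}=[\xi(\varepsilon),-]^{SJ}$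 acts on $(\mathcal D^\bullet L)[[\varepsilon]]$ coefficientwise, and $\exp\mathcal L_{\xi(\varepsilon)}=\sum_n\frac1{n!}\mathcal L_{\xi(\varepsilon)}^n$. $P$ is extended coefficientwise. *)

theory Defs
  imports
    "HOL-Analysis.Analysis"
    "HOL-Combinatorics.Permutations"
    "HOL-Library.Function_Algebras"
    "HOL-Library.Groups_Big_Fun"
begin

section \<open>Preliminaries\<close>

instantiation "fun" :: (type, real_vector) real_vector
begin

definition scaleR_fun :: "real \<Rightarrow> ('a \<Rightarrow> 'b) \<Rightarrow> 'a \<Rightarrow> 'b"
  where "scaleR_fun c f = (\<lambda>x. c *\<^sub>R f x)"

instance
  by standard (simp_all add: scaleR_fun_def fun_eq_iff algebra_simps)

end

definition linear_map_on :: "'a::real_vector set \<Rightarrow> ('a \<Rightarrow> 'b::real_vector) \<Rightarrow> bool"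
  where "linear_map_on V f \<longleftrightarrow>
    (\<forall>u\<in>V. \<forall>w\<in>V. f (u + w) = f u + f w) \<and> (\<forall>c. \<forall>u\<in>V. f (c *\<^sub>R u) = c *\<^sub>R f u)"

definition fscale :: "('a \<Rightarrow> real) \<Rightarrow> ('a \<Rightarrow> 'b::real_vector) \<Rightarrow> 'a \<Rightarrow> 'b"
  where "fscale f s = (\<lambda>x. f x *\<^sub>R s x)"

definition restrict_zero :: "'a set \<Rightarrow> ('a \<Rightarrow> 'b::zero) \<Rightarrow> 'a \<Rightarrow> 'b"
  where "restrict_zero A f = (\<lambda>x. if x \<in> A then f x else 0)"


section \<open>Smooth manifolds\<close>

text \<open>
  Model spaces are linear subspaces \<open>V\<close> of a Euclidean space rather than whole Euclidean
  types: this allows dimension 0 (types of class \<open>euclidean_space\<close> have positive dimension) and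
  lets a submanifold be modelled on a subspace of the model of the ambient manifold.  For \<open>W\<close>
  relatively open in \<open>V\<close>, the derivative within \<open>W\<close> is unique on \<open>V\<close>.
\<close>

primrec Ck_on :: "nat \<Rightarrow> 'a::euclidean_space set \<Rightarrow> 'a set \<Rightarrow> ('a \<Rightarrow> 'b::euclidean_space) \<Rightarrow> bool"
  where
    "Ck_on 0 V W f \<longleftrightarrow> continuous_on W f"
  | "Ck_on (Suc k) V W f \<longleftrightarrow>
      (\<exists>f'. (\<forall>x\<in>W. (f has_derivative f' x) (at x within W)) \<and> (\<forall>v\<in>V. Ck_on k V W (\<lambda>x. f' x v)))"

definition smooth_on :: "'a::euclidean_space set \<Rightarrow> 'a set \<Rightarrow> ('a \<Rightarrow> 'b::euclidean_space) \<Rightarrow> bool"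
  where "smooth_on V W f \<longleftrightarrow> (\<forall>k. Ck_on k V W f)"

record ('a, 'e) manifold =
  pts :: "'a set"
  model :: "'e set"
  atlas :: "('a set \<times> ('a \<Rightarrow> 'e)) set"

text \<open>The topology is the one induced by the atlas.\<close>

definition mtop :: "('a, 'e::euclidean_space) manifold \<Rightarrow> 'a topology"
  where "mtop M = topology (\<lambda>U. U \<subseteq> pts M \<and>
    (\<forall>(D, \<phi>)\<in>atlas M. openin (top_of_set (model M)) (\<phi> ` (U \<inter> D))))"

definition smooth_manifold :: "('a, 'e::euclidean_space) manifold \<Rightarrow> bool"
  where "smooth_manifold M \<longleftrightarrow>
    subspace (model M) \<and>
    (\<forall>(D, \<phi>)\<in>atlas M. D \<subseteq> pts M \<and> inj_on \<phi> D \<and> openin (top_of_set (model M)) (\<phi> ` D)) \<and>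
    (\<Union>(D, \<phi>)\<in>atlas M. D) = pts M \<and>
    (\<forall>(D, \<phi>)\<in>atlas M. \<forall>(D', \<psi>)\<in>atlas M.
      openin (top_of_set (model M)) (\<phi> ` (D \<inter> D')) \<and>
      smooth_on (model M) (\<phi> ` (D \<inter> D')) (\<psi> \<circ> inv_into D \<phi>)) \<and>
    Hausdorff_space (mtop M) \<and> second_countable (mtop M)"

text \<open>Smoothness, on an open set \<open>U\<close>, of a map into a Euclidean space.\<close>

definition smooth_fun :: "('a, 'e::euclidean_space) manifold \<Rightarrow> 'a set \<Rightarrow> ('a \<Rightarrow> 'b::euclidean_space) \<Rightarrow> bool"
  where "smooth_fun M U g \<longleftrightarrow>
    (\<forall>(D, \<phi>)\<in>atlas M. smooth_on (model M) (\<phi> ` (D \<inter> U)) (g \<circ> inv_into D \<phi>))"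

text \<open>
  Functions and sections are normalised to vanish off the manifold, so that equality in HOL is
  equality on the manifold.
\<close>

definition Cinf :: "('a, 'e::euclidean_space) manifold \<Rightarrow> ('a \<Rightarrow> real) set"
  where "Cinf M = {f. smooth_fun M (pts M) f \<and> (\<forall>x. x \<notin> pts M \<longrightarrow> f x = 0)}"

text \<open>All charts compatible with the atlas (the maximal atlas).\<close>

definition charts :: "('a, 'e::euclidean_space) manifold \<Rightarrow> ('a set \<times> ('a \<Rightarrow> 'e)) set"
  where "charts M = {(D, \<phi>).
    openin (mtop M) D \<and> inj_on \<phi> D \<and> openin (top_of_set (model M)) (\<phi> ` D) \<and>
    smooth_fun M D \<phi> \<and>
    (\<forall>(D', \<psi>)\<in>atlas M. openin (top_of_set (model M)) (\<phi> ` (D \<inter> D')) \<and>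
      smooth_on (model M) (\<phi> ` (D \<inter> D')) (\<psi> \<circ> inv_into D \<phi>))}"

definition open_embedding ::
  "('a, 'e::euclidean_space) manifold \<Rightarrow> ('b, 'f::euclidean_space) manifold \<Rightarrow> ('a \<Rightarrow> 'b) \<Rightarrow> bool"
  where "open_embedding M M' f \<longleftrightarrow>
    f ` pts M \<subseteq> pts M' \<and> inj_on f (pts M) \<and>
    (\<forall>(D, \<psi>)\<in>atlas M'. openin (mtop M) {x \<in> pts M. f x \<in> D} \<and>
      smooth_fun M {x \<in> pts M. f x \<in> D} (\<psi> \<circ> f)) \<and>
    (\<forall>(D, \<phi>)\<in>atlas M. openin (mtop M') (f ` D) \<and> smooth_fun M' (f ` D) (\<phi> \<circ> inv_into (pts M) f))"

text \<open>Tangent vectors at a point, as derivations of the algebra of smooth functions.\<close>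

definition tangent :: "('a, 'e::euclidean_space) manifold \<Rightarrow> 'a \<Rightarrow> (('a \<Rightarrow> real) \<Rightarrow> real) set"
  where "tangent M x = {v. linear_map_on (Cinf M) v \<and>
    (\<forall>f\<in>Cinf M. \<forall>g\<in>Cinf M. v (f * g) = f x * v g + g x * v f) \<and> (\<forall>f. f \<notin> Cinf M \<longrightarrow> v f = 0)}"

definition vector_fields :: "('a, 'e::euclidean_space) manifold \<Rightarrow> (('a \<Rightarrow> real) \<Rightarrow> 'a \<Rightarrow> real) set"
  where "vector_fields M = {X. X ` Cinf M \<subseteq> Cinf M \<and> linear_map_on (Cinf M) X \<and>
    (\<forall>f\<in>Cinf M. \<forall>g\<in>Cinf M. X (f * g) = f * X g + g * X f) \<and> (\<forall>f. f \<notin> Cinf M \<longrightarrow> X f = 0)}"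

text \<open>
  Embedded submanifolds, modelled on the subspace \<open>W\<close> of the model of \<open>M\<close>, via slice charts.
\<close>

definition slice_charts ::
  "('a, 'e::euclidean_space) manifold \<Rightarrow> 'e set \<Rightarrow> 'a set \<Rightarrow> ('a set \<times> ('a \<Rightarrow> 'e)) set"
  where "slice_charts M W S = {(D, \<phi>). (D, \<phi>) \<in> charts M \<and> \<phi> ` (D \<inter> S) = \<phi> ` D \<inter> W}"

definition submanifold :: "('a, 'e::euclidean_space) manifold \<Rightarrow> 'e set \<Rightarrow> 'a set \<Rightarrow> bool"
  where "submanifold M W S \<longleftrightarrow> S \<subseteq> pts M \<and> subspace W \<and> W \<subseteq> model M \<and>
    (\<forall>x\<in>S. \<exists>(D, \<phi>)\<in>slice_charts M W S. x \<in> D)"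

definition induced_manifold ::
  "('a, 'e::euclidean_space) manifold \<Rightarrow> 'e set \<Rightarrow> 'a set \<Rightarrow> ('a, 'e) manifold"
  where "induced_manifold M W S =
    \<lparr>pts = S, model = W, atlas = (\<lambda>(D, \<phi>). (D \<inter> S, \<phi>)) ` slice_charts M W S\<rparr>"

text \<open>\<open>TS\<close> inside \<open>TM\<close>: the image of the tangent space of \<open>S\<close> under the differential of the inclusion.\<close>

definition tangent_sub ::
  "('a, 'e::euclidean_space) manifold \<Rightarrow> 'e set \<Rightarrow> 'a set \<Rightarrow> 'a \<Rightarrow> (('a \<Rightarrow> real) \<Rightarrow> real) set"
  where "tangent_sub M W S x =
    (\<lambda>w f. if f \<in> Cinf M then w (restrict_zero S f) else 0) ` tangent (induced_manifold M W S) x"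


section \<open>Vector bundles\<close>

text \<open>
  The fibres are linear subspaces of one real vector space type \<open>'v\<close>, which is no restriction
  (embed them, for instance, into their direct sum) as no compatibility with the smooth structure
  is imposed; the latter is given by the local trivialisations \<open>(U, \<Phi>)\<close>, where \<open>\<Phi> x\<close> maps the
  fibre over \<open>x\<close> to the typical fibre \<open>tmodel\<close>.
\<close>

record ('a, 'f, 'v) vbundle =
  fib :: "'a \<Rightarrow> 'v set"
  tmodel :: "'f set"
  trivs :: "('a set \<times> ('a \<Rightarrow> 'v \<Rightarrow> 'f)) set"

definition vector_bundle ::
  "('a, 'e::euclidean_space) manifold \<Rightarrow> ('a, 'f::euclidean_space, 'v::real_vector) vbundle \<Rightarrow> bool"
  where "vector_bundle M E \<longleftrightarrow>
    subspace (tmodel E) \<and> (\<forall>x\<in>pts M. subspace (fib E x)) \<and>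
    (\<forall>(U, \<Phi>)\<in>trivs E. openin (mtop M) U \<and>
      (\<forall>x\<in>U. linear_map_on (fib E x) (\<Phi> x) \<and> bij_betw (\<Phi> x) (fib E x) (tmodel E))) \<and>
    (\<Union>(U, \<Phi>)\<in>trivs E. U) = pts M \<and>
    (\<forall>(U, \<Phi>)\<in>trivs E. \<forall>(U', \<Phi>')\<in>trivs E. \<forall>c\<in>tmodel E.
      smooth_fun M (U \<inter> U') (\<lambda>x. \<Phi>' x (inv_into (fib E x) (\<Phi> x) c)))"

definition line_bundle ::
  "('a, 'e::euclidean_space) manifold \<Rightarrow> ('a, 'f::euclidean_space, 'v::real_vector) vbundle \<Rightarrow> bool"
  where "line_bundle M L \<longleftrightarrow> vector_bundle M L \<and> dim (tmodel L) = 1"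

definition sections ::
  "('a, 'e::euclidean_space) manifold \<Rightarrow> ('a, 'f::euclidean_space, 'v::real_vector) vbundle
    \<Rightarrow> ('a \<Rightarrow> 'v) set"
  where "sections M E = {s. (\<forall>x\<in>pts M. s x \<in> fib E x) \<and> (\<forall>x. x \<notin> pts M \<longrightarrow> s x = 0) \<and>
    (\<forall>(U, \<Phi>)\<in>trivs E. smooth_fun M U (\<lambda>x. \<Phi> x (s x)))}"

definition total_space ::
  "('a, 'e::euclidean_space) manifold \<Rightarrow> ('a, 'f::euclidean_space, 'v::real_vector) vbundle
    \<Rightarrow> ('a \<times> 'v, 'e \<times> 'f) manifold"
  where "total_space M E =
    \<lparr>pts = Sigma (pts M) (fib E), model = model M \<times> tmodel E,
     atlas = {(Sigma (D \<inter> U) (fib E), \<lambda>(x, v). (\<phi> x, \<Phi> x v)) | D \<phi> U \<Phi>.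
       (D, \<phi>) \<in> atlas M \<and> (U, \<Phi>) \<in> trivs E}\<rparr>"

text \<open>The pull-back of the bundle \<open>E\<close> along \<open>f\<close>, defined on the points \<open>A\<close>.\<close>

definition pullback :: "'b set \<Rightarrow> ('b \<Rightarrow> 'a) \<Rightarrow> ('a, 'f, 'v) vbundle \<Rightarrow> ('b, 'f, 'v) vbundle"
  where "pullback A f E =
    \<lparr>fib = (\<lambda>y. fib E (f y)), tmodel = tmodel E,
     trivs = (\<lambda>(U, \<Phi>). ({y \<in> A. f y \<in> U}, \<lambda>y. \<Phi> (f y))) ` trivs E\<rparr>"

text \<open>
  \<open>(N, q)\<close> is the normal bundle \<open>TM|\<^sub>S / TS\<close>: \<open>q\<close> is a smooth vector bundle map
  from \<open>TM|\<^sub>S\<close> onto \<open>N\<close> with kernel \<open>TS\<close>.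
\<close>

definition normal_bundle ::
  "('a, 'e::euclidean_space) manifold \<Rightarrow> 'e set \<Rightarrow> 'a set
    \<Rightarrow> ('a, 'g::euclidean_space, 'v::real_vector) vbundle
    \<Rightarrow> ('a \<Rightarrow> (('a \<Rightarrow> real) \<Rightarrow> real) \<Rightarrow> 'v) \<Rightarrow> bool"
  where "normal_bundle M W S N q \<longleftrightarrow>
    vector_bundle (induced_manifold M W S) N \<and>
    (\<forall>x\<in>S. linear_map_on (tangent M x) (q x) \<and> q x ` tangent M x = fib N x \<and>
      {v \<in> tangent M x. q x v = 0} = tangent_sub M W S x) \<and>
    (\<forall>X\<in>vector_fields M.
      restrict_zero S (\<lambda>x. q x (\<lambda>f. X f x)) \<in> sections (induced_manifold M W S) N)"


section \<open>Multi-differential operators and the Schouten-Jacobi bracket\<close>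

text \<open>First order differential operators between sections of \<open>L\<close>: \<open>[[\<Delta>, f], g] = 0\<close>.\<close>

definition first_order_op ::
  "('a, 'e::euclidean_space) manifold \<Rightarrow> ('a, 'f::euclidean_space, 'l::real_vector) vbundle
    \<Rightarrow> (('a \<Rightarrow> 'l) \<Rightarrow> 'a \<Rightarrow> 'l) \<Rightarrow> bool"
  where "first_order_op M L \<Delta> \<longleftrightarrow>
    \<Delta> ` sections M L \<subseteq> sections M L \<and> linear_map_on (sections M L) \<Delta> \<and>
    (\<forall>f\<in>Cinf M. \<forall>g\<in>Cinf M. \<forall>s\<in>sections M L.
      \<Delta> (fscale (f * g) s) - fscale f (\<Delta> (fscale g s)) - fscale g (\<Delta> (fscale f s))
        + fscale (f * g) (\<Delta> s) = 0)"

definition has_symbol ::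
  "('a, 'e::euclidean_space) manifold \<Rightarrow> ('a, 'f::euclidean_space, 'l::real_vector) vbundle
    \<Rightarrow> (('a \<Rightarrow> 'l) \<Rightarrow> 'a \<Rightarrow> 'l) \<Rightarrow> (('a \<Rightarrow> real) \<Rightarrow> 'a \<Rightarrow> real) \<Rightarrow> bool"
  where "has_symbol M L \<Delta> X \<longleftrightarrow> X \<in> vector_fields M \<and>
    (\<forall>f\<in>Cinf M. \<forall>s\<in>sections M L. \<Delta> (fscale f s) = fscale (X f) s + fscale f (\<Delta> s))"

definition symbol ::
  "('a, 'e::euclidean_space) manifold \<Rightarrow> ('a, 'f::euclidean_space, 'l::real_vector) vbundle
    \<Rightarrow> (('a \<Rightarrow> 'l) \<Rightarrow> 'a \<Rightarrow> 'l) \<Rightarrow> ('a \<Rightarrow> real) \<Rightarrow> 'a \<Rightarrow> real"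
  where "symbol M L \<Delta> = (SOME X. has_symbol M L \<Delta> X)"

definition derivation_with_symbol ::
  "('a, 'e::euclidean_space) manifold \<Rightarrow> ('a, 'f::euclidean_space, 'l::real_vector) vbundle
    \<Rightarrow> (('a \<Rightarrow> 'l) \<Rightarrow> 'a \<Rightarrow> 'l) \<Rightarrow> (('a \<Rightarrow> real) \<Rightarrow> 'a \<Rightarrow> real) \<Rightarrow> bool"
  where "derivation_with_symbol M L \<Delta> X \<longleftrightarrow>
    \<Delta> ` sections M L \<subseteq> sections M L \<and> linear_map_on (sections M L) \<Delta> \<and> has_symbol M L \<Delta> X"

text \<open>
  A \<open>k\<close>-ary operator is a function on argument lists, normalised to vanish on lists that are not
  lists of \<open>k\<close> sections.
\<close>

type_synonym ('a, 'l) multi_op = "('a \<Rightarrow> 'l) list \<Rightarrow> 'a \<Rightarrow> 'l"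

definition multi_diff_ops ::
  "('a, 'e::euclidean_space) manifold \<Rightarrow> ('a, 'f::euclidean_space, 'l::real_vector) vbundle \<Rightarrow> nat
    \<Rightarrow> ('a, 'l) multi_op set"
  where "multi_diff_ops M L k = {B.
    (\<forall>as. \<not> (length as = k \<and> set as \<subseteq> sections M L) \<longrightarrow> B as = 0) \<and>
    (\<forall>as. length as = k \<and> set as \<subseteq> sections M L \<longrightarrow>
      B as \<in> sections M L \<and>
      (\<forall>i<k. first_order_op M L (\<lambda>s. B (as[i := s]))) \<and>
      (\<forall>i<k. \<forall>j<k. i \<noteq> j \<and> as ! i = as ! j \<longrightarrow> B as = 0))}"

definition unary ::
  "('a, 'e::euclidean_space) manifold \<Rightarrow> ('a, 'f::euclidean_space, 'l::real_vector) vbundle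
    \<Rightarrow> (('a \<Rightarrow> 'l) \<Rightarrow> 'a \<Rightarrow> 'l) \<Rightarrow> ('a, 'l) multi_op"
  where "unary M L \<Delta> = (\<lambda>as. if length as = 1 \<and> set as \<subseteq> sections M L then \<Delta> (hd as) else 0)"

definition unshuffles :: "nat \<Rightarrow> nat \<Rightarrow> (nat \<Rightarrow> nat) set"
  where "unshuffles q r = {\<tau>. \<tau> permutes {..<q + r} \<and>
    strict_mono_on {..<q} \<tau> \<and> strict_mono_on {q..<q + r} \<tau>}"

text \<open>
  \<open>p\<close> and \<open>q\<close> are the arities of \<open>B\<close> and \<open>B'\<close>, i.e. \<open>p = k + 1\<close>, \<open>q = k' + 1\<close> in terms of the degrees.
\<close>

definition op_comp ::
  "('a, 'e::euclidean_space) manifold \<Rightarrow> ('a, 'f::euclidean_space, 'l::real_vector) vbundle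
    \<Rightarrow> nat \<Rightarrow> nat \<Rightarrow> ('a, 'l) multi_op \<Rightarrow> ('a, 'l) multi_op \<Rightarrow> ('a, 'l) multi_op"
  where "op_comp M L p q B B' = (\<lambda>as.
    if 1 \<le> p \<and> length as = q + (p - 1) \<and> set as \<subseteq> sections M L then
      (\<Sum>\<tau>\<in>unshuffles q (p - 1). real_of_int (sign \<tau>) *\<^sub>R
        B (B' (map (\<lambda>i. as ! \<tau> i) [0..<q]) # map (\<lambda>i. as ! \<tau> i) [q..<q + (p - 1)]))
    else 0)"

text \<open>The sign \<open>(-1)\<^bsup>kk'\<^esup>\<close> is written with \<open>p + 1\<close>, \<open>q + 1\<close>, which have the parity of the degrees.\<close>

definition SJ ::
  "('a, 'e::euclidean_space) manifold \<Rightarrow> ('a, 'f::euclidean_space, 'l::real_vector) vbundle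
    \<Rightarrow> nat \<Rightarrow> nat \<Rightarrow> ('a, 'l) multi_op \<Rightarrow> ('a, 'l) multi_op \<Rightarrow> ('a, 'l) multi_op"
  where "SJ M L p q B B' =
    ((- 1) ^ ((p + 1) * (q + 1)) :: real) *\<^sub>R op_comp M L p q B B' - op_comp M L q p B' B"


section \<open>Jacobi structures and coisotropic submanifolds\<close>

definition jacobi_structure ::
  "('a, 'e::euclidean_space) manifold \<Rightarrow> ('a, 'f::euclidean_space, 'l::real_vector) vbundle
    \<Rightarrow> ('a, 'l) multi_op \<Rightarrow> bool"
  where "jacobi_structure M L J \<longleftrightarrow> J \<in> multi_diff_ops M L 2 \<and>
    (\<forall>s\<in>sections M L. \<forall>t\<in>sections M L. \<forall>u\<in>sections M L.
      J [s, J [t, u]] + J [t, J [u, s]] + J [u, J [s, t]] = 0)"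

definition hamiltonian ::
  "('a, 'e::euclidean_space) manifold \<Rightarrow> ('a, 'f::euclidean_space, 'l::real_vector) vbundle
    \<Rightarrow> ('a, 'l) multi_op \<Rightarrow> ('a \<Rightarrow> 'l) \<Rightarrow> ('a \<Rightarrow> real) \<Rightarrow> 'a \<Rightarrow> real"
  where "hamiltonian M L J s = symbol M L (\<lambda>t. J [s, t])"

definition sharp ::
  "('a, 'e::euclidean_space) manifold \<Rightarrow> ('a, 'f::euclidean_space, 'l::real_vector) vbundle
    \<Rightarrow> ('a, 'l) multi_op \<Rightarrow> ('a \<Rightarrow> real) \<Rightarrow> ('a \<Rightarrow> 'l) \<Rightarrow> ('a \<Rightarrow> real) \<Rightarrow> 'a \<Rightarrow> real"
  where "sharp M L J f s =
    (\<lambda>h. hamiltonian M L J (fscale f s) h - f * hamiltonian M L J s h)"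

definition coisotropic ::
  "('a, 'e::euclidean_space) manifold \<Rightarrow> ('a, 'f::euclidean_space, 'l::real_vector) vbundle
    \<Rightarrow> ('a, 'l) multi_op \<Rightarrow> 'e set \<Rightarrow> 'a set \<Rightarrow> bool"
  where "coisotropic M L J W S \<longleftrightarrow>
    (\<forall>x\<in>S. \<forall>f\<in>Cinf M. \<forall>s\<in>sections M L.
      (\<forall>v\<in>tangent_sub M W S x. v f = 0) \<longrightarrow>
      (\<lambda>h. sharp M L J f s h x) \<in> tangent_sub M W S x)"


section \<open>Fat tubular neighbourhoods\<close>

definition restricted_bundle :: "'a set \<Rightarrow> ('a, 'f, 'l) vbundle \<Rightarrow> ('a, 'f, 'l) vbundle"
  where "restricted_bundle S L = pullback S (\<lambda>x. x) L"

text \<open>\<open>\<pi>\<^sup>*l\<close> over the total space of \<open>N \<rightarrow> S\<close>.\<close>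

definition bundle_over_total ::
  "('a, 'e::euclidean_space) manifold \<Rightarrow> ('a, 'g::euclidean_space, 'v::real_vector) vbundle
    \<Rightarrow> ('a, 'f::euclidean_space, 'l::real_vector) vbundle \<Rightarrow> ('a \<times> 'v, 'f, 'l) vbundle"
  where "bundle_over_total S N l = pullback (pts (total_space S N)) fst l"

text \<open>Embeddings (\<open>F\<close> covering \<open>f\<close>) of bundles of the same rank.\<close>

definition bundle_embedding ::
  "('a, 'e::euclidean_space) manifold \<Rightarrow> ('a, 'f::euclidean_space, 'v::real_vector) vbundle
    \<Rightarrow> ('b, 'h::euclidean_space) manifold \<Rightarrow> ('b, 'g::euclidean_space, 'w::real_vector) vbundle
    \<Rightarrow> ('a \<Rightarrow> 'b) \<Rightarrow> ('a \<Rightarrow> 'v \<Rightarrow> 'w) \<Rightarrow> bool"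
  where "bundle_embedding M E M' E' f F \<longleftrightarrow>
    open_embedding M M' f \<and>
    (\<forall>y\<in>pts M. linear_map_on (fib E y) (F y) \<and> bij_betw (F y) (fib E y) (fib E' (f y))) \<and>
    (\<forall>(U, \<Phi>)\<in>trivs E. \<forall>(U', \<Phi>')\<in>trivs E'. \<forall>c\<in>tmodel E.
      smooth_fun M {y \<in> U. f y \<in> U'} (\<lambda>y. \<Phi>' (f y) (F y (inv_into (fib E y) (\<Phi> y) c))))"

definition fat_tubular_nbhd ::
  "('a, 'e::euclidean_space) manifold \<Rightarrow> ('a, 'f::euclidean_space, 'l::real_vector) vbundle
    \<Rightarrow> ('a, 'e) manifold \<Rightarrow> ('a, 'g::euclidean_space, 'v::real_vector) vbundle
    \<Rightarrow> ('a \<times> 'v \<Rightarrow> 'a) \<Rightarrow> ('a \<times> 'v \<Rightarrow> 'l \<Rightarrow> 'l) \<Rightarrow> bool"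
  where "fat_tubular_nbhd M L S N f F \<longleftrightarrow>
    bundle_embedding (total_space S N) (bundle_over_total S N (restricted_bundle (pts S) L)) M L f F \<and>
    (\<forall>x\<in>pts S. f (x, 0) = x \<and> (\<forall>e\<in>fib L x. F (x, 0) e = e))"

definition pull_section ::
  "('a, 'e::euclidean_space) manifold \<Rightarrow> ('a, 'f::euclidean_space, 'v::real_vector) vbundle
    \<Rightarrow> ('a \<Rightarrow> 'b) \<Rightarrow> ('a \<Rightarrow> 'v \<Rightarrow> 'w) \<Rightarrow> ('b \<Rightarrow> 'w) \<Rightarrow> 'a \<Rightarrow> 'v"
  where "pull_section M E f F s =
    restrict_zero (pts M) (\<lambda>y. inv_into (fib E y) (F y) (s (f y)))"

text \<open>
  \<open>J\<close> is the Jacobi structure induced from \<open>J\<^sub>0\<close> by the bundle embedding \<open>(f, F)\<close>; by locality of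
  differential operators it is determined by its values on pulled-back sections.
\<close>

definition induced_jacobi ::
  "('a, 'e::euclidean_space) manifold \<Rightarrow> ('a, 'f::euclidean_space, 'v::real_vector) vbundle
    \<Rightarrow> ('b, 'h::euclidean_space) manifold \<Rightarrow> ('b, 'g::euclidean_space, 'w::real_vector) vbundle
    \<Rightarrow> ('a \<Rightarrow> 'b) \<Rightarrow> ('a \<Rightarrow> 'v \<Rightarrow> 'w) \<Rightarrow> ('b, 'w) multi_op \<Rightarrow> ('a, 'v) multi_op \<Rightarrow> bool"
  where "induced_jacobi M E M' E' f F J\<^sub>0 J \<longleftrightarrow>
    jacobi_structure M E J \<and>
    (\<forall>s\<in>sections M' E'. \<forall>t\<in>sections M' E'.
      J [pull_section M E f F s, pull_section M E f F t] = pull_section M E f F (J\<^sub>0 [s, t]))"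


section \<open>The projection \<open>P\<close>\<close>

text \<open>The fibre of the first jet bundle at \<open>y\<close> is the space of sections modulo \<open>m\<^sub>y\<^sup>2 \<Gamma>(L)\<close>.\<close>

definition jet ::
  "('a, 'e::euclidean_space) manifold \<Rightarrow> ('a, 'f::euclidean_space, 'l::real_vector) vbundle
    \<Rightarrow> 'a \<Rightarrow> ('a \<Rightarrow> 'l) \<Rightarrow> ('a \<Rightarrow> 'l) set"
  where "jet M L y s = {t \<in> sections M L. t - s \<in>
    span {fscale (f * g) u | f g u. f \<in> Cinf M \<and> g \<in> Cinf M \<and> u \<in> sections M L \<and> f y = 0 \<and> g y = 0}}"

text \<open>
  The form on jets at \<open>y\<close> defined by a multi-differential operator \<open>B\<close>, evaluated on
  representatives; for such \<open>B\<close> the value does not depend on their choice.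
\<close>

definition form_at :: "('a, 'l) multi_op \<Rightarrow> 'a \<Rightarrow> ('a \<Rightarrow> 'l) set list \<Rightarrow> 'l"
  where "form_at B y js = B (map (\<lambda>j. SOME s. s \<in> j) js) y"

text \<open>The fibre at \<open>x\<close> of \<open>N\<^sup>*S \<otimes> l\<close>, as the space of linear maps from the fibre of \<open>N\<close> to that of \<open>l\<close>.\<close>

definition conormal ::
  "('a, 'g, 'v::real_vector) vbundle \<Rightarrow> ('a, 'f, 'l::real_vector) vbundle \<Rightarrow> 'a \<Rightarrow> ('v \<Rightarrow> 'l) set"
  where "conormal N l x = {\<alpha>. linear_map_on (fib N x) \<alpha> \<and> \<alpha> ` fib N x \<subseteq> fib l x \<and>
    (\<forall>v. v \<notin> fib N x \<longrightarrow> \<alpha> v = 0)}"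

text \<open>
  For a function \<open>f\<close> on the total space of \<open>N\<close> that vanishes on the zero section and a section
  \<open>s\<close>: the element \<open>df \<otimes> s\<close> of \<open>N\<^sup>*S \<otimes> l\<close> at \<open>x\<close>, the normal bundle of the zero section being
  identified with \<open>N\<close> through vertical vectors.
\<close>

definition df_tensor ::
  "('a, 'g, 'v::real_vector) vbundle \<Rightarrow> 'a \<Rightarrow> ('a \<times> 'v \<Rightarrow> real) \<Rightarrow> ('a \<times> 'v \<Rightarrow> 'l::real_vector)
    \<Rightarrow> 'v \<Rightarrow> 'l"
  where "df_tensor N x f s =
    restrict_zero (fib N x) (\<lambda>v. deriv (\<lambda>t. f (x, t *\<^sub>R v)) 0 *\<^sub>R s (x, 0))"

text \<open>
  The embedding \<open>\<gamma>\<close> at \<open>x\<close>, with \<open>\<gamma> (df \<otimes> s) = j\<^sup>1(f s) - f j\<^sup>1 s\<close>.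
  Every \<open>\<alpha>\<close> in \<open>conormal\<close> has the form \<open>df \<otimes> s\<close>, and the jet does not depend on the choice of \<open>f\<close>, \<open>s\<close>.
\<close>

definition gamma ::
  "('a, 'e::euclidean_space) manifold \<Rightarrow> ('a, 'g::euclidean_space, 'v::real_vector) vbundle
    \<Rightarrow> ('a, 'f::euclidean_space, 'l::real_vector) vbundle \<Rightarrow> 'a \<Rightarrow> ('v \<Rightarrow> 'l) \<Rightarrow> ('a \<times> 'v \<Rightarrow> 'l) set"
  where "gamma S N l x \<alpha> = (SOME j. \<exists>f\<in>Cinf (total_space S N).
    \<exists>s\<in>sections (total_space S N) (bundle_over_total S N l).
      (\<forall>y\<in>pts S. f (y, 0) = 0) \<and> \<alpha> = df_tensor N x f s \<and>
      j = jet (total_space S N) (bundle_over_total S N l) (x, 0) (fscale f s - f (x, 0) *\<^sub>R s))"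

type_synonym ('a, 'v, 'l) conormal_form = "'a \<Rightarrow> ('v \<Rightarrow> 'l) list \<Rightarrow> 'l"

definition proj_P ::
  "('a, 'e::euclidean_space) manifold \<Rightarrow> ('a, 'g::euclidean_space, 'v::real_vector) vbundle
    \<Rightarrow> ('a, 'f::euclidean_space, 'l::real_vector) vbundle
    \<Rightarrow> ('a \<times> 'v, 'l) multi_op \<Rightarrow> ('a, 'v, 'l) conormal_form"
  where "proj_P S N l B = (\<lambda>x \<alpha>s.
    if x \<in> pts S \<and> set \<alpha>s \<subseteq> conormal N l x
    then form_at B (x, 0) (map (gamma S N l x) \<alpha>s) else 0)"


section \<open>The map \<open>I\<close> and the brackets\<close>

definition pull_vert ::
  "('a, 'e::euclidean_space) manifold \<Rightarrow> ('a, 'g::euclidean_space, 'v::real_vector) vbundle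
    \<Rightarrow> ('a \<Rightarrow> 'b::zero) \<Rightarrow> 'a \<times> 'v \<Rightarrow> 'b"
  where "pull_vert S N s = restrict_zero (pts (total_space S N)) (\<lambda>y. s (fst y))"

definition vertical_fields ::
  "('a, 'e::euclidean_space) manifold \<Rightarrow> ('a, 'g::euclidean_space, 'v::real_vector) vbundle
    \<Rightarrow> (('a \<times> 'v \<Rightarrow> real) \<Rightarrow> 'a \<times> 'v \<Rightarrow> real) set"
  where "vertical_fields S N =
    {X \<in> vector_fields (total_space S N). \<forall>f\<in>Cinf S. X (pull_vert S N f) = 0}"

definition vertical_lift ::
  "('a, 'e::euclidean_space) manifold \<Rightarrow> ('a, 'g::euclidean_space, 'v::real_vector) vbundle
    \<Rightarrow> ('a \<Rightarrow> 'v) \<Rightarrow> ('a \<times> 'v \<Rightarrow> real) \<Rightarrow> 'a \<times> 'v \<Rightarrow> real"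
  where "vertical_lift S N \<nu> = (\<lambda>f. if f \<in> Cinf (total_space S N) then
    restrict_zero (pts (total_space S N)) (\<lambda>(x, v). deriv (\<lambda>t. f (x, v + t *\<^sub>R \<nu> x)) 0) else 0)"

text \<open>
  The flat connection in \<open>\<pi>\<^sup>*l\<close> along vertical vector fields for which pulled-back sections
  are parallel; these conditions determine it on vertical fields and sections.
\<close>

definition canonical_connection ::
  "('a, 'e::euclidean_space) manifold \<Rightarrow> ('a, 'g::euclidean_space, 'v::real_vector) vbundle
    \<Rightarrow> ('a, 'f::euclidean_space, 'l::real_vector) vbundle
    \<Rightarrow> ((('a \<times> 'v \<Rightarrow> real) \<Rightarrow> 'a \<times> 'v \<Rightarrow> real) \<Rightarrow> ('a \<times> 'v \<Rightarrow> 'l) \<Rightarrow> 'a \<times> 'v \<Rightarrow> 'l) \<Rightarrow> bool"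
  where "canonical_connection S N l \<D> \<longleftrightarrow>
    (\<forall>X\<in>vertical_fields S N.
      derivation_with_symbol (total_space S N) (bundle_over_total S N l) (\<D> X) X) \<and>
    (\<forall>X\<in>vertical_fields S N. \<forall>Y\<in>vertical_fields S N.
      \<forall>s\<in>sections (total_space S N) (bundle_over_total S N l).
        (\<forall>f\<in>Cinf (total_space S N). \<forall>g\<in>Cinf (total_space S N).
          \<D> (\<lambda>h. f * X h + g * Y h) s = fscale f (\<D> X s) + fscale g (\<D> Y s)) \<and>
        \<D> (\<lambda>h. X (Y h) - Y (X h)) s = \<D> X (\<D> Y s) - \<D> Y (\<D> X s)) \<and>
    (\<forall>X\<in>vertical_fields S N. \<forall>s\<in>sections S l. \<D> X (pull_vert S N s) = 0)"

definition I_map ::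
  "('a, 'e::euclidean_space) manifold \<Rightarrow> ('a, 'g::euclidean_space, 'v::real_vector) vbundle
    \<Rightarrow> ('a, 'f::euclidean_space, 'l::real_vector) vbundle
    \<Rightarrow> ((('a \<times> 'v \<Rightarrow> real) \<Rightarrow> 'a \<times> 'v \<Rightarrow> real) \<Rightarrow> ('a \<times> 'v \<Rightarrow> 'l) \<Rightarrow> 'a \<times> 'v \<Rightarrow> 'l)
    \<Rightarrow> ('a \<Rightarrow> 'v) \<Rightarrow> ('a \<times> 'v, 'l) multi_op"
  where "I_map S N l \<D> \<nu> =
    unary (total_space S N) (bundle_over_total S N l) (\<D> (vertical_lift S N \<nu>))"

text \<open>
  The bracket \<open>m\<^sub>k\<close> on sections of \<open>N\<close> (\<open>k\<close> is the length of the list).  All intermediate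
  operators have arity 2, as bracketing with a unary operator preserves the arity.
\<close>

definition m_bracket ::
  "('a, 'e::euclidean_space) manifold \<Rightarrow> ('a, 'g::euclidean_space, 'v::real_vector) vbundle
    \<Rightarrow> ('a, 'f::euclidean_space, 'l::real_vector) vbundle
    \<Rightarrow> ((('a \<times> 'v \<Rightarrow> real) \<Rightarrow> 'a \<times> 'v \<Rightarrow> real) \<Rightarrow> ('a \<times> 'v \<Rightarrow> 'l) \<Rightarrow> 'a \<times> 'v \<Rightarrow> 'l)
    \<Rightarrow> ('a \<times> 'v, 'l) multi_op \<Rightarrow> ('a \<Rightarrow> 'v) list \<Rightarrow> ('a, 'v, 'l) conormal_form"
  where "m_bracket S N l \<D> J \<xi>s = proj_P S N l
    (foldl (\<lambda>B \<xi>. SJ (total_space S N) (bundle_over_total S N l) 2 1 B (I_map S N l \<D> \<xi>)) J \<xi>s)"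


section \<open>Formal power series\<close>

text \<open>
  A formal power series with coefficients in a vector space is the sequence of its coefficients.
  Infinite sums of power series are taken coefficientwise; \<open>Sum_any\<close> is the sum of
  the nonzero terms, of which each coefficient has only finitely many when \<open>s\<^sub>0 = 0\<close>.
\<close>

definition m_bracket_formal ::
  "('a, 'e::euclidean_space) manifold \<Rightarrow> ('a, 'g::euclidean_space, 'v::real_vector) vbundle
    \<Rightarrow> ('a, 'f::euclidean_space, 'l::real_vector) vbundle
    \<Rightarrow> ((('a \<times> 'v \<Rightarrow> real) \<Rightarrow> 'a \<times> 'v \<Rightarrow> real) \<Rightarrow> ('a \<times> 'v \<Rightarrow> 'l) \<Rightarrow> 'a \<times> 'v \<Rightarrow> 'l)
    \<Rightarrow> ('a \<times> 'v, 'l) multi_op \<Rightarrow> (nat \<Rightarrow> 'a \<Rightarrow> 'v) list \<Rightarrow> nat \<Rightarrow> ('a, 'v, 'l) conormal_form"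
  where "m_bracket_formal S N l \<D> J \<xi>s n =
    (\<Sum>is\<in>{is. length is = length \<xi>s \<and> sum_list is = n}.
      m_bracket S N l \<D> J (map (\<lambda>(\<xi>, i). \<xi> i) (zip \<xi>s is)))"

definition MC ::
  "('a, 'e::euclidean_space) manifold \<Rightarrow> ('a, 'g::euclidean_space, 'v::real_vector) vbundle
    \<Rightarrow> ('a, 'f::euclidean_space, 'l::real_vector) vbundle
    \<Rightarrow> ((('a \<times> 'v \<Rightarrow> real) \<Rightarrow> 'a \<times> 'v \<Rightarrow> real) \<Rightarrow> ('a \<times> 'v \<Rightarrow> 'l) \<Rightarrow> 'a \<times> 'v \<Rightarrow> 'l)
    \<Rightarrow> ('a \<times> 'v, 'l) multi_op \<Rightarrow> (nat \<Rightarrow> 'a \<Rightarrow> 'v) \<Rightarrow> nat \<Rightarrow> ('a, 'v, 'l) conormal_form"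
  where "MC S N l \<D> J \<xi> n = Sum_any (\<lambda>k. if 1 \<le> k
    then (1 / fact k :: real) *\<^sub>R m_bracket_formal S N l \<D> J (replicate k \<xi>) n else 0)"

text \<open>\<open>[\<xi>(\<epsilon>), -]\<close> on series of operators of arity \<open>q\<close>, for a series \<open>\<xi>\<close> of unary operators.\<close>

definition lie_op ::
  "('a, 'e::euclidean_space) manifold \<Rightarrow> ('a, 'f::euclidean_space, 'l::real_vector) vbundle \<Rightarrow> nat
    \<Rightarrow> (nat \<Rightarrow> ('a, 'l) multi_op) \<Rightarrow> (nat \<Rightarrow> ('a, 'l) multi_op) \<Rightarrow> nat \<Rightarrow> ('a, 'l) multi_op"
  where "lie_op M L q \<xi> B n = (\<Sum>i\<le>n. SJ M L 1 q (\<xi> i) (B (n - i)))"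

definition exp_lie ::
  "('a, 'e::euclidean_space) manifold \<Rightarrow> ('a, 'f::euclidean_space, 'l::real_vector) vbundle \<Rightarrow> nat
    \<Rightarrow> (nat \<Rightarrow> ('a, 'l) multi_op) \<Rightarrow> (nat \<Rightarrow> ('a, 'l) multi_op) \<Rightarrow> nat \<Rightarrow> ('a, 'l) multi_op"
  where "exp_lie M L q \<xi> B n = Sum_any (\<lambda>j. (1 / fact j :: real) *\<^sub>R (lie_op M L q \<xi> ^^ j) B n)"

definition const_series :: "'b::zero \<Rightarrow> nat \<Rightarrow> 'b"
  where "const_series b n = (if n = 0 then b else 0)"

definition formal_deformation ::
  "('a, 'e::euclidean_space) manifold \<Rightarrow> ('a, 'g::euclidean_space, 'v::real_vector) vbundle
    \<Rightarrow> (nat \<Rightarrow> 'a \<Rightarrow> 'v) \<Rightarrow> bool"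
  where "formal_deformation S N s \<longleftrightarrow> (\<forall>i. s i \<in> sections S N) \<and> s 0 = 0"

definition formally_coisotropic ::
  "('a, 'e::euclidean_space) manifold \<Rightarrow> ('a, 'g::euclidean_space, 'v::real_vector) vbundle
    \<Rightarrow> ('a, 'f::euclidean_space, 'l::real_vector) vbundle
    \<Rightarrow> ((('a \<times> 'v \<Rightarrow> real) \<Rightarrow> 'a \<times> 'v \<Rightarrow> real) \<Rightarrow> ('a \<times> 'v \<Rightarrow> 'l) \<Rightarrow> 'a \<times> 'v \<Rightarrow> 'l)
    \<Rightarrow> ('a \<times> 'v, 'l) multi_op \<Rightarrow> (nat \<Rightarrow> 'a \<Rightarrow> 'v) \<Rightarrow> bool"
  where "formally_coisotropic S N l \<D> J s \<longleftrightarrow>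
    (\<forall>n. proj_P S N l (exp_lie (total_space S N) (bundle_over_total S N l) 2
      (\<lambda>i. I_map S N l \<D> (s i)) (const_series J) n) = 0)"

end

(*
  Since [xi, B] = -[B, xi] for a unary xi and I is linear, the term of order k of
  exp(L_{I(s)}) J is the k-fold bracket [...[J, I(-s)], ..., I(-s)] / k!, so that
  P(exp(L_{I(s)}) J) = P J + MC(-s).  It remains to see that P J = 0, which is the coisotropy
  of S: a conormal covector at x is represented by f s with f vanishing on S, and after cutting
  off near x the products f s are restrictions of products g u on the ambient manifold with g
  vanishing on S, for which {g u, g' u'} vanishes at x.
*)
theory Submission
  imports Defs "HOL-Real_Asymp.Real_Asymp"
begin

text \<open>Choices by \<open>SOME\<close> stand between the definitions and the computation. The
  Hamiltonian field in the coisotropy condition is a chosen symbol, so every first order operator on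
  a line bundle has to be shown to possess one; and \<open>P\<close> evaluates on chosen jets and
  chosen representatives, so every conormal covector has to be shown to come from a pair
  \<open>f\<close>, \<open>s\<close>. Both demand global functions and sections built from local
  ones, which accounts for the calculus and the cutoff functions.

  Bundles are given by trivialisations that are smooth for each fixed fibre vector. The passage to
  varying vectors, by linearity and a finite basis, is the recurring device: it yields the charts of
  the total space, the smoothness of vertical lifts and that of pushed-forward sections.

  The induced structure on the normal bundle is tied to the given one on pulled-back sections only;
  this forces the detour through the ambient manifold.\<close>

section \<open>Differential calculus on open subsets of subspaces\<close>

text \<open>A case distinction is enough: beyond order 0 the function enters only through its first
  derivative, and the higher conditions concern the derivative witness.\<close>

lemma Ck_on_cong:
  assumes "\<And>x. x \<in> W \<Longrightarrow> f x = g x"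
  shows "Ck_on k V W f \<longleftrightarrow> Ck_on k V W g"
proof (cases k)
  case 0
  then show ?thesis using assms by (simp cong: continuous_on_cong)
next
  case (Suc k)
  have *: "(f has_derivative f') (at x within W) \<longleftrightarrow> (g has_derivative f') (at x within W)"
    if "x \<in> W" for x f'
    using has_derivative_transform[OF that] assms that by metis
  show ?thesis using * by (simp add: Suc)
qed

lemma Ck_on_eqI: "Ck_on k V W f \<Longrightarrow> (\<And>x. x \<in> W \<Longrightarrow> g x = f x) \<Longrightarrow> Ck_on k V W g"
  using Ck_on_cong[of W g f] by blast

lemma Ck_on_const: "Ck_on k V W (\<lambda>x. c)"
proof (induction k arbitrary: c)
  case (Suc k)
  have "\<forall>x\<in>W. ((\<lambda>x. c) has_derivative (\<lambda>x v. 0) x) (at x within W)" by simp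
  then show ?case using Suc[of 0] unfolding Ck_on.simps
    by (intro exI[of _ "\<lambda>x v. 0"] conjI) auto
qed simp

lemma Ck_on_subset:
  "Ck_on k V W f \<Longrightarrow> V' \<subseteq> V \<Longrightarrow> W' \<subseteq> W \<Longrightarrow> Ck_on k V' W' f"
proof (induction k arbitrary: f)
  case 0
  then show ?case by (auto intro: continuous_on_subset)
next
  case (Suc k)
  then obtain f' where f': "\<forall>x\<in>W. (f has_derivative f' x) (at x within W)"
    and Ck: "\<forall>v\<in>V. Ck_on k V W (\<lambda>x. f' x v)" by auto
  have "\<forall>x\<in>W'. (f has_derivative f' x) (at x within W')"
    using f' Suc.prems(3) by (meson has_derivative_subset subsetD)
  moreover have "\<forall>v\<in>V'. Ck_on k V' W' (\<lambda>x. f' x v)"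
    using Suc.IH Ck Suc.prems(2,3) by blast
  ultimately show ?case by auto
qed

lemma Ck_on_linear:
  assumes "bounded_linear h"
  shows "Ck_on k V W h"
proof (cases k)
  case 0
  then show ?thesis using assms by (simp add: linear_continuous_on)
next
  case (Suc k)
  have "\<forall>x\<in>W. (h has_derivative (\<lambda>x. h) x) (at x within W)"
    using assms by (simp add: bounded_linear_imp_has_derivative)
  then show ?thesis unfolding Suc Ck_on.simps
    by (intro exI[of _ "\<lambda>x. h"] conjI) (auto intro: Ck_on_const)
qed

lemma Ck_on_linear_comp:
  assumes h: "bounded_linear h"
  shows "Ck_on k V W f \<Longrightarrow> Ck_on k V W (\<lambda>x. h (f x))"
proof (induction k arbitrary: f)
  case 0
  then show ?case using h by (auto intro: bounded_linear.continuous_on)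
next
  case (Suc k)
  then obtain f' where f': "\<forall>x\<in>W. (f has_derivative f' x) (at x within W)"
    and Ck: "\<forall>v\<in>V. Ck_on k V W (\<lambda>x. f' x v)" by auto
  show ?case unfolding Ck_on.simps
  proof (intro exI[of _ "\<lambda>x v. h (f' x v)"] conjI ballI)
    fix x assume "x \<in> W"
    then show "((\<lambda>x. h (f x)) has_derivative (\<lambda>v. h (f' x v))) (at x within W)"
      using f' bounded_linear.has_derivative[OF h] by blast
  qed (use Suc.IH Ck in blast)
qed

lemma Ck_on_add:
  "Ck_on k V W f \<Longrightarrow> Ck_on k V W g \<Longrightarrow> Ck_on k V W (\<lambda>x. f x + g x)"
proof (induction k arbitrary: f g)
  case 0
  then show ?case by (auto intro: continuous_on_add)
next
  case (Suc k)
  from Suc.prems obtain f' where f': "\<forall>x\<in>W. (f has_derivative f' x) (at x within W)"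
    and Ckf: "\<forall>v\<in>V. Ck_on k V W (\<lambda>x. f' x v)" by auto
  from Suc.prems obtain g' where g': "\<forall>x\<in>W. (g has_derivative g' x) (at x within W)"
    and Ckg: "\<forall>v\<in>V. Ck_on k V W (\<lambda>x. g' x v)" by auto
  show ?case unfolding Ck_on.simps
  proof (intro exI[of _ "\<lambda>x v. f' x v + g' x v"] conjI ballI)
    fix x assume "x \<in> W"
    then show "((\<lambda>x. f x + g x) has_derivative (\<lambda>v. f' x v + g' x v)) (at x within W)"
      using f' g' has_derivative_add by blast
  qed (use Suc.IH Ckf Ckg in blast)
qed

lemma Ck_on_sum:
  assumes "\<And>i. i \<in> A \<Longrightarrow> Ck_on k V W (f i)"
  shows "Ck_on k V W (\<lambda>x. \<Sum>i\<in>A. f i x)"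
proof (cases "finite A")
  case True
  then show ?thesis using assms
    by (induction A rule: finite_induct) (auto intro: Ck_on_const Ck_on_add)
qed (simp add: Ck_on_const)

lemma Ck_on_Suc_imp: "Ck_on (Suc k) V W f \<Longrightarrow> Ck_on k V W f"
proof (induction k arbitrary: f)
  case 0
  then obtain f' where f': "\<forall>x\<in>W. (f has_derivative f' x) (at x within W)" by auto
  have "continuous_on W f"
    unfolding continuous_on_eq_continuous_within
    using f' has_derivative_continuous by blast
  then show ?case by simp
next
  case (Suc k)
  from Suc.prems obtain f' where f': "\<forall>x\<in>W. (f has_derivative f' x) (at x within W)"
    and Ckf: "\<forall>v\<in>V. Ck_on (Suc k) V W (\<lambda>x. f' x v)" by auto
  have "\<forall>v\<in>V. Ck_on k V W (\<lambda>x. f' x v)" using Ckf Suc.IH by blast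
  with f' show ?case by auto
qed

text \<open>In the Leibniz rule one factor of each summand is left undifferentiated, so the
  induction also needs the given functions at the lower order.\<close>

lemma Ck_on_bilinear:
  assumes h: "bounded_bilinear h"
  shows "Ck_on k V W f \<Longrightarrow> Ck_on k V W g \<Longrightarrow> Ck_on k V W (\<lambda>x. h (f x) (g x))"
proof (induction k arbitrary: f g)
  case 0
  then show ?case using h by (auto intro: bounded_bilinear.continuous_on)
next
  case (Suc k)
  from Suc.prems obtain f' where f': "\<forall>x\<in>W. (f has_derivative f' x) (at x within W)"
    and Ckf: "\<forall>v\<in>V. Ck_on k V W (\<lambda>x. f' x v)" by auto
  from Suc.prems obtain g' where g': "\<forall>x\<in>W. (g has_derivative g' x) (at x within W)"
    and Ckg: "\<forall>v\<in>V. Ck_on k V W (\<lambda>x. g' x v)" by auto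
  have "Ck_on k V W f" "Ck_on k V W g" using Suc.prems Ck_on_Suc_imp by blast+
  show ?case unfolding Ck_on.simps
  proof (intro exI[of _ "\<lambda>x v. h (f x) (g' x v) + h (f' x v) (g x)"] conjI ballI)
    fix x assume "x \<in> W"
    then show "((\<lambda>x. h (f x) (g x)) has_derivative (\<lambda>v. h (f x) (g' x v) + h (f' x v) (g x)))
      (at x within W)"
      using f' g' bounded_bilinear.FDERIV[OF h] by blast
  next
    fix v assume "v \<in> V"
    then show "Ck_on k V W (\<lambda>x. h (f x) (g' x v) + h (f' x v) (g x))"
      using Ckf Ckg \<open>Ck_on k V W f\<close> \<open>Ck_on k V W g\<close> by (intro Ck_on_add Suc.IH) auto
  qed
qed

text \<open>The coordinates are inner products, hence bounded linear on the whole Euclidean space.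
  Linear maps defined only on a subspace can thus be expanded into finite sums with smooth
  coefficients.\<close>

lemma orthonormal_basis_coordinates:
  fixes T :: "'a::euclidean_space set"
  assumes "subspace T"
  obtains B where "finite B" "B \<subseteq> T" "\<forall>c\<in>T. (\<Sum>b\<in>B. (c \<bullet> b) *\<^sub>R b) = c"
proof -
  obtain B where B: "B \<subseteq> T" "pairwise orthogonal B" "\<And>x. x \<in> B \<Longrightarrow> norm x = 1"
      "independent B" "span B = T"
    using orthonormal_basis_subspace[OF assms] by metis
  show ?thesis
    by (rule that[of B]) (use B orthonormal_basis_expand[OF B(2,3)] in \<open>auto simp: independent_imp_finite\<close>)
qed

text \<open>
  The derivative of \<open>f\<close> is projected to \<open>V'\<close>, which makes the values of its derivative
  expandable in a basis of \<open>V'\<close> without discussing uniqueness of derivatives.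
\<close>

lemma Ck_on_compose:
  fixes f :: "'a::euclidean_space \<Rightarrow> 'b::euclidean_space"
  assumes V': "subspace V'" "W' \<subseteq> V'" and sub: "f ` W \<subseteq> W'"
  shows "Ck_on k V' W' g \<Longrightarrow> Ck_on k V W f \<Longrightarrow> Ck_on k V W (\<lambda>x. g (f x))"
proof (induction k arbitrary: g)
  case 0
  then show ?case using sub by (auto intro: continuous_on_compose2)
next
  case (Suc k)
  from Suc.prems obtain f' where f': "\<forall>x\<in>W. (f has_derivative f' x) (at x within W)"
    and Ckf: "\<forall>v\<in>V. Ck_on k V W (\<lambda>x. f' x v)" by auto
  from Suc.prems obtain g' where g': "\<forall>x\<in>W'. (g has_derivative g' x) (at x within W')"
    and Ckg: "\<forall>v\<in>V'. Ck_on k V' W' (\<lambda>x. g' x v)" by auto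
  have Cf: "Ck_on k V W f" using Suc.prems Ck_on_Suc_imp by blast
  obtain B where B: "finite B" "B \<subseteq> V'" "\<forall>y\<in>V'. (\<Sum>b\<in>B. (y \<bullet> b) *\<^sub>R b) = y"
    by (rule orthonormal_basis_coordinates[OF V'(1)])
  define \<pi> where "\<pi> = (\<lambda>y::'b. \<Sum>b\<in>B. (y \<bullet> b) *\<^sub>R b)"
  have \<pi>lin: "bounded_linear \<pi>" unfolding \<pi>_def
    by (intro bounded_linear_sum bounded_linear_scaleR_const bounded_linear_inner_left)
  have \<pi>id: "\<pi> y = y" if "y \<in> V'" for y using B(3) that by (simp add: \<pi>_def)
  define F where "F = (\<lambda>x v. \<pi> (f' x v))"
  have F: "(f has_derivative F x) (at x within W)" if "x \<in> W" for x
  proof -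
    have "f y = \<pi> (f y)" if "y \<in> W" for y
      by (rule \<pi>id[symmetric]) (use sub V'(2) that in blast)
    moreover have "((\<lambda>x. \<pi> (f x)) has_derivative F x) (at x within W)"
      unfolding F_def using f' that bounded_linear.has_derivative[OF \<pi>lin] by blast
    ultimately show ?thesis by (rule has_derivative_transform[OF that])
  qed
  have gd: "bounded_linear (g' x)" if "x \<in> W'" for x using g' that has_derivative_bounded_linear by blast
  \<comment> \<open>After this expansion the derivative of \<open>g\<close> is applied to fixed
    basis vectors only, where the induction hypothesis is available.\<close>
  have expand: "g' (f x) (F x v) = (\<Sum>b\<in>B. (f' x v \<bullet> b) *\<^sub>R g' (f x) b)" if "x \<in> W" for x v
  proof -
    have "linear (g' (f x))" using gd that sub by (simp add: bounded_linear.linear image_subset_iff)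
    then show ?thesis unfolding F_def \<pi>_def by (simp add: linear_sum linear_scale)
  qed
  show ?case unfolding Ck_on.simps
  proof (intro exI[of _ "\<lambda>x v. g' (f x) (F x v)"] conjI ballI)
    fix x assume x: "x \<in> W"
    then have "(g has_derivative g' (f x)) (at (f x) within f ` W)"
      using g' sub by (meson has_derivative_subset image_subset_iff)
    then show "((\<lambda>x. g (f x)) has_derivative (\<lambda>v. g' (f x) (F x v))) (at x within W)"
      using has_derivative_in_compose[OF F[OF x]] by simp
  next
    fix v assume v: "v \<in> V"
    have "Ck_on k V W (\<lambda>x. \<Sum>b\<in>B. (f' x v \<bullet> b) *\<^sub>R g' (f x) b)"
    proof (intro Ck_on_sum Ck_on_bilinear[OF bounded_bilinear_scaleR])
      fix b assume b: "b \<in> B"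
      show "Ck_on k V W (\<lambda>x. f' x v \<bullet> b)"
        using Ck_on_linear_comp[OF bounded_linear_inner_left] Ckf v by blast
      show "Ck_on k V W (\<lambda>x. g' (f x) b)" using Suc.IH[of "\<lambda>y. g' y b"] Ckg b B(2) Cf by auto
    qed
    then show "Ck_on k V W (\<lambda>x. g' (f x) (F x v))" by (rule Ck_on_eqI) (rule expand)
  qed
qed

text \<open>The derivative witness in \<open>Ck_on\<close> is merely asserted to exist. On a
  relatively open set this expression agrees with every witness along directions of the model
  subspace, and it depends on \<open>f\<close> alone.\<close>

definition dir_deriv :: "('a::real_normed_vector \<Rightarrow> 'b::real_normed_vector) \<Rightarrow> 'a \<Rightarrow> 'a \<Rightarrow> 'b"
  where "dir_deriv f x v = vector_derivative (\<lambda>t. f (x + t *\<^sub>R v)) (at 0)"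

lemma has_vector_derivative_line:
  assumes V: "subspace V" and W: "openin (top_of_set V) W" and x: "x \<in> W" and v: "v \<in> V"
    and f: "(f has_derivative f') (at x within W)"
  shows "((\<lambda>t. f (x + t *\<^sub>R v)) has_vector_derivative f' v) (at 0)"
proof -
  define T where "T = {t. x + t *\<^sub>R v \<in> W}"
  obtain O' where O': "open O'" "W = V \<inter> O'" using W openin_open by metis
  \<comment> \<open>The line stays in \<open>V\<close>, so staying in \<open>W\<close> is an open
    condition on the parameter.\<close>
  have "T = (\<lambda>t. x + t *\<^sub>R v) -` O'"
    using O' x v V by (auto simp: T_def subspace_add subspace_scale)
  then have T: "open T"
    using O'(1) by (simp add: open_vimage continuous_intros)
  have "((\<lambda>t. x + t *\<^sub>R v) has_derivative (\<lambda>t. t *\<^sub>R v)) (at 0 within T)"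
    by (auto intro!: derivative_eq_intros)
  moreover have "(f has_derivative f') (at (x + 0 *\<^sub>R v) within (\<lambda>t. x + t *\<^sub>R v) ` T)"
    using f by (rule_tac has_derivative_subset) (auto simp: T_def)
  ultimately have "((\<lambda>t. f (x + t *\<^sub>R v)) has_derivative (\<lambda>t. f' (t *\<^sub>R v))) (at 0 within T)"
    using has_derivative_in_compose by fastforce
  moreover have "0 \<in> T" using x by (simp add: T_def)
  moreover have "f' (t *\<^sub>R v) = t *\<^sub>R f' v" for t
    using f has_derivative_bounded_linear bounded_linear.linear linear_scale by metis
  ultimately show ?thesis unfolding has_vector_derivative_def
    using at_within_open[OF _ T] by simp
qed

lemma dir_deriv_eq:
  assumes "subspace V" "openin (top_of_set V) W" "x \<in> W" "v \<in> V"
    and "(f has_derivative f') (at x within W)"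
  shows "dir_deriv f x v = f' v"
  unfolding dir_deriv_def using has_vector_derivative_line[OF assms] vector_derivative_at by blast

lemma Ck_on_dir_deriv:
  assumes "subspace V" "openin (top_of_set V) W" "Ck_on (Suc k) V W f" "v \<in> V"
  shows "Ck_on k V W (\<lambda>x. dir_deriv f x v)"
proof -
  from assms(3) obtain f' where f': "\<forall>x\<in>W. (f has_derivative f' x) (at x within W)"
    and Ckf: "\<forall>v\<in>V. Ck_on k V W (\<lambda>x. f' x v)" by auto
  have eq: "dir_deriv f x v = f' x v" if "x \<in> W" for x
    by (rule dir_deriv_eq[OF assms(1,2) that assms(4)]) (use f' that in blast)
  have "Ck_on k V W (\<lambda>x. f' x v)" using Ckf assms(4) by blast
  then show ?thesis by (rule Ck_on_eqI) (rule eq)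
qed

text \<open>Witnesses of the local pieces need not match, so the global witness is taken to be
  \<open>frechet_derivative\<close>. Along \<open>V\<close> its values are directional derivatives,
  which are locally of class C^k and so fall under the induction hypothesis.\<close>

lemma Ck_on_local:
  assumes V: "subspace V" and W: "openin (top_of_set V) W"
  shows "(\<And>x. x \<in> W \<Longrightarrow> \<exists>A. openin (top_of_set V) A \<and> x \<in> A \<and> Ck_on k V (W \<inter> A) f) \<Longrightarrow> Ck_on k V W f"
proof (induction k arbitrary: f)
  case 0
  show ?case unfolding Ck_on.simps continuous_on_eq_continuous_within
  proof
    fix x assume x: "x \<in> W"
    from 0[OF x] obtain A where A: "openin (top_of_set V) A" "x \<in> A" "continuous_on (W \<inter> A) f" by auto
    obtain B where B: "open B" "A = V \<inter> B" using A(1) openin_open by metis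
    have "at x within W = at x within (W \<inter> A)"
      using B A(2) openin_imp_subset[OF W] by (intro at_within_nhd[of x B]) auto
    then show "continuous (at x within W) f"
      using A x by (simp add: continuous_on_eq_continuous_within)
  qed
next
  case (Suc k)
  have *: "\<exists>A f'. openin (top_of_set V) A \<and> x \<in> A \<and> Ck_on (Suc k) V (W \<inter> A) f
    \<and> (f has_derivative f') (at x within W)" if x: "x \<in> W" for x
  proof -
    from Suc(2)[OF x] obtain A where A: "openin (top_of_set V) A" "x \<in> A" "Ck_on (Suc k) V (W \<inter> A) f" by blast
    obtain B where B: "open B" "A = V \<inter> B" using A(1) openin_open by metis
    have "at x within W = at x within (W \<inter> A)"
      using B A(2) openin_imp_subset[OF W] by (intro at_within_nhd[of x B]) auto
    with A x show ?thesis by auto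
  qed
  show ?case unfolding Ck_on.simps
  proof (intro exI[of _ "\<lambda>x v. frechet_derivative f (at x within W) v"] conjI ballI)
    fix x assume "x \<in> W"
    then show "(f has_derivative frechet_derivative f (at x within W)) (at x within W)"
      using * differentiableI frechet_derivative_works by blast
  next
    fix v assume v: "v \<in> V"
    have eq: "frechet_derivative f (at x within W) v = dir_deriv f x v" if "x \<in> W" for x
      using * that differentiableI frechet_derivative_works dir_deriv_eq[OF V W that v] by metis
    have "Ck_on k V W (\<lambda>x. dir_deriv f x v)"
    proof (rule Suc.IH)
      fix x assume x: "x \<in> W"
      obtain A where A: "openin (top_of_set V) A" "x \<in> A" "Ck_on (Suc k) V (W \<inter> A) f"
        using *[OF x] by blast
      then have "Ck_on k V (W \<inter> A) (\<lambda>x. dir_deriv f x v)"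
        using V W v by (intro Ck_on_dir_deriv) auto
      with A show "\<exists>A. openin (top_of_set V) A \<and> x \<in> A \<and> Ck_on k V (W \<inter> A) (\<lambda>x. dir_deriv f x v)" by blast
    qed
    then show "Ck_on k V W (\<lambda>x. frechet_derivative f (at x within W) v)"
      by (rule Ck_on_eqI) (rule eq)
  qed
qed

section \<open>Smoothness of all orders: closure properties\<close>

lemma smooth_on_cong: "(\<And>x. x \<in> W \<Longrightarrow> f x = g x) \<Longrightarrow> smooth_on V W f \<longleftrightarrow> smooth_on V W g"
  unfolding smooth_on_def using Ck_on_cong by blast

lemma smooth_on_eqI: "smooth_on V W f \<Longrightarrow> (\<And>x. x \<in> W \<Longrightarrow> g x = f x) \<Longrightarrow> smooth_on V W g"
  using smooth_on_cong[of W g f] by blast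

lemma smooth_on_const: "smooth_on V W (\<lambda>x. c)"
  unfolding smooth_on_def using Ck_on_const by blast

lemma smooth_on_subset: "smooth_on V W f \<Longrightarrow> V' \<subseteq> V \<Longrightarrow> W' \<subseteq> W \<Longrightarrow> smooth_on V' W' f"
  unfolding smooth_on_def using Ck_on_subset by blast

lemma smooth_on_linear: "bounded_linear h \<Longrightarrow> smooth_on V W h"
  unfolding smooth_on_def using Ck_on_linear by blast

lemma smooth_on_add: "smooth_on V W f \<Longrightarrow> smooth_on V W g \<Longrightarrow> smooth_on V W (\<lambda>x. f x + g x)"
  by (simp add: smooth_on_def Ck_on_add)

lemma smooth_on_sum:
  "(\<And>i. i \<in> A \<Longrightarrow> smooth_on V W (f i)) \<Longrightarrow> smooth_on V W (\<lambda>x. \<Sum>i\<in>A. f i x)"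
  by (simp add: smooth_on_def Ck_on_sum)

lemma smooth_on_bilinear:
  "bounded_bilinear h \<Longrightarrow> smooth_on V W f \<Longrightarrow> smooth_on V W g \<Longrightarrow> smooth_on V W (\<lambda>x. h (f x) (g x))"
  by (simp add: smooth_on_def Ck_on_bilinear)

lemma smooth_on_linear_comp:
  "bounded_linear h \<Longrightarrow> smooth_on V W f \<Longrightarrow> smooth_on V W (\<lambda>x. h (f x))"
  by (simp add: smooth_on_def Ck_on_linear_comp)

lemma smooth_on_compose:
  assumes "smooth_on V' W' g" "smooth_on V W f" "subspace V'" "W' \<subseteq> V'" "f ` W \<subseteq> W'"
  shows "smooth_on V W (\<lambda>x. g (f x))"
  using assms(1,2) by (simp add: smooth_on_def Ck_on_compose[OF assms(3-5)])

lemma smooth_on_local: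
  assumes "subspace V" and "openin (top_of_set V) W"
    and "\<And>x. x \<in> W \<Longrightarrow> \<exists>A. openin (top_of_set V) A \<and> x \<in> A \<and> smooth_on V (W \<inter> A) f"
  shows "smooth_on V W f"
  unfolding smooth_on_def
proof
  fix k
  show "Ck_on k V W f"
  proof (rule Ck_on_local[OF assms(1,2)])
    fix x assume "x \<in> W"
    from assms(3)[OF this] obtain A where "openin (top_of_set V) A" "x \<in> A" "smooth_on V (W \<inter> A) f"
      by blast
    then show "\<exists>A. openin (top_of_set V) A \<and> x \<in> A \<and> Ck_on k V (W \<inter> A) f"
      by (auto simp: smooth_on_def)
  qed
qed

lemma smooth_on_dir_deriv:
  assumes "subspace V" "openin (top_of_set V) W" "smooth_on V W f" "v \<in> V"
  shows "smooth_on V W (\<lambda>x. dir_deriv f x v)"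
  using assms Ck_on_dir_deriv unfolding smooth_on_def by blast

lemma smooth_on_has_derivative:
  assumes "smooth_on V W f" "x \<in> W"
  shows "(f has_derivative frechet_derivative f (at x within W)) (at x within W)"
proof -
  have "Ck_on (Suc 0) V W f" using assms smooth_on_def by blast
  then have "f differentiable at x within W"
    using assms(2) unfolding Ck_on.simps by (meson differentiableI)
  then show ?thesis using frechet_derivative_works by blast
qed

lemma smooth_on_imp_continuous_on: "smooth_on V W f \<Longrightarrow> continuous_on W f"
  unfolding smooth_on_def using Ck_on.simps(1) by blast

lemma smooth_on_Pair:
  assumes "smooth_on V W f" "smooth_on V W g"
  shows "smooth_on V W (\<lambda>x. (f x, g x))"
proof -
  have "smooth_on V W (\<lambda>x. (f x, 0) + (0, g x))"
    using assms
    by (intro smooth_on_add smooth_on_linear_comp[where h="\<lambda>y. (y, 0)"]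
        smooth_on_linear_comp[where h="\<lambda>y. (0, y)"]) (auto intro!: bounded_linear_intros)
  then show ?thesis by simp
qed

section \<open>Cutoff functions\<close>

text \<open>Allowing a power of 1/t in front of exp(- 1/t) makes the family closed under
  differentiation up to linear combinations, so all orders of smoothness follow by one
  induction.\<close>

definition flat_exp :: "nat \<Rightarrow> real \<Rightarrow> real"
  where "flat_exp n t = (if t > 0 then (1 / t) ^ n * exp (- 1 / t) else 0)"

lemma flat_exp_deriv:
  "(flat_exp n has_real_derivative flat_exp (n + 2) t - n * flat_exp (n + 1) t) (at t)"
proof -
  consider "t > 0" | "t < 0" | "t = 0" by linarith
  then show ?thesis
  proof cases
    case 1
    have "((\<lambda>t. (1 / t) ^ n * exp (- 1 / t)) has_real_derivative
        (n * (1 / t) ^ (n - 1) * (- 1 / t\<^sup>2)) * exp (- 1 / t) + (1 / t) ^ n * (exp (- 1 / t) * (1 / t\<^sup>2))) (at t)"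
      using 1 by (auto intro!: derivative_eq_intros simp: power2_eq_square)
    moreover have "(n * (1 / t) ^ (n - 1) * (- 1 / t\<^sup>2)) * exp (- 1 / t) + (1 / t) ^ n * (exp (- 1 / t) * (1 / t\<^sup>2))
      = flat_exp (n + 2) t - n * flat_exp (n + 1) t"
      using 1 by (cases n) (simp_all add: flat_exp_def field_simps power2_eq_square)
    ultimately show ?thesis
      using 1 has_field_derivative_transform_within_open[of _ _ t "{0<..}" "flat_exp n"]
      by (simp add: flat_exp_def)
  next
    case 2
    have "((\<lambda>t. 0) has_real_derivative 0) (at t)" by simp
    then have "(flat_exp n has_real_derivative 0) (at t)"
      using 2 has_field_derivative_transform_within_open[of "\<lambda>t. 0" 0 t "{..<0}" "flat_exp n"]
      by (simp add: flat_exp_def)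
    then show ?thesis using 2 by (simp add: flat_exp_def)
  next
    case 3
    \<comment> \<open>The difference quotient from the right at 0 is the next member of the
      family.\<close>
    have r: "((\<lambda>t. (1 / t) ^ Suc n * exp (- 1 / t)) \<longlongrightarrow> (0::real)) (at_right 0)"
      by real_asymp
    have "((\<lambda>h. (flat_exp n (0 + h) - flat_exp n 0) / h) \<longlongrightarrow> 0) (at_right 0)"
      by (rule Lim_transform_eventually[OF r])
        (auto simp: flat_exp_def eventually_at_right_less intro!: eventually_mono[OF eventually_at_right_less])
    moreover have "((\<lambda>h. (flat_exp n (0 + h) - flat_exp n 0) / h) \<longlongrightarrow> 0) (at_left 0)"
      by (rule Lim_transform_eventually[OF tendsto_const])
        (auto simp: flat_exp_def eventually_at_filter)
    ultimately have "(flat_exp n has_real_derivative 0) (at 0)"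
      unfolding DERIV_def using filterlim_split_at by blast
    then show ?thesis using 3 by (simp add: flat_exp_def)
  qed
qed

lemma Ck_on_flat_exp: "Ck_on k UNIV UNIV (flat_exp n)"
proof (induction k arbitrary: n)
  case 0
  have "isCont (flat_exp n) t" for t using flat_exp_deriv DERIV_isCont by blast
  then show ?case by (simp add: continuous_at_imp_continuous_on)
next
  case (Suc k)
  define D where "D = (\<lambda>t v. v *\<^sub>R flat_exp (n + 2) t + (- real n * v) *\<^sub>R flat_exp (n + 1) t)"
  have "(flat_exp n has_derivative D t) (at t within UNIV)" for t
    using flat_exp_deriv[of n t] unfolding has_field_derivative_def D_def
    by (rule has_derivative_eq_rhs) (simp add: fun_eq_iff algebra_simps)
  moreover have "Ck_on k UNIV UNIV (\<lambda>t. D t v)" for v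
    unfolding D_def by (intro Ck_on_add Ck_on_linear_comp[OF bounded_linear_scaleR_right] Suc)
  ultimately show ?case by auto
qed

text \<open>Composing two flat exponentials replaces the usual quotient. The inner one vanishes on
  the small ball, which gives the normalised value 1; outside the large ball it is at least
  \<open>c\<close>, so the argument of the outer one is not positive there.\<close>

lemma smooth_cutoff:
  fixes V W :: "'a::euclidean_space set"
  assumes V: "subspace V" and W: "openin (top_of_set V) W" and p: "p \<in> W"
  obtains \<beta> :: "'a \<Rightarrow> real" and r where "smooth_on UNIV UNIV \<beta>" "r > 0"
    "\<And>x. x \<in> ball p r \<Longrightarrow> \<beta> x = 1" "\<And>x. x \<notin> cball p (2 * r) \<Longrightarrow> \<beta> x = 0" "cball p (2 * r) \<inter> V \<subseteq> W"
proof -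
  obtain B where B: "open B" "W = V \<inter> B" using W openin_open by metis
  then obtain e where e: "e > 0" "cball p e \<subseteq> B" using p open_contains_cball by blast
  define r where "r = e / 2"
  \<comment> \<open>The value of the inner function at distance 2 r, since (2 r)^2 - r^2 = 3
    r^2.\<close>
  define c where "c = flat_exp 0 (3 * r\<^sup>2)"
  have r: "r > 0" "cball p (2 * r) \<inter> V \<subseteq> W" using e B by (auto simp: r_def)
  have c: "c > 0" using r by (simp add: c_def flat_exp_def)
  define d where "d = (\<lambda>x::'a. (x - p) \<bullet> (x - p) - r\<^sup>2)"
  define \<beta> where "\<beta> = (\<lambda>x. (1 / flat_exp 0 c) *\<^sub>R flat_exp 0 (c - flat_exp 0 (d x)))"
  have lin: "smooth_on UNIV UNIV (\<lambda>x. x - p)"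
    using smooth_on_add[OF smooth_on_linear[OF bounded_linear_ident] smooth_on_const[of _ _ "- p"]] by simp
  have sd: "smooth_on UNIV UNIV d" unfolding d_def
    using smooth_on_add[OF smooth_on_bilinear[OF bounded_bilinear_inner lin lin] smooth_on_const[of _ _ "- r\<^sup>2"]]
    by simp
  have flat: "smooth_on UNIV UNIV (flat_exp n)" for n
    unfolding smooth_on_def using Ck_on_flat_exp by blast
  have comp: "smooth_on UNIV UNIV (\<lambda>x::'a. flat_exp 0 (h x))" if "smooth_on UNIV UNIV h" for h
    by (rule smooth_on_compose[OF flat that]) auto
  have "smooth_on UNIV UNIV (\<lambda>x. c + (-1) *\<^sub>R flat_exp 0 (d x))"
    by (intro smooth_on_add smooth_on_const smooth_on_linear_comp[OF bounded_linear_scaleR_right] comp sd)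
  then have "smooth_on UNIV UNIV (\<lambda>x. c - flat_exp 0 (d x))" by simp
  then have "smooth_on UNIV UNIV \<beta>" unfolding \<beta>_def
    by (intro smooth_on_linear_comp[OF bounded_linear_scaleR_right] comp)
  moreover have "\<beta> x = 1" if "x \<in> ball p r" for x
  proof -
    have "(norm (x - p))\<^sup>2 \<le> r\<^sup>2" using that by (intro power_mono) (auto simp: dist_norm norm_minus_commute)
    then have "d x \<le> 0" by (simp add: d_def power2_norm_eq_inner)
    then show ?thesis using c by (simp add: \<beta>_def flat_exp_def)
  qed
  moreover have "\<beta> x = 0" if "x \<notin> cball p (2 * r)" for x
  proof -
    have "(2 * r)\<^sup>2 \<le> (norm (x - p))\<^sup>2" using that r by (intro power_mono) (auto simp: dist_norm norm_minus_commute)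
    then have "3 * r\<^sup>2 \<le> d x" by (simp add: d_def power2_norm_eq_inner power_mult_distrib)
    moreover have "flat_exp 0 a \<le> flat_exp 0 b" if "0 < a" "a \<le> b" for a b
      using that by (simp add: flat_exp_def frac_le)
    moreover have "0 < 3 * r\<^sup>2" using r by simp
    ultimately have "c \<le> flat_exp 0 (d x)" unfolding c_def by blast
    then show ?thesis by (simp add: \<beta>_def flat_exp_def)
  qed
  ultimately show ?thesis using that r by blast
qed

section \<open>Manifolds without separation axioms\<close>

text \<open>
  Total spaces are treated as premanifolds: their Hausdorff property would only serve to construct
  cutoff functions, which can be pulled back from the ambient manifold instead.
\<close>

definition premanifold :: "('a, 'e::euclidean_space) manifold \<Rightarrow> bool"
  where "premanifold M \<longleftrightarrow> subspace (model M) \<and>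
    (\<forall>(D, \<phi>)\<in>atlas M. D \<subseteq> pts M \<and> inj_on \<phi> D \<and> openin (top_of_set (model M)) (\<phi> ` D)) \<and>
    (\<Union>(D, \<phi>)\<in>atlas M. D) = pts M \<and>
    (\<forall>(D, \<phi>)\<in>atlas M. \<forall>(D', \<psi>)\<in>atlas M.
      openin (top_of_set (model M)) (\<phi> ` (D \<inter> D')) \<and>
      smooth_on (model M) (\<phi> ` (D \<inter> D')) (\<psi> \<circ> inv_into D \<phi>))"

lemma smooth_manifold_imp_premanifold: "smooth_manifold M \<Longrightarrow> premanifold M"
  unfolding smooth_manifold_def premanifold_def by blast

context
  fixes M :: "('a, 'e::euclidean_space) manifold"
  assumes M: "premanifold M"
begin

lemma premanifold_model: "subspace (model M)"
  using M unfolding premanifold_def by blast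

lemma premanifold_chart:
  assumes "(D, \<phi>) \<in> atlas M"
  shows "D \<subseteq> pts M" "inj_on \<phi> D" "openin (top_of_set (model M)) (\<phi> ` D)"
  using M assms unfolding premanifold_def by auto

lemma premanifold_chart_model: "(D, \<phi>) \<in> atlas M \<Longrightarrow> x \<in> D \<Longrightarrow> \<phi> x \<in> model M"
  using premanifold_chart(3) openin_imp_subset by blast

lemma premanifold_cover:
  assumes "x \<in> pts M" obtains D \<phi> where "(D, \<phi>) \<in> atlas M" "x \<in> D"
  using M assms unfolding premanifold_def by blast

lemma premanifold_transition:
  assumes "(D, \<phi>) \<in> atlas M" "(D', \<psi>) \<in> atlas M"
  shows "openin (top_of_set (model M)) (\<phi> ` (D \<inter> D'))"
    "smooth_on (model M) (\<phi> ` (D \<inter> D')) (\<psi> \<circ> inv_into D \<phi>)"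
  using M assms unfolding premanifold_def by fastforce+

text \<open>\<open>mtop\<close> says something only once its predicate is known to be a topology.
  Closure under intersections comes from the injectivity of the charts.\<close>

lemma openin_mtop:
  "openin (mtop M) U \<longleftrightarrow> U \<subseteq> pts M \<and>
    (\<forall>(D, \<phi>)\<in>atlas M. openin (top_of_set (model M)) (\<phi> ` (U \<inter> D)))"
proof -
  let ?P = "\<lambda>U. U \<subseteq> pts M \<and> (\<forall>(D, \<phi>)\<in>atlas M. openin (top_of_set (model M)) (\<phi> ` (U \<inter> D)))"
  have "istopology ?P"
    unfolding istopology_def
  proof (intro conjI allI impI)
    fix U V assume U: "?P U" and V: "?P V"
    show "U \<inter> V \<subseteq> pts M" using U by blast
    show "\<forall>(D, \<phi>)\<in>atlas M. openin (top_of_set (model M)) (\<phi> ` (U \<inter> V \<inter> D))"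
    proof (clarify)
      fix D \<phi> assume D: "(D, \<phi>) \<in> atlas M"
      have "\<phi> ` (U \<inter> V \<inter> D) = \<phi> ` (U \<inter> D) \<inter> \<phi> ` (V \<inter> D)"
        using premanifold_chart(2)[OF D] by (auto simp: inj_on_def)
      moreover have "openin (top_of_set (model M)) (\<phi> ` (U \<inter> D))"
        "openin (top_of_set (model M)) (\<phi> ` (V \<inter> D))" using U V D by auto
      ultimately show "openin (top_of_set (model M)) (\<phi> ` (U \<inter> V \<inter> D))"
        by (simp only: openin_Int)
    qed
  next
    fix K assume K: "\<forall>U\<in>K. ?P U"
    show "\<Union>K \<subseteq> pts M" using K by blast
    show "\<forall>(D, \<phi>)\<in>atlas M. openin (top_of_set (model M)) (\<phi> ` (\<Union>K \<inter> D))"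
    proof (clarify)
      fix D \<phi> assume D: "(D, \<phi>) \<in> atlas M"
      have "\<phi> ` (\<Union>K \<inter> D) = (\<Union>U\<in>K. \<phi> ` (U \<inter> D))" by blast
      moreover have "openin (top_of_set (model M)) (\<Union>U\<in>K. \<phi> ` (U \<inter> D))"
        using K D by (intro openin_Union) auto
      ultimately show "openin (top_of_set (model M)) (\<phi> ` (\<Union>K \<inter> D))" by simp
    qed
  qed
  then show ?thesis unfolding mtop_def by (simp only: topology_inverse')
qed

lemma openin_mtop_chart: "(D, \<phi>) \<in> atlas M \<Longrightarrow> openin (mtop M) D"
  unfolding openin_mtop using premanifold_chart(1) premanifold_transition(1)
  by (fastforce simp: Int_commute)

lemma openin_mtop_pts: "openin (mtop M) (pts M)"
  unfolding openin_mtop using premanifold_chart by (auto simp: Int_absorb1)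

lemma topspace_mtop: "topspace (mtop M) = pts M"
  using openin_mtop_pts openin_mtop openin_topspace openin_subset by (metis subset_antisym)

lemma openin_chart_image:
  "(D, \<phi>) \<in> atlas M \<Longrightarrow> openin (mtop M) U \<Longrightarrow> openin (top_of_set (model M)) (\<phi> ` (D \<inter> U))"
  unfolding openin_mtop by (auto simp: Int_commute)

lemma smooth_fun_eqI:
  "smooth_fun M U g \<Longrightarrow> (\<And>x. x \<in> U \<Longrightarrow> h x = g x) \<Longrightarrow> smooth_fun M U h"
  unfolding smooth_fun_def
proof clarify
  fix D \<phi> assume g: "\<forall>(D, \<phi>)\<in>atlas M. smooth_on (model M) (\<phi> ` (D \<inter> U)) (g \<circ> inv_into D \<phi>)"
    and eq: "\<And>x. x \<in> U \<Longrightarrow> h x = g x" and D: "(D, \<phi>) \<in> atlas M"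
  from g D have "smooth_on (model M) (\<phi> ` (D \<inter> U)) (g \<circ> inv_into D \<phi>)" by blast
  then show "smooth_on (model M) (\<phi> ` (D \<inter> U)) (h \<circ> inv_into D \<phi>)"
    by (rule smooth_on_eqI) (use premanifold_chart(2)[OF D] eq in auto)
qed

lemma smooth_fun_subset: "smooth_fun M U g \<Longrightarrow> U' \<subseteq> U \<Longrightarrow> smooth_fun M U' g"
  unfolding smooth_fun_def
proof clarify
  fix D \<phi> assume g: "\<forall>(D, \<phi>)\<in>atlas M. smooth_on (model M) (\<phi> ` (D \<inter> U)) (g \<circ> inv_into D \<phi>)"
    and "U' \<subseteq> U" and D: "(D, \<phi>) \<in> atlas M"
  then have "smooth_on (model M) (\<phi> ` (D \<inter> U)) (g \<circ> inv_into D \<phi>)" "\<phi> ` (D \<inter> U') \<subseteq> \<phi> ` (D \<inter> U)"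
    by blast+
  then show "smooth_on (model M) (\<phi> ` (D \<inter> U')) (g \<circ> inv_into D \<phi>)"
    using smooth_on_subset by blast
qed

lemma smooth_fun_const: "smooth_fun M U (\<lambda>x. c)"
  unfolding smooth_fun_def by (auto simp: o_def smooth_on_const)

lemma smooth_fun_add: "smooth_fun M U g \<Longrightarrow> smooth_fun M U h \<Longrightarrow> smooth_fun M U (\<lambda>x. g x + h x)"
  unfolding smooth_fun_def by (auto simp: o_def intro!: smooth_on_add)

lemma smooth_fun_sum:
  "(\<And>i. i \<in> A \<Longrightarrow> smooth_fun M U (g i)) \<Longrightarrow> smooth_fun M U (\<lambda>x. \<Sum>i\<in>A. g i x)"
  unfolding smooth_fun_def by (auto simp: o_def intro!: smooth_on_sum)

lemma smooth_fun_bilinear: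
  "bounded_bilinear b \<Longrightarrow> smooth_fun M U g \<Longrightarrow> smooth_fun M U h \<Longrightarrow> smooth_fun M U (\<lambda>x. b (g x) (h x))"
  unfolding smooth_fun_def by (fastforce simp: o_def smooth_on_bilinear[of b])

lemma smooth_fun_linear_comp:
  "bounded_linear b \<Longrightarrow> smooth_fun M U g \<Longrightarrow> smooth_fun M U (\<lambda>x. b (g x))"
  unfolding smooth_fun_def by (fastforce simp: o_def smooth_on_linear_comp[of b])

lemma smooth_fun_compose:
  assumes "smooth_on V W h" "subspace V" "W \<subseteq> V" "smooth_fun M U g" "g ` U \<subseteq> W"
  shows "smooth_fun M U (\<lambda>x. h (g x))"
  unfolding smooth_fun_def
proof clarify
  fix D \<phi> assume D: "(D, \<phi>) \<in> atlas M"
  then have "smooth_on (model M) (\<phi> ` (D \<inter> U)) (g \<circ> inv_into D \<phi>)"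
    using assms(4) unfolding smooth_fun_def by blast
  then have "smooth_on (model M) (\<phi> ` (D \<inter> U)) (\<lambda>x. h ((g \<circ> inv_into D \<phi>) x))"
    by (rule smooth_on_compose[OF assms(1) _ assms(2,3)])
      (use premanifold_chart(2)[OF D] assms(5) in auto)
  then show "smooth_on (model M) (\<phi> ` (D \<inter> U)) ((\<lambda>x. h (g x)) \<circ> inv_into D \<phi>)" by (simp add: o_def)
qed

lemma smooth_fun_chart: "(D, \<phi>) \<in> atlas M \<Longrightarrow> smooth_fun M D \<phi>"
  unfolding smooth_fun_def using premanifold_transition(2) by blast

lemma smooth_fun_openin:
  assumes g: "smooth_fun M U g" and U: "openin (mtop M) U" and A: "open A"
  shows "openin (mtop M) {x \<in> U. g x \<in> A}"
  unfolding openin_mtop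
proof (intro conjI)
  show "{x \<in> U. g x \<in> A} \<subseteq> pts M" using U openin_mtop by blast
  show "\<forall>(D, \<phi>)\<in>atlas M. openin (top_of_set (model M)) (\<phi> ` ({x \<in> U. g x \<in> A} \<inter> D))"
  proof clarify
    fix D \<phi> assume D: "(D, \<phi>) \<in> atlas M"
    let ?W = "\<phi> ` (D \<inter> U)"
    have "continuous_on ?W (g \<circ> inv_into D \<phi>)"
      using g D unfolding smooth_fun_def by (blast intro: smooth_on_imp_continuous_on)
    then have "openin (top_of_set ?W) (?W \<inter> (g \<circ> inv_into D \<phi>) -` A)"
      using A continuous_openin_preimage_gen by blast
    moreover have "?W \<inter> (g \<circ> inv_into D \<phi>) -` A = \<phi> ` ({x \<in> U. g x \<in> A} \<inter> D)"
      using premanifold_chart(2)[OF D] by auto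
    ultimately show "openin (top_of_set (model M)) (\<phi> ` ({x \<in> U. g x \<in> A} \<inter> D))"
      using openin_chart_image[OF D U] openin_trans by metis
  qed
qed

lemma smooth_fun_local:
  assumes U: "openin (mtop M) U"
    and loc: "\<And>x. x \<in> U \<Longrightarrow> \<exists>A. openin (mtop M) A \<and> x \<in> A \<and> smooth_fun M (U \<inter> A) g"
  shows "smooth_fun M U g"
  unfolding smooth_fun_def
proof clarify
  fix D \<phi> assume D: "(D, \<phi>) \<in> atlas M"
  show "smooth_on (model M) (\<phi> ` (D \<inter> U)) (g \<circ> inv_into D \<phi>)"
  proof (rule smooth_on_local[OF premanifold_model openin_chart_image[OF D U]])
    fix y assume "y \<in> \<phi> ` (D \<inter> U)"
    then obtain x where x: "x \<in> D" "x \<in> U" "y = \<phi> x" by blast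
    from loc[OF x(2)] obtain A where A: "openin (mtop M) A" "x \<in> A" "smooth_fun M (U \<inter> A) g" by blast
    have "smooth_on (model M) (\<phi> ` (D \<inter> (U \<inter> A))) (g \<circ> inv_into D \<phi>)"
      using A(3) D unfolding smooth_fun_def by blast
    moreover have "\<phi> ` (D \<inter> (U \<inter> A)) = \<phi> ` (D \<inter> U) \<inter> \<phi> ` (D \<inter> A)"
      using premanifold_chart(2)[OF D] by (auto simp: inj_on_def)
    ultimately show "\<exists>A. openin (top_of_set (model M)) A \<and> y \<in> A \<and>
        smooth_on (model M) (\<phi> ` (D \<inter> U) \<inter> A) (g \<circ> inv_into D \<phi>)"
      using openin_chart_image[OF D A(1)] x A(2) by (intro exI[of _ "\<phi> ` (D \<inter> A)"]) auto
  qed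
qed

end

text \<open>Openness of the preimages of chart domains is part of the notion, because coordinate
  expressions are tested only on these preimages and do not give continuity by themselves. When the
  charts cover the target, it makes \<open>A\<close> open as well.\<close>

definition smooth_map ::
  "('a, 'e::euclidean_space) manifold \<Rightarrow> 'a set \<Rightarrow> ('b, 'f::euclidean_space) manifold \<Rightarrow> ('a \<Rightarrow> 'b) \<Rightarrow> bool"
  where "smooth_map M A M' h \<longleftrightarrow> h ` A \<subseteq> pts M' \<and>
    (\<forall>(D, \<phi>)\<in>atlas M'. openin (mtop M) {x \<in> A. h x \<in> D} \<and> smooth_fun M {x \<in> A. h x \<in> D} (\<phi> \<circ> h))"

text \<open>Within a chart domain, membership in \<open>V\<close> is membership of the coordinates
  in an ambient open set, and the coordinates of \<open>h\<close> are continuous.\<close>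

lemma smooth_map_openin:
  assumes M: "premanifold M" and M': "premanifold M'" and h: "smooth_map M A M' h"
    and V: "openin (mtop M') V"
  shows "openin (mtop M) {x \<in> A. h x \<in> V}"
proof -
  let ?T = "\<lambda>(D, \<phi>). {x \<in> A. h x \<in> D \<and> h x \<in> V}"
  have "openin (mtop M) (?T c)" if "c \<in> atlas M'" for c
  proof -
    obtain D \<phi> where c: "c = (D, \<phi>)" by (cases c)
    with that have c2: "(D, \<phi>) \<in> atlas M'" by simp
    obtain B where B: "open B" "\<phi> ` (D \<inter> V) = model M' \<inter> B"
      using openin_chart_image[OF M' c2 V] openin_open by metis
    have "openin (mtop M) {x \<in> A. h x \<in> D}" "smooth_fun M {x \<in> A. h x \<in> D} (\<phi> \<circ> h)"
      using h c2 unfolding smooth_map_def by auto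
    from smooth_fun_openin[OF M this(2,1) B(1)]
    have "openin (mtop M) {x \<in> {x \<in> A. h x \<in> D}. (\<phi> \<circ> h) x \<in> B}" .
    moreover have "{x \<in> {x \<in> A. h x \<in> D}. (\<phi> \<circ> h) x \<in> B} = ?T c"
    proof -
      have "y \<in> V \<longleftrightarrow> \<phi> y \<in> B" if "y \<in> D" for y
      proof -
        have "\<phi> y \<in> \<phi> ` (D \<inter> V) \<longleftrightarrow> y \<in> V"
          using premanifold_chart(2)[OF M' c2] that by (auto simp: inj_on_def)
        moreover have "\<phi> y \<in> model M'" using premanifold_chart_model[OF M' c2 that] .
        ultimately show ?thesis using B(2) by auto
      qed
      then show ?thesis using c by auto
    qed
    ultimately show ?thesis by simp
  qed
  then have "openin (mtop M) (\<Union>(?T ` atlas M'))" by blast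
  moreover have "\<Union>(?T ` atlas M') = {x \<in> A. h x \<in> V}"
  proof
    show "{x \<in> A. h x \<in> V} \<subseteq> \<Union>(?T ` atlas M')"
    proof
      fix x assume x: "x \<in> {x \<in> A. h x \<in> V}"
      then have "h x \<in> pts M'" using h unfolding smooth_map_def by blast
      then obtain D \<phi> where "(D, \<phi>) \<in> atlas M'" "h x \<in> D" using premanifold_cover[OF M'] by metis
      then show "x \<in> \<Union>(?T ` atlas M')" using x by force
    qed
  qed auto
  ultimately show ?thesis by simp
qed

lemma smooth_map_compose_fun:
  assumes M: "premanifold M" and M': "premanifold M'" and h: "smooth_map M A M' h"
    and V: "openin (mtop M') V" and g: "smooth_fun M' V g"
  shows "smooth_fun M {x \<in> A. h x \<in> V} (\<lambda>x. g (h x))"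
proof (rule smooth_fun_local[OF M smooth_map_openin[OF M M' h V]])
  fix x assume x: "x \<in> {x \<in> A. h x \<in> V}"
  then have "h x \<in> pts M'" using h unfolding smooth_map_def by blast
  then obtain D \<phi> where D: "(D, \<phi>) \<in> atlas M'" "h x \<in> D" using premanifold_cover[OF M'] by metis
  let ?A = "{x \<in> A. h x \<in> D}"
  have A: "openin (mtop M) ?A" "smooth_fun M ?A (\<phi> \<circ> h)" using h D(1) unfolding smooth_map_def by auto
  have "smooth_on (model M') (\<phi> ` (D \<inter> V)) (g \<circ> inv_into D \<phi>)"
    using g D(1) unfolding smooth_fun_def by blast
  then have "smooth_fun M ({x \<in> A. h x \<in> V} \<inter> ?A) (\<lambda>x. (g \<circ> inv_into D \<phi>) ((\<phi> \<circ> h) x))"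
  proof (rule smooth_fun_compose[OF M _ premanifold_model[OF M']])
    show "\<phi> ` (D \<inter> V) \<subseteq> model M'" using premanifold_chart_model[OF M' D(1)] by blast
    show "smooth_fun M ({x \<in> A. h x \<in> V} \<inter> ?A) (\<phi> \<circ> h)" by (rule smooth_fun_subset[OF M A(2)]) blast
  qed auto
  then have "smooth_fun M ({x \<in> A. h x \<in> V} \<inter> ?A) (\<lambda>x. g (h x))"
    by (rule smooth_fun_eqI[OF M]) (use premanifold_chart(2)[OF M' D(1)] in auto)
  then show "\<exists>B. openin (mtop M) B \<and> x \<in> B \<and> smooth_fun M ({x \<in> A. h x \<in> V} \<inter> B) (\<lambda>x. g (h x))"
    using A(1) x D(2) by (intro exI[of _ ?A]) auto
qed

section \<open>Open embeddings and their inverses\<close>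

lemma open_embedding_smooth_map:
  "open_embedding M M' f \<Longrightarrow> smooth_map M (pts M) M' f"
  unfolding open_embedding_def smooth_map_def by blast

lemma open_embedding_inverse_smooth_map:
  assumes M: "premanifold M" and f: "open_embedding M M' f"
  shows "smooth_map M' (f ` pts M) M (inv_into (pts M) f)"
  unfolding smooth_map_def
proof (intro conjI ballI)
  have inj: "inj_on f (pts M)" using f unfolding open_embedding_def by blast
  then show "inv_into (pts M) f ` f ` pts M \<subseteq> pts M" by auto
  fix c assume c: "c \<in> atlas M"
  obtain D \<phi> where D: "c = (D, \<phi>)" by (cases c)
  have "{y \<in> f ` pts M. inv_into (pts M) f y \<in> D} = f ` D"
    using premanifold_chart(1)[OF M] c inj D by force
  then show "case c of (D, \<phi>) \<Rightarrow> openin (mtop M') {y \<in> f ` pts M. inv_into (pts M) f y \<in> D} \<and>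
      smooth_fun M' {y \<in> f ` pts M. inv_into (pts M) f y \<in> D} (\<phi> \<circ> inv_into (pts M) f)"
    using f c unfolding open_embedding_def D by auto
qed

lemma open_embedding_open_map:
  assumes M: "premanifold M" and M': "premanifold M'" and f: "open_embedding M M' f"
    and U: "openin (mtop M) U"
  shows "openin (mtop M') (f ` U)"
proof -
  have inj: "inj_on f (pts M)" using f unfolding open_embedding_def by blast
  have "U \<subseteq> pts M" using U openin_mtop[OF M] by blast
  then have "{y \<in> f ` pts M. inv_into (pts M) f y \<in> U} = f ` U"
    using inj by force
  then show ?thesis
    using smooth_map_openin[OF M' M open_embedding_inverse_smooth_map[OF M f] U] by simp
qed

section \<open>Submanifolds\<close>

text \<open>\<open>smooth_fun\<close> tests the atlas only, while slice charts are drawn from the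
  maximal atlas. The gap is closed by gluing over the charts of the atlas, through which the
  compatible chart factors smoothly.\<close>

lemma charts_smooth_fun:
  assumes M: "premanifold M" and D: "(D, \<phi>) \<in> charts M"
    and U: "openin (mtop M) U" and g: "smooth_fun M U g"
  shows "openin (top_of_set (model M)) (\<phi> ` (D \<inter> U))"
    and "smooth_on (model M) (\<phi> ` (D \<inter> U)) (g \<circ> inv_into D \<phi>)"
proof -
  have inj: "inj_on \<phi> D" and Dpts: "D \<subseteq> pts M" and
    tr: "\<And>D' \<psi>. (D', \<psi>) \<in> atlas M \<Longrightarrow> openin (top_of_set (model M)) (\<phi> ` (D \<inter> D')) \<and>
      smooth_on (model M) (\<phi> ` (D \<inter> D')) (\<psi> \<circ> inv_into D \<phi>)"
    using D openin_mtop[OF M] unfolding charts_def by blast+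
  have op: "openin (top_of_set (model M)) (\<phi> ` (D \<inter> U \<inter> D'))" if D': "(D', \<psi>) \<in> atlas M" for D' \<psi>
  proof -
    let ?W = "\<phi> ` (D \<inter> D')"
    obtain B where B: "open B" "\<psi> ` (D' \<inter> U) = model M \<inter> B"
      using openin_chart_image[OF M D' U] openin_open by metis
    have "continuous_on ?W (\<psi> \<circ> inv_into D \<phi>)" using tr[OF D'] smooth_on_imp_continuous_on by blast
    then have "openin (top_of_set ?W) (?W \<inter> (\<psi> \<circ> inv_into D \<phi>) -` B)"
      using B(1) continuous_openin_preimage_gen by blast
    moreover have "?W \<inter> (\<psi> \<circ> inv_into D \<phi>) -` B = \<phi> ` (D \<inter> U \<inter> D')"
    proof -
      have "\<psi> x \<in> B \<longleftrightarrow> x \<in> U" if "x \<in> D'" for x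
      proof -
        have "\<psi> x \<in> \<psi> ` (D' \<inter> U) \<longleftrightarrow> x \<in> U"
          using premanifold_chart(2)[OF M D'] that by (auto simp: inj_on_def)
        moreover have "\<psi> x \<in> model M" using premanifold_chart_model[OF M D' that] .
        ultimately show ?thesis using B(2) by auto
      qed
      then show ?thesis using inj by auto
    qed
    ultimately show ?thesis using tr[OF D'] openin_trans by metis
  qed
  have "\<phi> ` (D \<inter> U) = (\<Union>(D', \<psi>)\<in>atlas M. \<phi> ` (D \<inter> U \<inter> D'))"
  proof
    show "\<phi> ` (D \<inter> U) \<subseteq> (\<Union>(D', \<psi>)\<in>atlas M. \<phi> ` (D \<inter> U \<inter> D'))"
    proof
      fix y assume "y \<in> \<phi> ` (D \<inter> U)"
      then obtain x where x: "x \<in> D" "x \<in> U" "y = \<phi> x" by blast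
      then obtain D' \<psi> where "(D', \<psi>) \<in> atlas M" "x \<in> D'" using premanifold_cover[OF M] Dpts by blast
      then show "y \<in> (\<Union>(D', \<psi>)\<in>atlas M. \<phi> ` (D \<inter> U \<inter> D'))" using x by blast
    qed
  qed auto
  moreover have "openin (top_of_set (model M)) (\<Union>(D', \<psi>)\<in>atlas M. \<phi> ` (D \<inter> U \<inter> D'))"
    using op by (intro openin_Union) auto
  ultimately show opU: "openin (top_of_set (model M)) (\<phi> ` (D \<inter> U))" by simp
  show "smooth_on (model M) (\<phi> ` (D \<inter> U)) (g \<circ> inv_into D \<phi>)"
  proof (rule smooth_on_local[OF premanifold_model[OF M] opU])
    fix y assume "y \<in> \<phi> ` (D \<inter> U)"
    then obtain x where x: "x \<in> D" "x \<in> U" "y = \<phi> x" by blast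
    then obtain D' \<psi> where D': "(D', \<psi>) \<in> atlas M" "x \<in> D'" using premanifold_cover[OF M] Dpts by blast
    let ?A = "\<phi> ` (D \<inter> U \<inter> D')"
    have "smooth_on (model M) (\<psi> ` (D' \<inter> U)) (g \<circ> inv_into D' \<psi>)"
      using g D'(1) unfolding smooth_fun_def by blast
    moreover have "smooth_on (model M) ?A (\<psi> \<circ> inv_into D \<phi>)"
      by (rule smooth_on_subset[OF conjunct2[OF tr[OF D'(1)]]]) auto
    ultimately have "smooth_on (model M) ?A (\<lambda>p. (g \<circ> inv_into D' \<psi>) ((\<psi> \<circ> inv_into D \<phi>) p))"
    proof (rule smooth_on_compose[OF _ _ premanifold_model[OF M]])
      show "\<psi> ` (D' \<inter> U) \<subseteq> model M" using premanifold_chart_model[OF M D'(1)] by blast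
      show "(\<psi> \<circ> inv_into D \<phi>) ` ?A \<subseteq> \<psi> ` (D' \<inter> U)" using inj by auto
    qed
    then have "smooth_on (model M) ?A (g \<circ> inv_into D \<phi>)"
      by (rule smooth_on_eqI) (use inj premanifold_chart(2)[OF M D'(1)] in auto)
    moreover have "\<phi> ` (D \<inter> U) \<inter> ?A = ?A" by blast
    ultimately show "\<exists>A. openin (top_of_set (model M)) A \<and> y \<in> A \<and>
        smooth_on (model M) (\<phi> ` (D \<inter> U) \<inter> A) (g \<circ> inv_into D \<phi>)"
      using op[OF D'(1)] x D'(2) by (intro exI[of _ ?A]) auto
  qed
qed

context
  fixes M :: "('a, 'e::euclidean_space) manifold" and W S
  assumes M: "premanifold M" and S: "submanifold M W S"
begin

lemma slice_chart:
  assumes "(D, \<phi>) \<in> slice_charts M W S"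
  shows "(D, \<phi>) \<in> charts M" "inj_on \<phi> D" "\<phi> ` (D \<inter> S) = \<phi> ` D \<inter> W"
  using assms unfolding slice_charts_def charts_def by auto

lemma slice_chart_smooth_fun:
  assumes D: "(D, \<phi>) \<in> slice_charts M W S" and U: "openin (mtop M) U" and g: "smooth_fun M U g"
  shows "openin (top_of_set W) (\<phi> ` (D \<inter> S \<inter> U))"
    and "smooth_on W (\<phi> ` (D \<inter> S \<inter> U)) (g \<circ> inv_into (D \<inter> S) \<phi>)"
proof -
  note D' = slice_chart[OF D]
  have W: "W \<subseteq> model M" using S unfolding submanifold_def by blast
  \<comment> \<open>In a slice chart, membership in \<open>S\<close> is membership of the
    coordinates in \<open>W\<close>; openness and smoothness on \<open>S\<close> are then inherited
    by intersecting with \<open>W\<close>.\<close>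
  have eq: "\<phi> ` (D \<inter> S \<inter> U) = W \<inter> \<phi> ` (D \<inter> U)"
  proof
    show "W \<inter> \<phi> ` (D \<inter> U) \<subseteq> \<phi> ` (D \<inter> S \<inter> U)"
    proof
      fix y assume y: "y \<in> W \<inter> \<phi> ` (D \<inter> U)"
      then obtain x where x: "x \<in> D" "x \<in> U" "y = \<phi> x" by blast
      then have "\<phi> x \<in> \<phi> ` (D \<inter> S)" using D'(3) y by blast
      then have "x \<in> S" using D'(2) x by (auto simp: inj_on_def)
      then show "y \<in> \<phi> ` (D \<inter> S \<inter> U)" using x by blast
    qed
  qed (use D'(3) in blast)
  obtain B where "open B" "\<phi> ` (D \<inter> U) = model M \<inter> B"
    using charts_smooth_fun(1)[OF M D'(1) U g] openin_open by metis
  then show "openin (top_of_set W) (\<phi> ` (D \<inter> S \<inter> U))" unfolding eq openin_open using W by blast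
  have "smooth_on W (\<phi> ` (D \<inter> S \<inter> U)) (g \<circ> inv_into D \<phi>)"
    by (rule smooth_on_subset[OF charts_smooth_fun(2)[OF M D'(1) U g] W]) blast
  then show "smooth_on W (\<phi> ` (D \<inter> S \<inter> U)) (g \<circ> inv_into (D \<inter> S) \<phi>)"
    by (rule smooth_on_eqI) (use D'(2) in \<open>auto simp: inv_into_f_f inj_on_Int\<close>)
qed

lemma premanifold_induced: "premanifold (induced_manifold M W S)"
proof -
  have slice_open: "openin (mtop M) D" "smooth_fun M D \<phi>" if "(D, \<phi>) \<in> slice_charts M W S" for D \<phi>
    using that unfolding slice_charts_def charts_def by auto
  have Spts: "S \<subseteq> pts M" "subspace W" using S unfolding submanifold_def by auto
  have a: "inj_on \<phi> (D \<inter> S) \<and> openin (top_of_set W) (\<phi> ` (D \<inter> S))" if D: "(D, \<phi>) \<in> slice_charts M W S" for D \<phi>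
  proof -
    have "\<phi> ` (D \<inter> S) = \<phi> ` (D \<inter> S \<inter> D)" by (intro arg_cong[where f="image \<phi>"]) blast
    then show ?thesis
      using slice_chart_smooth_fun(1)[OF D slice_open[OF D]] slice_chart(2)[OF D]
      by (simp add: inj_on_Int)
  qed
  have b: "(\<Union>(D, \<phi>)\<in>slice_charts M W S. D \<inter> S) = S"
    using S unfolding submanifold_def by fastforce
  have c: "openin (top_of_set W) (\<phi> ` (D \<inter> S \<inter> (D' \<inter> S))) \<and>
      smooth_on W (\<phi> ` (D \<inter> S \<inter> (D' \<inter> S))) (\<psi> \<circ> inv_into (D \<inter> S) \<phi>)"
    if D: "(D, \<phi>) \<in> slice_charts M W S" and D': "(D', \<psi>) \<in> slice_charts M W S" for D \<phi> D' \<psi>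
  proof -
    have "D \<inter> S \<inter> (D' \<inter> S) = D \<inter> S \<inter> D'" by blast
    then show ?thesis using slice_chart_smooth_fun[OF D slice_open[OF D']] by simp
  qed
  show ?thesis
    unfolding premanifold_def induced_manifold_def using Spts a b c by auto
qed

lemma smooth_map_inclusion: "smooth_map (induced_manifold M W S) S M (\<lambda>x. x)"
  unfolding smooth_map_def
proof (intro conjI ballI)
  show "(\<lambda>x. x) ` S \<subseteq> pts M" using S unfolding submanifold_def by auto
  fix c assume c: "c \<in> atlas M"
  obtain D \<phi> where D: "c = (D, \<phi>)" by (cases c)
  note D' = openin_mtop_chart[OF M c[unfolded D]] smooth_fun_chart[OF M c[unfolded D]]
  have eq: "S \<inter> D \<inter> (D' \<inter> S) = D' \<inter> S \<inter> D" "D' \<inter> S \<inter> (S \<inter> D) = D' \<inter> S \<inter> D" for D' by auto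
  have "openin (mtop (induced_manifold M W S)) (S \<inter> D)"
    unfolding openin_mtop[OF premanifold_induced]
    using slice_chart_smooth_fun(1)[OF _ D'] by (auto simp: induced_manifold_def eq)
  moreover have "smooth_fun (induced_manifold M W S) (S \<inter> D) (\<phi> \<circ> (\<lambda>x. x))"
    unfolding smooth_fun_def
    using slice_chart_smooth_fun(2)[OF _ D'] by (auto simp: induced_manifold_def eq o_def)
  moreover have "{x \<in> S. x \<in> D} = S \<inter> D" by blast
  ultimately show "case c of (D, \<phi>) \<Rightarrow> openin (mtop (induced_manifold M W S)) {x \<in> S. x \<in> D} \<and>
      smooth_fun (induced_manifold M W S) {x \<in> S. x \<in> D} (\<phi> \<circ> (\<lambda>x. x))"
    by (simp add: D)
qed

end

section \<open>Bump functions\<close>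

text \<open>Stated at a point, so that it can be carried along open embeddings. The closed set
  \<open>C\<close> inside \<open>A\<close>, rather than a support, is what extension by zero uses:
  \<open>A\<close> and the complement of \<open>C\<close> form an open cover.\<close>

definition bump_at :: "('a, 'e::euclidean_space) manifold \<Rightarrow> 'a \<Rightarrow> bool"
  where "bump_at M x \<longleftrightarrow> (\<forall>A. openin (mtop M) A \<and> x \<in> A \<longrightarrow>
    (\<exists>b\<in>Cinf M. \<exists>C B. closedin (mtop M) C \<and> C \<subseteq> A \<and> (\<forall>y. y \<notin> C \<longrightarrow> b y = 0) \<and>
      openin (mtop M) B \<and> x \<in> B \<and> (\<forall>y\<in>B. b y = 1)))"

lemma bump_atE:
  assumes "bump_at M x" "openin (mtop M) A" "x \<in> A"
  obtains b C B where "b \<in> Cinf M" "closedin (mtop M) C" "C \<subseteq> A" "\<And>y. y \<notin> C \<Longrightarrow> b y = 0"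
    "openin (mtop M) B" "x \<in> B" "\<And>y. y \<in> B \<Longrightarrow> b y = 1"
proof -
  have "\<exists>b\<in>Cinf M. \<exists>C B. closedin (mtop M) C \<and> C \<subseteq> A \<and> (\<forall>y. y \<notin> C \<longrightarrow> b y = 0) \<and>
      openin (mtop M) B \<and> x \<in> B \<and> (\<forall>y\<in>B. b y = 1)"
    using assms unfolding bump_at_def by simp
  then show ?thesis using that by (elim bexE exE conjE) metis
qed

text \<open>Every point lies in \<open>A\<close>, where smoothness is given, or in the open
  complement of \<open>C\<close>, where the function is zero.\<close>

lemma smooth_fun_closed_cover:
  assumes M: "premanifold M" and A: "openin (mtop M) A" and C: "closedin (mtop M) C" "C \<subseteq> A"
    and g: "smooth_fun M A g" and 0: "\<And>y. y \<in> pts M \<Longrightarrow> y \<notin> C \<Longrightarrow> g y = 0"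
  shows "smooth_fun M (pts M) g"
proof (rule smooth_fun_local[OF M openin_mtop_pts[OF M]])
  fix x assume x: "x \<in> pts M"
  show "\<exists>A. openin (mtop M) A \<and> x \<in> A \<and> smooth_fun M (pts M \<inter> A) g"
  proof (cases "x \<in> C")
    case True
    have "smooth_fun M (pts M \<inter> A) g" by (rule smooth_fun_subset[OF M g]) blast
    with True A C show ?thesis by blast
  next
    case False
    have "smooth_fun M (pts M \<inter> (pts M - C)) g"
      by (rule smooth_fun_eqI[OF M smooth_fun_const[OF M, of _ 0]]) (use 0 in auto)
    moreover have "openin (mtop M) (pts M - C)"
      using C(1) topspace_mtop[OF M] by (metis closedin_def)
    ultimately show ?thesis using False x by blast
  qed
qed

text \<open>The Hausdorff property enters here: a closed ball in the model is compact, the inverse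
  chart carries it to a compact set, and compact sets are closed. The chart cutoff then extends by
  zero.\<close>

lemma bump_at_smooth_manifold:
  assumes M: "smooth_manifold M" and x: "x \<in> pts M"
  shows "bump_at M x"
  unfolding bump_at_def
proof (intro allI impI, elim conjE)
  note pm = smooth_manifold_imp_premanifold[OF M]
  fix A assume A: "openin (mtop M) A" "x \<in> A"
  obtain D \<phi> where D: "(D, \<phi>) \<in> atlas M" "x \<in> D" using premanifold_cover[OF pm x] .
  note inj = premanifold_chart(2)[OF pm D(1)]
  obtain \<beta> :: "_ \<Rightarrow> real" and r where \<beta>: "smooth_on UNIV UNIV \<beta>" "r > 0"
    "\<And>y. y \<in> ball (\<phi> x) r \<Longrightarrow> \<beta> y = 1" "\<And>y. y \<notin> cball (\<phi> x) (2 * r) \<Longrightarrow> \<beta> y = 0"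
    "cball (\<phi> x) (2 * r) \<inter> model M \<subseteq> \<phi> ` (D \<inter> A)"
    by (rule smooth_cutoff[OF premanifold_model[OF pm] openin_chart_image[OF pm D(1) A(1)], of "\<phi> x"])
      (use D A in auto)
  define K where "K = cball (\<phi> x) (2 * r) \<inter> model M"
  define C where "C = inv_into D \<phi> ` K"
  define b where "b = (\<lambda>y. if y \<in> D then \<beta> (\<phi> y) else 0)"
  have K: "compact K" "K \<subseteq> \<phi> ` D"
    unfolding K_def using \<beta>(5) premanifold_model[OF pm] by (auto intro: closed_subspace)
  have C_iff: "y \<in> C \<longleftrightarrow> y \<in> D \<and> \<phi> y \<in> cball (\<phi> x) (2 * r)" for y
  proof
    assume "y \<in> C"
    then obtain p where "p \<in> K" "y = inv_into D \<phi> p" by (auto simp: C_def)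
    then show "y \<in> D \<and> \<phi> y \<in> cball (\<phi> x) (2 * r)"
      using K(2) by (auto simp: K_def f_inv_into_f inv_into_into)
  next
    assume y: "y \<in> D \<and> \<phi> y \<in> cball (\<phi> x) (2 * r)"
    then have "\<phi> y \<in> K" "inv_into D \<phi> (\<phi> y) = y"
      using premanifold_chart_model[OF pm D(1)] inj by (auto simp: K_def)
    then show "y \<in> C" by (auto simp: C_def image_iff intro!: bexI[of _ "\<phi> y"])
  qed
  have "continuous_map (top_of_set (\<phi> ` D)) (mtop M) (inv_into D \<phi>)"
    unfolding continuous_map topspace_mtop[OF pm]
  proof (intro conjI allI impI)
    show "inv_into D \<phi> ` topspace (top_of_set (\<phi> ` D)) \<subseteq> pts M"
      using premanifold_chart(1)[OF pm D(1)] inj by auto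
    fix U assume "openin (mtop M) U"
    then have "openin (top_of_set (model M)) (\<phi> ` (D \<inter> U))" using openin_chart_image[OF pm D(1)] by blast
    moreover have "{p \<in> topspace (top_of_set (\<phi> ` D)). inv_into D \<phi> p \<in> U} = \<phi> ` (D \<inter> U)"
      using inj by auto
    ultimately show "openin (top_of_set (\<phi> ` D)) {p \<in> topspace (top_of_set (\<phi> ` D)). inv_into D \<phi> p \<in> U}"
      using openin_subset_trans[of "model M" "\<phi> ` (D \<inter> U)" "\<phi> ` D"]
        openin_imp_subset[OF premanifold_chart(3)[OF pm D(1)]] by auto
  qed
  moreover have "compactin (top_of_set (\<phi> ` D)) K"
    using K by (simp add: compactin_subtopology)
  ultimately have "compactin (mtop M) C" unfolding C_def using image_compactin by blast
  then have C: "closedin (mtop M) C"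
    using M by (intro compactin_imp_closedin) (simp_all add: smooth_manifold_def)
  have CA: "C \<subseteq> A"
  proof
    fix y assume y: "y \<in> C"
    then have "\<phi> y \<in> \<phi> ` (D \<inter> A)"
      using C_iff \<beta>(5) premanifold_chart_model[OF pm D(1)] by blast
    then show "y \<in> A" using y inj C_iff by (auto simp: inj_on_def)
  qed
  have "smooth_fun M D (\<lambda>y. \<beta> (\<phi> y))"
    by (rule smooth_fun_compose[OF pm \<beta>(1) _ _ smooth_fun_chart[OF pm D(1)]]) auto
  then have "smooth_fun M D b" by (rule smooth_fun_eqI[OF pm]) (simp add: b_def)
  then have "smooth_fun M (pts M) b"
    by (intro smooth_fun_closed_cover[OF pm openin_mtop_chart[OF pm D(1)] C])
      (auto simp: C_iff b_def \<beta>(4))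
  moreover have "\<forall>y. y \<notin> pts M \<longrightarrow> b y = 0"
    using premanifold_chart(1)[OF pm D(1)] by (auto simp: b_def)
  ultimately have "b \<in> Cinf M" by (simp add: Cinf_def)
  moreover have "\<forall>y. y \<notin> C \<longrightarrow> b y = 0" by (auto simp: b_def C_iff \<beta>(4))
  moreover have "openin (mtop M) {y \<in> D. \<phi> y \<in> ball (\<phi> x) r}"
    using smooth_fun_openin[OF pm smooth_fun_chart[OF pm D(1)] openin_mtop_chart[OF pm D(1)]] by blast
  moreover have "x \<in> {y \<in> D. \<phi> y \<in> ball (\<phi> x) r}" using D(2) \<beta>(2) by simp
  moreover have "\<forall>y\<in>{y \<in> D. \<phi> y \<in> ball (\<phi> x) r}. b y = 1" using \<beta>(3) by (auto simp: b_def)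
  ultimately show "\<exists>b\<in>Cinf M. \<exists>C B. closedin (mtop M) C \<and> C \<subseteq> A \<and> (\<forall>y. y \<notin> C \<longrightarrow> b y = 0) \<and>
      openin (mtop M) B \<and> x \<in> B \<and> (\<forall>y\<in>B. b y = 1)"
    using C CA by blast
qed

text \<open>The image of \<open>A\<close> is open in the target, so a bump function exists there;
  continuity keeps the preimages of \<open>C\<close> closed and of \<open>B\<close> open, and
  injectivity puts the preimage of \<open>C\<close> back inside \<open>A\<close>.\<close>

lemma bump_at_open_embedding:
  assumes M: "premanifold M" and M': "premanifold M'" and f: "open_embedding M M' f"
    and x: "x \<in> pts M" and bump: "bump_at M' (f x)"
  shows "bump_at M x"
  unfolding bump_at_def
proof (intro allI impI, elim conjE)
  fix A assume A: "openin (mtop M) A" "x \<in> A"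
  have inj: "inj_on f (pts M)" and fpts: "f ` pts M \<subseteq> pts M'" using f unfolding open_embedding_def by blast+
  note sm = open_embedding_smooth_map[OF f]
  have Apts: "A \<subseteq> pts M" using A openin_mtop[OF M] by blast
  obtain b C B where b: "b \<in> Cinf M'" "closedin (mtop M') C" "C \<subseteq> f ` A" "\<And>y. y \<notin> C \<Longrightarrow> b y = 0"
    "openin (mtop M') B" "f x \<in> B" "\<And>y. y \<in> B \<Longrightarrow> b y = 1"
    by (rule bump_atE[OF bump open_embedding_open_map[OF M M' f A(1)]]) (use A in auto)
  have op: "openin (mtop M) {y \<in> pts M. f y \<in> V}" if "openin (mtop M') V" for V
    using smooth_map_openin[OF M M' sm that] .
  have "openin (mtop M) {y \<in> pts M. f y \<in> pts M' - C}"
    using op b(2) topspace_mtop[OF M'] by (metis closedin_def)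
  moreover have "{y \<in> pts M. f y \<in> pts M' - C} = pts M - {y \<in> pts M. f y \<in> C}" using fpts by blast
  ultimately have C: "closedin (mtop M) {y \<in> pts M. f y \<in> C}"
    unfolding closedin_def topspace_mtop[OF M] by simp
  have "{y \<in> pts M. f y \<in> C} \<subseteq> A" using b(3) inj Apts by (auto simp: inj_on_def)
  moreover have "(\<lambda>y. if y \<in> pts M then b (f y) else 0) \<in> Cinf M"
  proof -
    have "smooth_fun M {y \<in> pts M. f y \<in> pts M'} (\<lambda>y. b (f y))"
      using smooth_map_compose_fun[OF M M' sm openin_mtop_pts[OF M']] b(1) unfolding Cinf_def by blast
    moreover have "{y \<in> pts M. f y \<in> pts M'} = pts M" using fpts by blast
    ultimately have "smooth_fun M (pts M) (\<lambda>y. b (f y))" by simp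
    then have "smooth_fun M (pts M) (\<lambda>y. if y \<in> pts M then b (f y) else 0)"
      by (rule smooth_fun_eqI[OF M]) simp
    then show ?thesis by (simp add: Cinf_def)
  qed
  ultimately show "\<exists>b\<in>Cinf M. \<exists>C B. closedin (mtop M) C \<and> C \<subseteq> A \<and> (\<forall>y. y \<notin> C \<longrightarrow> b y = 0) \<and>
      openin (mtop M) B \<and> x \<in> B \<and> (\<forall>y\<in>B. b y = 1)"
    using C op[OF b(5)] x b(4,6,7)
    by (intro bexI[of _ "\<lambda>y. if y \<in> pts M then b (f y) else 0"] exI[of _ "{y \<in> pts M. f y \<in> C}"]
        exI[of _ "{y \<in> pts M. f y \<in> B}"]) auto
qed

section \<open>Linear algebra on subspaces\<close>

lemma linear_map_on_0: "linear_map_on V f \<Longrightarrow> subspace V \<Longrightarrow> f 0 = 0"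
  unfolding linear_map_on_def using subspace_0 scaleR_zero_left by metis

lemma linear_map_on_add: "linear_map_on V f \<Longrightarrow> u \<in> V \<Longrightarrow> w \<in> V \<Longrightarrow> f (u + w) = f u + f w"
  unfolding linear_map_on_def by blast

lemma linear_map_on_scale: "linear_map_on V f \<Longrightarrow> u \<in> V \<Longrightarrow> f (c *\<^sub>R u) = c *\<^sub>R f u"
  unfolding linear_map_on_def by blast

lemma linear_map_on_diff:
  assumes "linear_map_on V f" "subspace V" "u \<in> V" "w \<in> V"
  shows "f (u - w) = f u - f w"
  using linear_map_on_add[OF assms(1), of "u - w" w] assms by (simp add: subspace_diff)

lemma linear_map_on_sum:
  assumes f: "linear_map_on V f" and V: "subspace V" and g: "\<And>i. i \<in> A \<Longrightarrow> g i \<in> V"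
  shows "f (\<Sum>i\<in>A. g i) = (\<Sum>i\<in>A. f (g i))"
proof (cases "finite A")
  case True
  then show ?thesis using g
  proof (induction A)
    case (insert a A)
    then have "g a \<in> V" "sum g A \<in> V" using V by (auto intro: subspace_sum)
    then show ?case using insert linear_map_on_add[OF f] by simp
  qed (simp add: linear_map_on_0[OF f V])
qed (simp add: linear_map_on_0[OF f V])

lemma linear_map_on_inv_into:
  assumes f: "linear_map_on V f" and V: "subspace V" and bij: "bij_betw f V T"
  shows "linear_map_on T (inv_into V f)"
proof -
  note i = bij_betw_inv_into_right[OF bij]
  have mem: "inv_into V f c \<in> V" if "c \<in> T" for c
    using that bij by (metis bij_betw_imp_surj_on inv_into_into)
  have eq: "inv_into V f (f v) = v" if "v \<in> V" for v
    using that bij by (simp add: bij_betw_inv_into_left)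
  have "inv_into V f (c + d) = inv_into V f c + inv_into V f d" if "c \<in> T" "d \<in> T" for c d
  proof -
    have "f (inv_into V f c + inv_into V f d) = c + d"
      using linear_map_on_add[OF f] mem that i by simp
    then show ?thesis using eq mem that V by (metis subspace_add)
  qed
  moreover have "inv_into V f (r *\<^sub>R c) = r *\<^sub>R inv_into V f c" if "c \<in> T" for r c
  proof -
    have "f (r *\<^sub>R inv_into V f c) = r *\<^sub>R c"
      using linear_map_on_scale[OF f] mem that i by simp
    then show ?thesis using eq mem that V by (metis subspace_scale)
  qed
  ultimately show ?thesis unfolding linear_map_on_def by blast
qed

lemma linear_map_on_coordinates:
  assumes G: "linear_map_on T G" "subspace T" and B: "B \<subseteq> T" "(\<Sum>b\<in>B. (c \<bullet> b) *\<^sub>R b) = c"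
  shows "G c = (\<Sum>b\<in>B. (c \<bullet> b) *\<^sub>R G b)"
proof -
  have "G (\<Sum>b\<in>B. (c \<bullet> b) *\<^sub>R b) = (\<Sum>b\<in>B. G ((c \<bullet> b) *\<^sub>R b))"
    using B(1) G(2) by (intro linear_map_on_sum[OF G]) (auto intro: subspace_scale)
  also have "\<dots> = (\<Sum>b\<in>B. (c \<bullet> b) *\<^sub>R G b)"
    using B(1) by (intro sum.cong refl linear_map_on_scale[OF G(1)]) blast
  finally show ?thesis unfolding B(2) .
qed

text \<open>Bundle data are smooth for a constant argument \<open>c\<close>. Expanding a varying
  argument in a fixed basis writes the value as a finite sum of smooth coefficients times such
  data.\<close>

lemma smooth_on_linear_family:
  fixes G :: "'a::euclidean_space \<Rightarrow> 'c::euclidean_space \<Rightarrow> 'b::euclidean_space"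
  assumes T: "subspace T" and lin: "\<And>x. x \<in> W \<Longrightarrow> linear_map_on T (G x)"
    and G: "\<And>c. c \<in> T \<Longrightarrow> smooth_on V W (\<lambda>x. G x c)"
    and c: "smooth_on V W c" "\<And>x. x \<in> W \<Longrightarrow> c x \<in> T"
  shows "smooth_on V W (\<lambda>x. G x (c x))"
proof -
  obtain B where B: "finite B" "B \<subseteq> T" "\<forall>c\<in>T. (\<Sum>b\<in>B. (c \<bullet> b) *\<^sub>R b) = c"
    by (rule orthonormal_basis_coordinates[OF T])
  have "smooth_on V W (\<lambda>x. \<Sum>b\<in>B. (c x \<bullet> b) *\<^sub>R G x b)"
    using B(2) c(1)
    by (intro smooth_on_sum smooth_on_bilinear[OF bounded_bilinear_scaleR] G
        smooth_on_linear_comp[OF bounded_linear_inner_left]) auto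
  then show ?thesis
    by (rule smooth_on_eqI) (rule linear_map_on_coordinates[OF lin T B(2) bspec[OF B(3) c(2)]])
qed

lemma smooth_fun_linear_family:
  fixes G :: "'a \<Rightarrow> 'c::euclidean_space \<Rightarrow> 'b::euclidean_space"
  assumes M: "premanifold M" and T: "subspace T" and lin: "\<And>x. x \<in> W \<Longrightarrow> linear_map_on T (G x)"
    and G: "\<And>c. c \<in> T \<Longrightarrow> smooth_fun M W (\<lambda>x. G x c)"
    and c: "smooth_fun M W c" "\<And>x. x \<in> W \<Longrightarrow> c x \<in> T"
  shows "smooth_fun M W (\<lambda>x. G x (c x))"
proof -
  obtain B where B: "finite B" "B \<subseteq> T" "\<forall>c\<in>T. (\<Sum>b\<in>B. (c \<bullet> b) *\<^sub>R b) = c"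
    by (rule orthonormal_basis_coordinates[OF T])
  have "smooth_fun M W (\<lambda>x. \<Sum>b\<in>B. (c x \<bullet> b) *\<^sub>R G x b)"
    using B(2) c(1)
    by (intro smooth_fun_sum[OF M] smooth_fun_bilinear[OF M bounded_bilinear_scaleR] G
        smooth_fun_linear_comp[OF M bounded_linear_inner_left]) auto
  then show ?thesis
    by (rule smooth_fun_eqI[OF M]) (rule linear_map_on_coordinates[OF lin T B(2) bspec[OF B(3) c(2)]])
qed

section \<open>Functions and sections\<close>

lemma CinfD: "f \<in> Cinf M \<Longrightarrow> smooth_fun M (pts M) f" "f \<in> Cinf M \<Longrightarrow> x \<notin> pts M \<Longrightarrow> f x = 0"
  unfolding Cinf_def by auto

context
  fixes M :: "('a, 'e::euclidean_space) manifold"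
  assumes M: "premanifold M"
begin

lemma Cinf_add: "f \<in> Cinf M \<Longrightarrow> g \<in> Cinf M \<Longrightarrow> f + g \<in> Cinf M"
  unfolding Cinf_def by (auto simp: plus_fun_def intro: smooth_fun_add[OF M])

lemma Cinf_mult: "f \<in> Cinf M \<Longrightarrow> g \<in> Cinf M \<Longrightarrow> f * g \<in> Cinf M"
  unfolding Cinf_def by (auto simp: times_fun_def intro: smooth_fun_bilinear[OF M bounded_bilinear_mult])

lemma Cinf_scaleR: "f \<in> Cinf M \<Longrightarrow> c *\<^sub>R f \<in> Cinf M"
  unfolding Cinf_def
  by (auto simp: scaleR_fun_def intro: smooth_fun_linear_comp[OF M bounded_linear_mult_right])

lemma Cinf_0: "0 \<in> Cinf M"
  unfolding Cinf_def by (simp add: zero_fun_def smooth_fun_const[OF M])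

lemma Cinf_restrict_const: "restrict_zero (pts M) (\<lambda>x. c) \<in> Cinf M"
  unfolding Cinf_def restrict_zero_def
  by (auto intro: smooth_fun_eqI[OF M smooth_fun_const[OF M, of _ c]])

lemma cutoff_function:
  fixes g :: "'a \<Rightarrow> real"
  assumes g: "smooth_fun M A g" and A: "openin (mtop M) A" and b: "b \<in> Cinf M"
    and C: "closedin (mtop M) C" "C \<subseteq> A" and 0: "\<And>y. y \<notin> C \<Longrightarrow> b y = 0"
  shows "(\<lambda>x. if x \<in> A then b x * g x else 0) \<in> Cinf M"
proof -
  have Apts: "A \<subseteq> pts M" using A openin_mtop[OF M] by blast
  have "smooth_fun M A (\<lambda>x. b x * g x)"
    by (rule smooth_fun_bilinear[OF M bounded_bilinear_mult smooth_fun_subset[OF M CinfD(1)[OF b] Apts] g])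
  then have "smooth_fun M A (\<lambda>x. if x \<in> A then b x * g x else 0)" by (rule smooth_fun_eqI[OF M]) simp
  then have "smooth_fun M (pts M) (\<lambda>x. if x \<in> A then b x * g x else 0)"
    by (intro smooth_fun_closed_cover[OF M A C]) (auto simp: 0)
  then show ?thesis using Apts by (auto simp: Cinf_def)
qed

lemma subspace_Cinf: "subspace (Cinf M)"
  unfolding subspace_def using Cinf_0 Cinf_add Cinf_scaleR by blast

end

section \<open>Sections, local sections and their extension by zero\<close>

definition local_section ::
  "('a, 'e::euclidean_space) manifold \<Rightarrow> ('a, 'f::euclidean_space, 'v::real_vector) vbundle
    \<Rightarrow> 'a set \<Rightarrow> ('a \<Rightarrow> 'v) \<Rightarrow> bool"
  where "local_section M E A \<sigma> \<longleftrightarrow> (\<forall>x\<in>A. \<sigma> x \<in> fib E x) \<and>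
    (\<forall>(U, \<Phi>)\<in>trivs E. smooth_fun M (U \<inter> A) (\<lambda>x. \<Phi> x (\<sigma> x)))"

text \<open>The spanning set in the definition of \<open>jet\<close>, named so that first order
  operators can be tested on it.\<close>

definition jet_kernel ::
  "('a, 'e::euclidean_space) manifold \<Rightarrow> ('a, 'f::euclidean_space, 'v::real_vector) vbundle
    \<Rightarrow> 'a \<Rightarrow> ('a \<Rightarrow> 'v) set"
  where "jet_kernel M E y = {fscale (f * g) u | f g u.
    f \<in> Cinf M \<and> g \<in> Cinf M \<and> u \<in> sections M E \<and> f y = 0 \<and> g y = 0}"

lemma fscale_mult: "fscale (f * g) s = fscale f (fscale g s)"
  by (simp add: fscale_def fun_eq_iff)

context
  fixes M :: "('a, 'e::euclidean_space) manifold"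
    and E :: "('a, 'f::euclidean_space, 'v::real_vector) vbundle"
  assumes M: "premanifold M" and E: "vector_bundle M E"
begin

lemma subspace_tmodel: "subspace (tmodel E)"
  using E unfolding vector_bundle_def by blast

lemma subspace_fib: "x \<in> pts M \<Longrightarrow> subspace (fib E x)"
  using E unfolding vector_bundle_def by blast

lemma triv_openin: "(U, \<Phi>) \<in> trivs E \<Longrightarrow> openin (mtop M) U"
  using E unfolding vector_bundle_def by fastforce

lemma triv_pts: "(U, \<Phi>) \<in> trivs E \<Longrightarrow> x \<in> U \<Longrightarrow> x \<in> pts M"
  using triv_openin openin_mtop[OF M] by blast

lemma triv_linear: "(U, \<Phi>) \<in> trivs E \<Longrightarrow> x \<in> U \<Longrightarrow> linear_map_on (fib E x) (\<Phi> x)"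
  using E unfolding vector_bundle_def by fastforce

lemma triv_bij: "(U, \<Phi>) \<in> trivs E \<Longrightarrow> x \<in> U \<Longrightarrow> bij_betw (\<Phi> x) (fib E x) (tmodel E)"
  using E unfolding vector_bundle_def by fastforce

lemma triv_cover:
  assumes "x \<in> pts M" obtains U \<Phi> where "(U, \<Phi>) \<in> trivs E" "x \<in> U"
proof -
  have "x \<in> (\<Union>(U, \<Phi>)\<in>trivs E. U)" using E assms unfolding vector_bundle_def by blast
  then show ?thesis using that by blast
qed

lemma triv_transition:
  "(U, \<Phi>) \<in> trivs E \<Longrightarrow> (U', \<Phi>') \<in> trivs E \<Longrightarrow> c \<in> tmodel E \<Longrightarrow>
    smooth_fun M (U \<inter> U') (\<lambda>x. \<Phi>' x (inv_into (fib E x) (\<Phi> x) c))"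
  using E unfolding vector_bundle_def by fastforce

lemma triv_in: "(U, \<Phi>) \<in> trivs E \<Longrightarrow> x \<in> U \<Longrightarrow> v \<in> fib E x \<Longrightarrow> \<Phi> x v \<in> tmodel E"
  using triv_bij bij_betwE by blast

lemma triv_inv_in:
  assumes "(U, \<Phi>) \<in> trivs E" "x \<in> U" "c \<in> tmodel E"
  shows "inv_into (fib E x) (\<Phi> x) c \<in> fib E x" "\<Phi> x (inv_into (fib E x) (\<Phi> x) c) = c"
  using bij_betw_imp_surj_on[OF triv_bij[OF assms(1,2)]] assms(3)
  by (auto simp: inv_into_into f_inv_into_f)

lemma triv_inv_triv:
  "(U, \<Phi>) \<in> trivs E \<Longrightarrow> x \<in> U \<Longrightarrow> v \<in> fib E x \<Longrightarrow> inv_into (fib E x) (\<Phi> x) (\<Phi> x v) = v"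
  using triv_bij bij_betw_inv_into_left by fast

lemma triv_inv_linear:
  "(U, \<Phi>) \<in> trivs E \<Longrightarrow> x \<in> U \<Longrightarrow> linear_map_on (tmodel E) (inv_into (fib E x) (\<Phi> x))"
  by (rule linear_map_on_inv_into[OF triv_linear subspace_fib[OF triv_pts] triv_bij])

lemma sections_fib: "s \<in> sections M E \<Longrightarrow> x \<in> pts M \<Longrightarrow> s x \<in> fib E x"
  unfolding sections_def by blast

lemma sections_outside: "s \<in> sections M E \<Longrightarrow> x \<notin> pts M \<Longrightarrow> s x = 0"
  unfolding sections_def by blast

lemma sections_smooth: "s \<in> sections M E \<Longrightarrow> (U, \<Phi>) \<in> trivs E \<Longrightarrow> smooth_fun M U (\<lambda>x. \<Phi> x (s x))"
  unfolding sections_def by blast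

lemma fscale_in_sections:
  assumes f: "f \<in> Cinf M" and s: "s \<in> sections M E"
  shows "fscale f s \<in> sections M E"
proof -
  have "smooth_fun M U (\<lambda>x. \<Phi> x (f x *\<^sub>R s x))" if U: "(U, \<Phi>) \<in> trivs E" for U \<Phi>
  proof -
    have "smooth_fun M U f" by (rule smooth_fun_subset[OF M CinfD(1)[OF f]]) (use triv_pts[OF U] in blast)
    then have "smooth_fun M U (\<lambda>x. f x *\<^sub>R \<Phi> x (s x))"
      using sections_smooth[OF s U] smooth_fun_bilinear[OF M bounded_bilinear_scaleR] by blast
    then show ?thesis
      by (rule smooth_fun_eqI[OF M])
        (simp add: linear_map_on_scale[OF triv_linear[OF U]] sections_fib[OF s] triv_pts[OF U])
  qed
  then show ?thesis
    unfolding sections_def fscale_def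
    by (auto simp: sections_outside[OF s] intro: subspace_scale[OF subspace_fib sections_fib[OF s]])
qed

lemma subspace_sections: "subspace (sections M E)"
  unfolding subspace_def
proof (intro conjI ballI allI)
  show "0 \<in> sections M E"
  proof -
    have "smooth_fun M U (\<lambda>x. \<Phi> x 0)" if U: "(U, \<Phi>) \<in> trivs E" for U \<Phi>
      by (rule smooth_fun_eqI[OF M smooth_fun_const[OF M, of _ 0]])
        (simp add: linear_map_on_0[OF triv_linear[OF U] subspace_fib[OF triv_pts[OF U]]])
    then show ?thesis unfolding sections_def using subspace_fib subspace_0 by auto
  qed
next
  fix s t assume s: "s \<in> sections M E" and t: "t \<in> sections M E"
  have "smooth_fun M U (\<lambda>x. \<Phi> x (s x + t x))" if U: "(U, \<Phi>) \<in> trivs E" for U \<Phi>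
    by (rule smooth_fun_eqI[OF M smooth_fun_add[OF M sections_smooth[OF s U] sections_smooth[OF t U]]])
      (simp add: linear_map_on_add[OF triv_linear[OF U]] sections_fib[OF s] sections_fib[OF t] triv_pts[OF U])
  then show "s + t \<in> sections M E"
    unfolding sections_def
    by (auto simp: sections_outside[OF s] sections_outside[OF t]
        intro: subspace_add[OF subspace_fib sections_fib[OF s] sections_fib[OF t]])
next
  fix c s assume s: "s \<in> sections M E"
  \<comment> \<open>A real scalar acts as the function that is constant on the manifold and zero off
    it, which reduces scaling to multiplication by smooth functions.\<close>
  have "fscale (restrict_zero (pts M) (\<lambda>x. c)) s = c *\<^sub>R s"
    using sections_outside[OF s] by (auto simp: fscale_def restrict_zero_def scaleR_fun_def)
  then show "c *\<^sub>R s \<in> sections M E"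
    using fscale_in_sections[OF Cinf_restrict_const[OF M] s] by metis
qed

lemma local_section_frame:
  "(U, \<Phi>) \<in> trivs E \<Longrightarrow> c \<in> tmodel E \<Longrightarrow> local_section M E U (\<lambda>x. inv_into (fib E x) (\<Phi> x) c)"
  unfolding local_section_def
  by (auto simp: triv_inv_in(1) Int_commute[of _ U] intro!: triv_transition)

lemma cutoff_section:
  assumes \<sigma>: "local_section M E A \<sigma>" and A: "openin (mtop M) A" and b: "b \<in> Cinf M"
    and C: "closedin (mtop M) C" "C \<subseteq> A" and 0: "\<And>y. y \<notin> C \<Longrightarrow> b y = 0"
  shows "(\<lambda>x. if x \<in> A then b x *\<^sub>R \<sigma> x else 0) \<in> sections M E" (is "?s \<in> _")
proof -
  have Apts: "A \<subseteq> pts M" using A openin_mtop[OF M] by blast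
  have fib: "?s x \<in> fib E x" if "x \<in> pts M" for x
    using \<sigma> subspace_fib[OF that] by (auto simp: local_section_def intro: subspace_0 subspace_scale)
  have "smooth_fun M U (\<lambda>x. \<Phi> x (?s x))" if U: "(U, \<Phi>) \<in> trivs E" for U \<Phi>
  proof (rule smooth_fun_local[OF M triv_openin[OF U]])
    fix x assume x: "x \<in> U"
    have *: "smooth_fun M (U \<inter> A) (\<lambda>x. \<Phi> x (?s x))"
    proof -
      have "smooth_fun M (U \<inter> A) b" by (rule smooth_fun_subset[OF M CinfD(1)[OF b]]) (use Apts in blast)
      moreover have "smooth_fun M (U \<inter> A) (\<lambda>x. \<Phi> x (\<sigma> x))" using \<sigma> U unfolding local_section_def by blast
      ultimately have "smooth_fun M (U \<inter> A) (\<lambda>x. b x *\<^sub>R \<Phi> x (\<sigma> x))"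
        using smooth_fun_bilinear[OF M bounded_bilinear_scaleR] by blast
      then show ?thesis
        by (rule smooth_fun_eqI[OF M])
          (use \<sigma> in \<open>auto simp: local_section_def linear_map_on_scale[OF triv_linear[OF U]]\<close>)
    qed
    have **: "smooth_fun M (U \<inter> (pts M - C)) (\<lambda>x. \<Phi> x (?s x))"
      by (rule smooth_fun_eqI[OF M smooth_fun_const[OF M, of _ 0]])
        (auto simp: 0 linear_map_on_0[OF triv_linear[OF U] subspace_fib])
    have "openin (mtop M) (pts M - C)" using C(1) topspace_mtop[OF M] by (metis closedin_def)
    then show "\<exists>B. openin (mtop M) B \<and> x \<in> B \<and> smooth_fun M (U \<inter> B) (\<lambda>x. \<Phi> x (?s x))"
      using * ** A C(2) triv_pts[OF U x] by (cases "x \<in> C") blast+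
  qed
  then show ?thesis using fib Apts unfolding sections_def by auto
qed

section \<open>First order operators\<close>

lemma first_order_op_sections: "first_order_op M E \<Delta> \<Longrightarrow> s \<in> sections M E \<Longrightarrow> \<Delta> s \<in> sections M E"
  unfolding first_order_op_def by blast

lemma first_order_op_linear: "first_order_op M E \<Delta> \<Longrightarrow> linear_map_on (sections M E) \<Delta>"
  unfolding first_order_op_def by blast

lemma first_order_op_product:
  assumes "first_order_op M E \<Delta>" "f \<in> Cinf M" "g \<in> Cinf M" "s \<in> sections M E"
  shows "\<Delta> (fscale (f * g) s) y =
    f y *\<^sub>R \<Delta> (fscale g s) y + g y *\<^sub>R \<Delta> (fscale f s) y - (f y * g y) *\<^sub>R \<Delta> s y"
proof -
  have "\<Delta> (fscale (f * g) s) - fscale f (\<Delta> (fscale g s)) - fscale g (\<Delta> (fscale f s))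
        + fscale (f * g) (\<Delta> s) = 0"
    using assms unfolding first_order_op_def by blast
  then have "(\<Delta> (fscale (f * g) s) - fscale f (\<Delta> (fscale g s)) - fscale g (\<Delta> (fscale f s))
        + fscale (f * g) (\<Delta> s)) y = 0" by simp
  then show ?thesis by (simp add: fscale_def algebra_simps)
qed

text \<open>By the product formula, each term of the operator on a generator of the jet kernel
  carries a factor \<open>f y\<close> or \<open>g y\<close>, which is 0. Hence the operator descends
  to jets.\<close>

lemma first_order_op_jet:
  assumes \<Delta>: "first_order_op M E \<Delta>" and s: "s \<in> sections M E" and t: "t \<in> sections M E"
    and st: "t - s \<in> span (jet_kernel M E y)"
  shows "\<Delta> t y = \<Delta> s y"
proof -
  note lin = first_order_op_linear[OF \<Delta>]
  have "subspace {u \<in> sections M E. \<Delta> u y = 0}"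
    using subspace_sections linear_map_on_0[OF lin subspace_sections] linear_map_on_add[OF lin]
      linear_map_on_scale[OF lin]
    by (auto simp: subspace_def scaleR_fun_def)
  moreover have "jet_kernel M E y \<subseteq> {u \<in> sections M E. \<Delta> u y = 0}"
    unfolding jet_kernel_def
    using first_order_op_product[OF \<Delta>] fscale_in_sections[OF Cinf_mult[OF M]] by auto
  ultimately have "t - s \<in> {u \<in> sections M E. \<Delta> u y = 0}"
    using st span_minimal by blast
  then have "\<Delta> (t - s) y = 0" by simp
  then show ?thesis using linear_map_on_diff[OF lin subspace_sections t s] by simp
qed

text \<open>
  The commutator \<open>P f\<close> of \<open>\<Delta>\<close> with multiplication by \<open>f\<close> is linear over functions, hence acts
  on each one-dimensional fibre as a scalar \<open>X f y\<close>.
\<close>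

lemma first_order_op_symbol:
  assumes dim: "dim (tmodel E) = 1" and bump: "\<And>x. x \<in> pts M \<Longrightarrow> bump_at M x"
    and \<Delta>: "first_order_op M E \<Delta>"
  shows "\<exists>X. has_symbol M E \<Delta> X"
proof -
  note lin = first_order_op_linear[OF \<Delta>] and sec = first_order_op_sections[OF \<Delta>]
  define P where "P = (\<lambda>f s y. \<Delta> (fscale f s) y - f y *\<^sub>R \<Delta> s y)"
  have P_sec: "P f s \<in> sections M E" if "f \<in> Cinf M" "s \<in> sections M E" for f s
  proof -
    have "\<Delta> (fscale f s) - fscale f (\<Delta> s) \<in> sections M E"
      using that by (intro subspace_diff[OF subspace_sections] sec fscale_in_sections)
    moreover have "P f s = \<Delta> (fscale f s) - fscale f (\<Delta> s)"
      by (simp add: P_def fscale_def fun_eq_iff)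
    ultimately show ?thesis by simp
  qed
  have P_fscale: "P f (fscale g s) y = g y *\<^sub>R P f s y"
    if "f \<in> Cinf M" "g \<in> Cinf M" "s \<in> sections M E" for f g s y
    using first_order_op_product[OF \<Delta> that] by (simp add: P_def fscale_mult algebra_simps)
  have P_mult: "P (f * g) s y = g y *\<^sub>R P f s y + f y *\<^sub>R P g s y"
    if "f \<in> Cinf M" "g \<in> Cinf M" "s \<in> sections M E" for f g s y
    using first_order_op_product[OF \<Delta> that] by (simp add: P_def algebra_simps)
  have P_add: "P (f + g) s y = P f s y + P g s y"
    if "f \<in> Cinf M" "g \<in> Cinf M" "s \<in> sections M E" for f g s y
  proof -
    have "fscale (f + g) s = fscale f s + fscale g s" by (simp add: fscale_def fun_eq_iff algebra_simps)
    then show ?thesis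
      using linear_map_on_add[OF lin] that fscale_in_sections by (simp add: P_def algebra_simps)
  qed
  have P_scaleR: "P (c *\<^sub>R f) s y = c *\<^sub>R P f s y" if "f \<in> Cinf M" "s \<in> sections M E" for c f s y
  proof -
    have "fscale (c *\<^sub>R f) s = c *\<^sub>R fscale f s" by (simp add: fscale_def fun_eq_iff scaleR_fun_def)
    then show ?thesis
      using linear_map_on_scale[OF lin] that fscale_in_sections
      by (simp add: P_def scaleR_fun_def algebra_simps)
  qed
  obtain c where c: "c \<in> tmodel E" "c \<noteq> 0"
    using dim dim_eq_0[of "tmodel E"] by fastforce
  have line: "d = ((d \<bullet> c) / (c \<bullet> c)) *\<^sub>R c" if d: "d \<in> tmodel E" for d
  proof -
    have "tmodel E \<subseteq> span {c}" using c dim subspace_tmodel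
      by (intro card_ge_dim_independent) auto
    then obtain k where "d = k *\<^sub>R c" using d by (auto simp: span_singleton)
    then show ?thesis using c(2) by simp
  qed
  \<comment> \<open>Around each point a global section \<open>e\<close> agrees with a local frame,
    so the scalar by which \<open>P f\<close> acts can be read off the single section
    \<open>P f e\<close>.\<close>
  have frame: "\<exists>U \<Phi> B e. (U, \<Phi>) \<in> trivs E \<and> openin (mtop M) B \<and> x \<in> B \<and> B \<subseteq> U \<and> e \<in> sections M E \<and>
      (\<forall>y\<in>B. \<Phi> y (e y) = c \<and> (\<forall>f\<in>Cinf M. \<forall>s\<in>sections M E.
        P f s y = ((\<Phi> y (P f e y) \<bullet> c) / (c \<bullet> c)) *\<^sub>R s y))" if x: "x \<in> pts M" for x
  proof -
    obtain U \<Phi> where U: "(U, \<Phi>) \<in> trivs E" "x \<in> U" by (rule triv_cover[OF x])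
    obtain b C B where b: "b \<in> Cinf M" "closedin (mtop M) C" "C \<subseteq> U" "\<And>y. y \<notin> C \<Longrightarrow> b y = 0"
      "openin (mtop M) B" "x \<in> B" "\<And>y. y \<in> B \<Longrightarrow> b y = 1"
      by (rule bump_atE[OF bump[OF x] triv_openin[OF U(1)] U(2)]) auto
    have BU: "B \<subseteq> U" using b(3,4,7) by force
    define \<sigma> where "\<sigma> = (\<lambda>y. inv_into (fib E y) (\<Phi> y) c)"
    define e where "e = (\<lambda>y. if y \<in> U then b y *\<^sub>R \<sigma> y else 0)"
    have e: "e \<in> sections M E" unfolding e_def
      by (rule cutoff_section[OF _ triv_openin[OF U(1)] b(1-4)])
        (simp add: \<sigma>_def local_section_frame[OF U(1) c(1)])
    have \<Phi>\<sigma>: "\<Phi> y (\<sigma> y) = c" "\<sigma> y \<in> fib E y" if "y \<in> U" for y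
      unfolding \<sigma>_def using triv_inv_in[OF U(1) that c(1)] by auto
    have coord: "v = ((\<Phi> y v \<bullet> c) / (c \<bullet> c)) *\<^sub>R \<sigma> y" if "y \<in> U" "v \<in> fib E y" for y v
    proof -
      have "v = inv_into (fib E y) (\<Phi> y) (\<Phi> y v)" using triv_inv_triv[OF U(1) that] by simp
      also have "\<dots> = inv_into (fib E y) (\<Phi> y) (((\<Phi> y v \<bullet> c) / (c \<bullet> c)) *\<^sub>R c)"
        using line[OF triv_in[OF U(1) that]] by simp
      also have "\<dots> = ((\<Phi> y v \<bullet> c) / (c \<bullet> c)) *\<^sub>R \<sigma> y"
        unfolding \<sigma>_def using linear_map_on_scale[OF triv_inv_linear[OF U(1) that(1)] c(1)] .
      finally show ?thesis .
    qed
    have "P f s y = ((\<Phi> y (P f e y) \<bullet> c) / (c \<bullet> c)) *\<^sub>R s y"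
      if y: "y \<in> B" and f: "f \<in> Cinf M" and s: "s \<in> sections M E" for y f s
    proof -
      define k where "k = (\<lambda>y. (\<Phi> y (s y) \<bullet> c) / (c \<bullet> c))"
      have "smooth_fun M U (\<lambda>y. (1 / (c \<bullet> c)) *\<^sub>R (\<Phi> y (s y) \<bullet> c))"
        by (intro smooth_fun_linear_comp[OF M bounded_linear_scaleR_right]
            smooth_fun_linear_comp[OF M bounded_linear_inner_left] sections_smooth[OF s U(1)])
      then have "smooth_fun M U k" by (rule smooth_fun_eqI[OF M]) (simp add: k_def)
      from cutoff_function[OF M this triv_openin[OF U(1)] b(1-4)]
      have g: "(\<lambda>y. if y \<in> U then b y * k y else 0) \<in> Cinf M" .
      \<comment> \<open>Both the coefficient \<open>k\<close> and the frame need a cutoff to become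
        global, hence the square of \<open>b\<close>; near the point it equals 1.\<close>
      have "fscale (b * b) s = fscale (\<lambda>y. if y \<in> U then b y * k y else 0) e"
      proof
        fix z show "fscale (b * b) s z = fscale (\<lambda>y. if y \<in> U then b y * k y else 0) e z"
        proof (cases "z \<in> U")
          case True
          then have "s z = k z *\<^sub>R \<sigma> z"
            unfolding k_def using coord sections_fib[OF s] triv_pts[OF U(1)] by blast
          then show ?thesis using True by (simp add: fscale_def e_def)
        qed (use b(3,4) in \<open>auto simp: fscale_def\<close>)
      qed
      moreover have "P f (fscale (b * b) s) y = P f s y"
        using P_fscale[OF f Cinf_mult[OF M b(1) b(1)] s] b(7)[OF y] by simp
      moreover have "P f (fscale (\<lambda>y. if y \<in> U then b y * k y else 0) e) y = k y *\<^sub>R P f e y"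
        using P_fscale[OF f g e] b(7)[OF y] BU y by auto
      ultimately have "P f s y = k y *\<^sub>R P f e y" by simp
      also have "P f e y = ((\<Phi> y (P f e y) \<bullet> c) / (c \<bullet> c)) *\<^sub>R \<sigma> y"
        using coord BU y sections_fib[OF P_sec[OF f e]] triv_pts[OF U(1)] by blast
      also have "k y *\<^sub>R \<dots> = ((\<Phi> y (P f e y) \<bullet> c) / (c \<bullet> c)) *\<^sub>R (k y *\<^sub>R \<sigma> y)" by simp
      also have "k y *\<^sub>R \<sigma> y = s y"
        unfolding k_def using coord sections_fib[OF s] triv_pts[OF U(1)] BU y by (metis subsetD)
      finally show ?thesis .
    qed
    moreover have "\<Phi> y (e y) = c" if "y \<in> B" for y
      using that BU b(7) \<Phi>\<sigma> by (auto simp: e_def)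
    ultimately show ?thesis using U b(5,6) BU e by blast
  qed
  \<comment> \<open>Choosing the scalar by a condition on all sections makes it independent of any
    frame.\<close>
  define X where "X = (\<lambda>f y. if f \<in> Cinf M \<and> y \<in> pts M
    then (SOME r. \<forall>s\<in>sections M E. P f s y = r *\<^sub>R s y) else 0)"
  have X: "P f s y = X f y *\<^sub>R s y" if f: "f \<in> Cinf M" and y: "y \<in> pts M" and s: "s \<in> sections M E" for f s y
  proof -
    obtain U \<Phi> B e where *: "y \<in> B" "\<forall>z\<in>B. \<Phi> z (e z) = c \<and> (\<forall>f\<in>Cinf M. \<forall>s\<in>sections M E.
        P f s z = ((\<Phi> z (P f e z) \<bullet> c) / (c \<bullet> c)) *\<^sub>R s z)"
      using frame[OF y] by blast
    define Q where "Q = (\<lambda>r. \<forall>s\<in>sections M E. P f s y = r *\<^sub>R s y)"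
    have "Q ((\<Phi> y (P f e y) \<bullet> c) / (c \<bullet> c))" unfolding Q_def
      by (rule bspec[OF conjunct2[OF bspec[OF *(2,1)]] f])
    then have "Q (SOME r. Q r)" by (rule someI[of Q])
    moreover have "X f y = (SOME r. Q r)" using f y by (simp add: X_def Q_def)
    ultimately have "Q (X f y)" by simp
    then have "\<forall>s\<in>sections M E. P f s y = X f y *\<^sub>R s y" by (simp only: Q_def)
    then show ?thesis using s by blast
  qed
  have nonzero: "\<exists>e\<in>sections M E. e x \<noteq> 0" if x: "x \<in> pts M" for x
  proof -
    obtain U \<Phi> B e where *: "(U, \<Phi>) \<in> trivs E" "x \<in> B" "B \<subseteq> U" "e \<in> sections M E" "\<forall>y\<in>B. \<Phi> y (e y) = c"
      using frame[OF x] by blast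
    then show ?thesis
      using c(2) linear_map_on_0[OF triv_linear[OF *(1)] subspace_fib[OF x]] by (metis subsetD)
  qed
  \<comment> \<open>Some section does not vanish at the point, so the scalar is unique; the
    derivation laws of \<open>X\<close> can then be read off those of \<open>P\<close>.\<close>
  have X_eq: "X f x = r" if f: "f \<in> Cinf M" and x: "x \<in> pts M" and P: "\<And>s. s \<in> sections M E \<Longrightarrow> P f s x = r *\<^sub>R s x" for f x r
  proof -
    obtain e where "e \<in> sections M E" "e x \<noteq> 0" using nonzero[OF x] by blast
    then show ?thesis using X[OF f x] P by (metis scaleR_cancel_right)
  qed
  have X_out: "X f y = 0" if "f \<notin> Cinf M \<or> y \<notin> pts M" for f y using that by (auto simp: X_def)
  have X_Cinf: "X f \<in> Cinf M" if f: "f \<in> Cinf M" for f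
  proof -
    have "smooth_fun M (pts M) (X f)"
    proof (rule smooth_fun_local[OF M openin_mtop_pts[OF M]])
      fix x assume x: "x \<in> pts M"
      obtain U \<Phi> B e where *: "(U, \<Phi>) \<in> trivs E" "openin (mtop M) B" "x \<in> B" "B \<subseteq> U" "e \<in> sections M E"
        "\<forall>y\<in>B. \<Phi> y (e y) = c \<and> (\<forall>f\<in>Cinf M. \<forall>s\<in>sections M E.
        P f s y = ((\<Phi> y (P f e y) \<bullet> c) / (c \<bullet> c)) *\<^sub>R s y)"
        using frame[OF x] by blast
      have "smooth_fun M U (\<lambda>y. (1 / (c \<bullet> c)) *\<^sub>R (\<Phi> y (P f e y) \<bullet> c))"
        by (intro smooth_fun_linear_comp[OF M bounded_linear_scaleR_right]
            smooth_fun_linear_comp[OF M bounded_linear_inner_left] sections_smooth[OF P_sec[OF f *(5)] *(1)])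
      then have "smooth_fun M (pts M \<inter> B) (\<lambda>y. (1 / (c \<bullet> c)) *\<^sub>R (\<Phi> y (P f e y) \<bullet> c))"
        by (rule smooth_fun_subset[OF M]) (use *(4) in blast)
      then have "smooth_fun M (pts M \<inter> B) (X f)"
        by (rule smooth_fun_eqI[OF M]) (use *(6) f in \<open>auto intro!: X_eq\<close>)
      then show "\<exists>A. openin (mtop M) A \<and> x \<in> A \<and> smooth_fun M (pts M \<inter> A) (X f)"
        using *(2,3) by blast
    qed
    then show ?thesis using X_out by (auto simp: Cinf_def)
  qed
  have "X \<in> vector_fields M"
    unfolding vector_fields_def linear_map_on_def
  proof (intro CollectI conjI ballI allI impI)
    show "X ` Cinf M \<subseteq> Cinf M" using X_Cinf by blast
    show "X f = 0" if "f \<notin> Cinf M" for f using X_out that by (auto simp: fun_eq_iff)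
    fix f assume f: "f \<in> Cinf M"
    show "X (r *\<^sub>R f) = r *\<^sub>R X f" for r
    proof
      fix y show "X (r *\<^sub>R f) y = (r *\<^sub>R X f) y"
      proof (cases "y \<in> pts M")
        case True
        then show ?thesis
          by (intro X_eq[OF Cinf_scaleR[OF M f]]) (simp_all add: P_scaleR f X, simp_all add: scaleR_fun_def)
      qed (simp add: X_out scaleR_fun_def)
    qed
    fix g assume g: "g \<in> Cinf M"
    show "X (f + g) = X f + X g"
    proof
      fix y show "X (f + g) y = (X f + X g) y"
      proof (cases "y \<in> pts M")
        case True
        then show ?thesis
          by (intro X_eq[OF Cinf_add[OF M f g]]) (simp_all add: P_add f g X algebra_simps)
      qed (simp add: X_out)
    qed
    show "X (f * g) = f * X g + g * X f"
    proof
      fix y show "X (f * g) y = (f * X g + g * X f) y"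
      proof (cases "y \<in> pts M")
        case True
        then show ?thesis
          by (intro X_eq[OF Cinf_mult[OF M f g]]) (simp_all add: P_mult f g X algebra_simps)
      qed (simp add: X_out)
    qed
  qed
  moreover have "\<Delta> (fscale f s) = fscale (X f) s + fscale f (\<Delta> s)"
    if "f \<in> Cinf M" "s \<in> sections M E" for f s
  proof
    fix y
    have "P f s y = X f y *\<^sub>R s y"
      using X[OF that(1) _ that(2)] X_out sections_outside[OF P_sec[OF that]]
      by (cases "y \<in> pts M") auto
    then show "\<Delta> (fscale f s) y = (fscale (X f) s + fscale f (\<Delta> s)) y"
      by (simp add: P_def fscale_def algebra_simps)
  qed
  ultimately show ?thesis unfolding has_symbol_def by blast
qed

end

section \<open>Pull-backs and total spaces\<close>

lemma vector_bundle_pullback: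
  assumes M: "premanifold M" and M': "premanifold M'" and f: "smooth_map M (pts M) M' f"
    and E: "vector_bundle M' E"
  shows "vector_bundle M (pullback (pts M) f E)"
proof -
  have fpts: "f x \<in> pts M'" if "x \<in> pts M" for x using f that unfolding smooth_map_def by blast
  have a: "openin (mtop M) {y \<in> pts M. f y \<in> U}" if "(U, \<Phi>) \<in> trivs E" for U \<Phi>
    using smooth_map_openin[OF M M' f triv_openin[OF M' E that]] .
  have b: "smooth_fun M ({y \<in> pts M. f y \<in> U} \<inter> {y \<in> pts M. f y \<in> U'})
      (\<lambda>x. \<Phi>' (f x) (inv_into (fib E (f x)) (\<Phi> (f x)) c))"
    if U: "(U, \<Phi>) \<in> trivs E" and U': "(U', \<Phi>') \<in> trivs E" and c: "c \<in> tmodel E" for U \<Phi> U' \<Phi>' c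
  proof -
    have "openin (mtop M') (U \<inter> U')" using triv_openin[OF M' E] U U' by blast
    from smooth_map_compose_fun[OF M M' f this triv_transition[OF M' E U U' c]]
    show ?thesis by (rule smooth_fun_subset[OF M]) blast
  qed
  have c: "(\<Union>(U, \<Phi>)\<in>trivs E. {y \<in> pts M. f y \<in> U}) = pts M"
  proof (intro equalityI subsetI)
    fix x assume x: "x \<in> pts M"
    obtain U \<Phi> where U: "(U, \<Phi>) \<in> trivs E" "f x \<in> U" by (rule triv_cover[OF M' E fpts[OF x]])
    show "x \<in> (\<Union>(U, \<Phi>)\<in>trivs E. {y \<in> pts M. f y \<in> U})" by (rule UN_I[OF U(1)]) (use x U in simp)
  qed auto
  show ?thesis
    unfolding vector_bundle_def pullback_def
    using subspace_tmodel[OF M' E] c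
    by (auto simp: a b split_beta intro: subspace_fib[OF M' E fpts] triv_linear[OF M' E] triv_bij[OF M' E])
qed

context
  fixes S :: "('a, 'e::euclidean_space) manifold"
    and N :: "('a, 'g::euclidean_space, 'v::real_vector) vbundle"
  assumes S: "premanifold S" and N: "vector_bundle S N"
begin

lemma total_chart_image:
  assumes D: "(D, \<phi>) \<in> atlas S" and U: "(U, \<Phi>) \<in> trivs N"
  shows "(\<lambda>(x, v). (\<phi> x, \<Phi> x v)) ` (Sigma (D \<inter> U) (fib N) \<inter> Sigma A (fib N)) =
    \<phi> ` (D \<inter> (U \<inter> A)) \<times> tmodel N" (is "?L = ?R")
proof
  show "?L \<subseteq> ?R" using triv_in[OF S N U] by auto
  show "?R \<subseteq> ?L"
  proof
    fix z assume "z \<in> ?R"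
    then obtain x c where x: "x \<in> D" "x \<in> U" "x \<in> A" "c \<in> tmodel N" "z = (\<phi> x, c)" by auto
    then show "z \<in> ?L" using triv_inv_in[OF S N U x(2,4)]
      by (intro image_eqI[of _ _ "(x, inv_into (fib N x) (\<Phi> x) c)"]) auto
  qed
qed

lemma total_chart_inj:
  assumes D: "(D, \<phi>) \<in> atlas S" and U: "(U, \<Phi>) \<in> trivs N"
  shows "inj_on (\<lambda>(x, v). (\<phi> x, \<Phi> x v)) (Sigma (D \<inter> U) (fib N))"
proof (rule inj_onI, clarify)
  fix x v y w assume *: "x \<in> D" "x \<in> U" "y \<in> D" "y \<in> U" "v \<in> fib N x" "w \<in> fib N y"
    "\<phi> x = \<phi> y" "\<Phi> x v = \<Phi> y w"
  then have "x = y" using premanifold_chart(2)[OF S D] by (auto simp: inj_on_def)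
  then show "x = y \<and> v = w" using * bij_betw_imp_inj_on[OF triv_bij[OF S N U]] by (auto simp: inj_on_def)
qed

lemma total_chart_inverse:
  assumes D: "(D, \<phi>) \<in> atlas S" and U: "(U, \<Phi>) \<in> trivs N"
    and p: "p \<in> \<phi> ` (D \<inter> U)" and c: "c \<in> tmodel N"
  shows "inv_into (Sigma (D \<inter> U) (fib N)) (\<lambda>(x, v). (\<phi> x, \<Phi> x v)) (p, c) =
    (inv_into D \<phi> p, inv_into (fib N (inv_into D \<phi> p)) (\<Phi> (inv_into D \<phi> p)) c)"
proof -
  obtain x where x: "x \<in> D" "x \<in> U" "p = \<phi> x" using p by blast
  then have "inv_into D \<phi> p = x" using premanifold_chart(2)[OF S D] by simp
  then show ?thesis
    using x triv_inv_in[OF S N U x(2) c] by (intro inv_into_f_eq[OF total_chart_inj[OF D U]]) auto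
qed

lemma smooth_on_base_fun:
  assumes D: "(D, \<phi>) \<in> atlas S" and g: "smooth_fun S A g" and B: "B \<subseteq> A"
  shows "smooth_on (model S \<times> T) (\<phi> ` (D \<inter> B) \<times> T') (\<lambda>z. g (inv_into D \<phi> (fst z)))"
proof -
  have "smooth_on (model S) (\<phi> ` (D \<inter> A)) (g \<circ> inv_into D \<phi>)"
    using g D unfolding smooth_fun_def by blast
  then have "smooth_on (model S) (\<phi> ` (D \<inter> B)) (g \<circ> inv_into D \<phi>)"
    by (rule smooth_on_subset) (use B in auto)
  then have "smooth_on (model S \<times> T) (\<phi> ` (D \<inter> B) \<times> T') (\<lambda>z. (g \<circ> inv_into D \<phi>) (fst z))"
    by (rule smooth_on_compose[OF _ smooth_on_linear[OF bounded_linear_fst] premanifold_model[OF S]])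
      (use premanifold_chart_model[OF S D] in auto)
  then show ?thesis by simp
qed

text \<open>The bundle axioms control each fixed fibre vector separately. Linearity in
  \<open>snd z\<close> upgrades this to joint smoothness, as the transition maps of the total space
  require.\<close>

lemma smooth_on_fibre_transition:
  assumes D: "(D, \<phi>) \<in> atlas S" and U: "(U, \<Phi>) \<in> trivs N" and U': "(U', \<Phi>') \<in> trivs N"
    and B: "B \<subseteq> U \<inter> U'"
  shows "smooth_on (model S \<times> tmodel N) (\<phi> ` (D \<inter> B) \<times> tmodel N)
    (\<lambda>z. \<Phi>' (inv_into D \<phi> (fst z))
      (inv_into (fib N (inv_into D \<phi> (fst z))) (\<Phi> (inv_into D \<phi> (fst z))) (snd z)))"
proof (rule smooth_on_linear_family[OF subspace_tmodel[OF S N], where c = snd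
      and G = "\<lambda>z c. \<Phi>' (inv_into D \<phi> (fst z))
        (inv_into (fib N (inv_into D \<phi> (fst z))) (\<Phi> (inv_into D \<phi> (fst z))) c)"])
  fix z assume z: "z \<in> \<phi> ` (D \<inter> B) \<times> tmodel N"
  define x where "x = inv_into D \<phi> (fst z)"
  have "x \<in> B" using z premanifold_chart(2)[OF S D] by (auto simp: x_def)
  then have x: "x \<in> U" "x \<in> U'" using B by auto
  show "linear_map_on (tmodel N) (\<lambda>c. \<Phi>' (inv_into D \<phi> (fst z))
      (inv_into (fib N (inv_into D \<phi> (fst z))) (\<Phi> (inv_into D \<phi> (fst z))) c))"
    unfolding x_def[symmetric]
    using triv_inv_linear[OF S N U x(1)] triv_linear[OF S N U' x(2)] triv_inv_in[OF S N U x(1)]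
    by (simp add: linear_map_on_def)
next
  fix c assume c: "c \<in> tmodel N"
  show "smooth_on (model S \<times> tmodel N) (\<phi> ` (D \<inter> B) \<times> tmodel N)
      (\<lambda>z. \<Phi>' (inv_into D \<phi> (fst z))
        (inv_into (fib N (inv_into D \<phi> (fst z))) (\<Phi> (inv_into D \<phi> (fst z))) c))"
    by (rule smooth_on_base_fun[OF D triv_transition[OF S N U U' c] B])
qed (auto intro: smooth_on_linear[OF bounded_linear_snd])

lemma total_atlasE:
  assumes "(K, \<kappa>) \<in> atlas (total_space S N)"
  obtains D \<phi> U \<Phi> where "(D, \<phi>) \<in> atlas S" "(U, \<Phi>) \<in> trivs N"
    "K = Sigma (D \<inter> U) (fib N)" "\<kappa> = (\<lambda>(x, v). (\<phi> x, \<Phi> x v))"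
  using assms unfolding total_space_def by auto

lemma total_atlasI:
  "(D, \<phi>) \<in> atlas S \<Longrightarrow> (U, \<Phi>) \<in> trivs N \<Longrightarrow>
    (Sigma (D \<inter> U) (fib N), \<lambda>(x, v). (\<phi> x, \<Phi> x v)) \<in> atlas (total_space S N)"
  unfolding total_space_def by auto

lemma total_space_simps:
  "pts (total_space S N) = Sigma (pts S) (fib N)" "model (total_space S N) = model S \<times> tmodel N"
  unfolding total_space_def by simp_all

lemma openin_base_image:
  assumes D: "(D, \<phi>) \<in> atlas S" and A: "openin (mtop S) A"
  shows "openin (top_of_set (model S \<times> tmodel N)) (\<phi> ` (D \<inter> A) \<times> tmodel N)"
  by (rule openin_Times[OF openin_chart_image[OF S D A]]) simp

lemma premanifold_total_space: "premanifold (total_space S N)"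
  unfolding premanifold_def total_space_simps
proof (intro conjI)
  show "subspace (model S \<times> tmodel N)"
    using premanifold_model[OF S] subspace_tmodel[OF S N] by (rule subspace_Times)
  show "(\<Union>(D, \<phi>)\<in>atlas (total_space S N). D) = Sigma (pts S) (fib N)"
  proof
    show "(\<Union>(D, \<phi>)\<in>atlas (total_space S N). D) \<subseteq> Sigma (pts S) (fib N)"
      using premanifold_chart(1)[OF S] unfolding total_space_def by auto
    show "Sigma (pts S) (fib N) \<subseteq> (\<Union>(D, \<phi>)\<in>atlas (total_space S N). D)"
    proof clarify
      fix x v assume x: "x \<in> pts S" "v \<in> fib N x"
      obtain D \<phi> where D: "(D, \<phi>) \<in> atlas S" "x \<in> D" by (rule premanifold_cover[OF S x(1)])
      obtain U \<Phi> where U: "(U, \<Phi>) \<in> trivs N" "x \<in> U" by (rule triv_cover[OF S N x(1)])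
      show "(x, v) \<in> (\<Union>(D, \<phi>)\<in>atlas (total_space S N). D)"
        by (rule UN_I[OF total_atlasI[OF D(1) U(1)]]) (use x D U in auto)
    qed
  qed
  show "\<forall>(K, \<kappa>)\<in>atlas (total_space S N). K \<subseteq> Sigma (pts S) (fib N) \<and> inj_on \<kappa> K \<and>
      openin (top_of_set (model S \<times> tmodel N)) (\<kappa> ` K)"
  proof clarify
    fix K \<kappa> assume "(K, \<kappa>) \<in> atlas (total_space S N)"
    then obtain D \<phi> U \<Phi> where D: "(D, \<phi>) \<in> atlas S" and U: "(U, \<Phi>) \<in> trivs N"
      and K: "K = Sigma (D \<inter> U) (fib N)" "\<kappa> = (\<lambda>(x, v). (\<phi> x, \<Phi> x v))" by (rule total_atlasE)
    have "K \<subseteq> Sigma (pts S) (fib N)" using premanifold_chart(1)[OF S D] K(1) by auto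
    moreover have "inj_on \<kappa> K" unfolding K by (rule total_chart_inj[OF D U])
    moreover have "\<kappa> ` K = \<phi> ` (D \<inter> U) \<times> tmodel N"
      using total_chart_image[OF D U, of U] unfolding K by (simp add: Int_absorb2 Times_Int_distrib1 flip: Sigma_Int_distrib1)
    moreover have "openin (top_of_set (model S \<times> tmodel N)) (\<phi> ` (D \<inter> U) \<times> tmodel N)"
      by (rule openin_base_image[OF D triv_openin[OF S N U]])
    ultimately show "K \<subseteq> Sigma (pts S) (fib N) \<and> inj_on \<kappa> K \<and>
        openin (top_of_set (model S \<times> tmodel N)) (\<kappa> ` K)" by simp
  qed
  show "\<forall>(K, \<kappa>)\<in>atlas (total_space S N). \<forall>(K', \<kappa>')\<in>atlas (total_space S N).
      openin (top_of_set (model S \<times> tmodel N)) (\<kappa> ` (K \<inter> K')) \<and>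
      smooth_on (model S \<times> tmodel N) (\<kappa> ` (K \<inter> K')) (\<kappa>' \<circ> inv_into K \<kappa>)"
  proof clarify
    fix K \<kappa> K' \<kappa>'
    assume a: "(K, \<kappa>) \<in> atlas (total_space S N)" and a': "(K', \<kappa>') \<in> atlas (total_space S N)"
    obtain D \<phi> U \<Phi> where D: "(D, \<phi>) \<in> atlas S" and U: "(U, \<Phi>) \<in> trivs N"
      and K: "K = Sigma (D \<inter> U) (fib N)" "\<kappa> = (\<lambda>(x, v). (\<phi> x, \<Phi> x v))" using total_atlasE[OF a] .
    obtain D' \<phi>' U' \<Phi>' where D': "(D', \<phi>') \<in> atlas S" and U': "(U', \<Phi>') \<in> trivs N"
      and K': "K' = Sigma (D' \<inter> U') (fib N)" "\<kappa>' = (\<lambda>(x, v). (\<phi>' x, \<Phi>' x v))" using total_atlasE[OF a'] .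
    let ?B = "U \<inter> (D' \<inter> U')"
    have im: "\<kappa> ` (K \<inter> K') = \<phi> ` (D \<inter> ?B) \<times> tmodel N"
      unfolding K K' by (rule total_chart_image[OF D U])
    have "openin (mtop S) ?B"
      using triv_openin[OF S N U] triv_openin[OF S N U'] openin_mtop_chart[OF S D'] by blast
    then have "openin (top_of_set (model S \<times> tmodel N)) (\<kappa> ` (K \<inter> K'))"
      unfolding im by (rule openin_base_image[OF D])
    moreover have "smooth_on (model S \<times> tmodel N) (\<kappa> ` (K \<inter> K')) (\<kappa>' \<circ> inv_into K \<kappa>)"
    proof -
      have "smooth_on (model S \<times> tmodel N) (\<phi> ` (D \<inter> ?B) \<times> tmodel N) (\<lambda>z. (\<phi>' (inv_into D \<phi> (fst z)),
        \<Phi>' (inv_into D \<phi> (fst z))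
        (inv_into (fib N (inv_into D \<phi> (fst z))) (\<Phi> (inv_into D \<phi> (fst z))) (snd z))))"
        by (intro smooth_on_Pair smooth_on_base_fun[OF D smooth_fun_chart[OF S D']]
            smooth_on_fibre_transition[OF D U U']) auto
      then show ?thesis unfolding im
      proof (rule smooth_on_eqI)
        fix z assume "z \<in> \<phi> ` (D \<inter> ?B) \<times> tmodel N"
        then have "fst z \<in> \<phi> ` (D \<inter> U)" "snd z \<in> tmodel N" by auto
        from total_chart_inverse[OF D U this]
        show "(\<kappa>' \<circ> inv_into K \<kappa>) z = (\<phi>' (inv_into D \<phi> (fst z)), \<Phi>' (inv_into D \<phi> (fst z))
          (inv_into (fib N (inv_into D \<phi> (fst z))) (\<Phi> (inv_into D \<phi> (fst z))) (snd z)))"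
          by (simp add: K K')
      qed
    qed
    ultimately show "openin (top_of_set (model S \<times> tmodel N)) (\<kappa> ` (K \<inter> K')) \<and>
      smooth_on (model S \<times> tmodel N) (\<kappa> ` (K \<inter> K')) (\<kappa>' \<circ> inv_into K \<kappa>)" by blast
  qed
qed

lemma openin_total_space:
  assumes A: "openin (mtop S) A"
  shows "openin (mtop (total_space S N)) (Sigma A (fib N))"
  unfolding openin_mtop[OF premanifold_total_space] total_space_simps
proof (intro conjI)
  show "Sigma A (fib N) \<subseteq> Sigma (pts S) (fib N)" using A openin_mtop[OF S] by auto
  show "\<forall>(K, \<kappa>)\<in>atlas (total_space S N).
      openin (top_of_set (model S \<times> tmodel N)) (\<kappa> ` (Sigma A (fib N) \<inter> K))"
  proof clarify
    fix K \<kappa> assume "(K, \<kappa>) \<in> atlas (total_space S N)"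
    then obtain D \<phi> U \<Phi> where D: "(D, \<phi>) \<in> atlas S" and U: "(U, \<Phi>) \<in> trivs N"
      and K: "K = Sigma (D \<inter> U) (fib N)" "\<kappa> = (\<lambda>(x, v). (\<phi> x, \<Phi> x v))" by (rule total_atlasE)
    have "openin (mtop S) (U \<inter> A)" using triv_openin[OF S N U] A by (rule openin_Int)
    moreover have "\<kappa> ` (Sigma A (fib N) \<inter> K) = \<phi> ` (D \<inter> (U \<inter> A)) \<times> tmodel N"
      using total_chart_image[OF D U, of A] unfolding K by (simp only: Int_commute)
    ultimately show "openin (top_of_set (model S \<times> tmodel N)) (\<kappa> ` (Sigma A (fib N) \<inter> K))"
      using openin_base_image[OF D] by simp
  qed
qed

lemma smooth_map_fst: "smooth_map (total_space S N) (pts (total_space S N)) S fst"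
  unfolding smooth_map_def
proof (intro conjI ballI)
  show "fst ` pts (total_space S N) \<subseteq> pts S" by (auto simp: total_space_simps)
  fix d assume d: "d \<in> atlas S"
  obtain D' \<phi>' where d_eq: "d = (D', \<phi>')" by (cases d)
  with d have D': "(D', \<phi>') \<in> atlas S" by simp
  have eq: "{y \<in> pts (total_space S N). fst y \<in> D'} = Sigma D' (fib N)"
    using premanifold_chart(1)[OF S D'] by (auto simp: total_space_simps)
  have "smooth_fun (total_space S N) (Sigma D' (fib N)) (\<phi>' \<circ> fst)"
    unfolding smooth_fun_def total_space_simps
  proof clarify
    fix K \<kappa> assume "(K, \<kappa>) \<in> atlas (total_space S N)"
    then obtain D \<phi> U \<Phi> where D: "(D, \<phi>) \<in> atlas S" and U: "(U, \<Phi>) \<in> trivs N"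
      and K: "K = Sigma (D \<inter> U) (fib N)" "\<kappa> = (\<lambda>(x, v). (\<phi> x, \<Phi> x v))" by (rule total_atlasE)
    have im: "\<kappa> ` (K \<inter> Sigma D' (fib N)) = \<phi> ` (D \<inter> (U \<inter> D')) \<times> tmodel N"
      unfolding K by (rule total_chart_image[OF D U])
    have "smooth_on (model S \<times> tmodel N) (\<phi> ` (D \<inter> (U \<inter> D')) \<times> tmodel N) (\<lambda>z. \<phi>' (inv_into D \<phi> (fst z)))"
      by (rule smooth_on_base_fun[OF D smooth_fun_chart[OF S D']]) auto
    then show "smooth_on (model S \<times> tmodel N) (\<kappa> ` (K \<inter> Sigma D' (fib N))) (\<phi>' \<circ> fst \<circ> inv_into K \<kappa>)"
      unfolding im
    proof (rule smooth_on_eqI)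
      fix z assume "z \<in> \<phi> ` (D \<inter> (U \<inter> D')) \<times> tmodel N"
      then have "fst z \<in> \<phi> ` (D \<inter> U)" "snd z \<in> tmodel N" by auto
      from total_chart_inverse[OF D U this]
      show "(\<phi>' \<circ> fst \<circ> inv_into K \<kappa>) z = \<phi>' (inv_into D \<phi> (fst z))" by (simp add: K)
    qed
  qed
  then show "case d of (D, \<phi>) \<Rightarrow> openin (mtop (total_space S N)) {y \<in> pts (total_space S N). fst y \<in> D} \<and>
      smooth_fun (total_space S N) {y \<in> pts (total_space S N). fst y \<in> D} (\<phi> \<circ> fst)"
    using openin_total_space[OF openin_mtop_chart[OF S D']] by (simp add: d_eq eq)
qed

lemma vector_bundle_over_total:
  "vector_bundle S l \<Longrightarrow> vector_bundle (total_space S N) (bundle_over_total S N l)"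
  unfolding bundle_over_total_def
  using vector_bundle_pullback[OF premanifold_total_space S smooth_map_fst] by blast

text \<open>The fibre coordinate is the second component of every chart of the total space built
  from this trivialisation, whichever base chart is used, so it is smooth over the whole of
  \<open>U\<close>.\<close>

lemma smooth_fun_fibre_coordinate:
  assumes U: "(U, \<Phi>) \<in> trivs N"
  shows "smooth_fun (total_space S N) (Sigma U (fib N)) (\<lambda>(x, v). \<Phi> x v)"
proof (rule smooth_fun_local[OF premanifold_total_space openin_total_space[OF triv_openin[OF S N U]]])
  note pm = premanifold_total_space
  fix y assume y: "y \<in> Sigma U (fib N)"
  then have "fst y \<in> pts S" using triv_pts[OF S N U] by auto
  then obtain D \<phi> where D: "(D, \<phi>) \<in> atlas S" "fst y \<in> D" by (rule premanifold_cover[OF S])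
  note a = total_atlasI[OF D(1) U]
  have "smooth_fun (total_space S N) (Sigma (D \<inter> U) (fib N)) (\<lambda>y. snd (case y of (x, v) \<Rightarrow> (\<phi> x, \<Phi> x v)))"
    by (rule smooth_fun_linear_comp[OF pm bounded_linear_snd smooth_fun_chart[OF pm a]])
  then have "smooth_fun (total_space S N) (Sigma U (fib N) \<inter> Sigma (D \<inter> U) (fib N)) (\<lambda>y. snd (case y of (x, v) \<Rightarrow> (\<phi> x, \<Phi> x v)))"
    by (rule smooth_fun_subset[OF pm]) blast
  then have "smooth_fun (total_space S N) (Sigma U (fib N) \<inter> Sigma (D \<inter> U) (fib N)) (\<lambda>(x, v). \<Phi> x v)"
    by (rule smooth_fun_eqI[OF pm]) auto
  then show "\<exists>A. openin (mtop (total_space S N)) A \<and> y \<in> A \<and>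
      smooth_fun (total_space S N) (Sigma U (fib N) \<inter> A) (\<lambda>(x, v). \<Phi> x v)"
    using openin_mtop_chart[OF pm a] y D(2) by (intro exI[of _ "Sigma (D \<inter> U) (fib N)"]) auto
qed

section \<open>Vertical lifts\<close>

text \<open>A trivialisation is linear on fibres, so a line in a fibre becomes an affine line in the
  direction (0, \<Phi> x w) of the chart. This turns the derivative defining the vertical lift into
  a directional derivative of a smooth function.\<close>

lemma fibre_line_derivative:
  fixes f :: "'a \<times> 'v \<Rightarrow> real"
  assumes f: "f \<in> Cinf (total_space S N)" and D: "(D, \<phi>) \<in> atlas S" and U: "(U, \<Phi>) \<in> trivs N"
    and x: "x \<in> D" "x \<in> U" and v: "v \<in> fib N x" and w: "w \<in> fib N x"
  defines "F \<equiv> f \<circ> inv_into (Sigma (D \<inter> U) (fib N)) (\<lambda>(x, v). (\<phi> x, \<Phi> x v))"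
  shows "((\<lambda>t. f (x, v + t *\<^sub>R w)) has_real_derivative dir_deriv F (\<phi> x, \<Phi> x v) (0, \<Phi> x w)) (at 0)"
    and "smooth_on (model S \<times> tmodel N) (\<phi> ` (D \<inter> U) \<times> tmodel N) F"
proof -
  let ?K = "Sigma (D \<inter> U) (fib N)" and ?\<kappa> = "\<lambda>(x, v). (\<phi> x, \<Phi> x v)" and ?W = "\<phi> ` (D \<inter> U) \<times> tmodel N"
  note a = total_atlasI[OF D U] and xp = triv_pts[OF S N U x(2)]
  have "?\<kappa> ` (?K \<inter> Sigma (pts S) (fib N)) = \<phi> ` (D \<inter> (U \<inter> pts S)) \<times> tmodel N"
    by (rule total_chart_image[OF D U])
  moreover have "U \<inter> pts S = U" using triv_pts[OF S N U] by auto
  ultimately have im: "?\<kappa> ` (?K \<inter> pts (total_space S N)) = ?W" by (simp add: total_space_simps)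
  have "smooth_on (model S \<times> tmodel N) (?\<kappa> ` (?K \<inter> pts (total_space S N))) F"
    using CinfD(1)[OF f] a unfolding smooth_fun_def F_def total_space_simps(2) by blast
  then show sF: "smooth_on (model S \<times> tmodel N) ?W F" unfolding im .
  have sub: "subspace (model S \<times> tmodel N)"
    using premanifold_model[OF S] subspace_tmodel[OF S N] by (rule subspace_Times)
  have op: "openin (top_of_set (model S \<times> tmodel N)) ?W"
    by (rule openin_base_image[OF D triv_openin[OF S N U]])
  have z: "(\<phi> x, \<Phi> x v) \<in> ?W" using x triv_in[OF S N U x(2) v] by auto
  have w': "(0, \<Phi> x w) \<in> model S \<times> tmodel N"
    using triv_in[OF S N U x(2) w] premanifold_model[OF S] by (auto intro: subspace_0)
  note d = smooth_on_has_derivative[OF sF z]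
  have "F ((\<phi> x, \<Phi> x v) + t *\<^sub>R (0, \<Phi> x w)) = f (x, v + t *\<^sub>R w)" for t
  proof -
    have vt: "v + t *\<^sub>R w \<in> fib N x"
      using v w subspace_fib[OF S N xp] by (simp add: subspace_add subspace_scale)
    have "\<Phi> x v + t *\<^sub>R \<Phi> x w = \<Phi> x (v + t *\<^sub>R w)"
      using triv_linear[OF S N U x(2)] v w subspace_fib[OF S N xp]
      by (simp add: linear_map_on_add linear_map_on_scale subspace_scale)
    moreover have "inv_into ?K ?\<kappa> (?\<kappa> (x, v + t *\<^sub>R w)) = (x, v + t *\<^sub>R w)"
      by (rule inv_into_f_f[OF total_chart_inj[OF D U]]) (use x vt in auto)
    ultimately show ?thesis by (simp add: F_def)
  qed
  then show "((\<lambda>t. f (x, v + t *\<^sub>R w)) has_real_derivative dir_deriv F (\<phi> x, \<Phi> x v) (0, \<Phi> x w)) (at 0)"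
    using has_vector_derivative_line[OF sub op z w' d] dir_deriv_eq[OF sub op z w' d]
    by (simp add: has_real_derivative_iff_has_vector_derivative)
qed

lemma vertical_lift_derivative:
  assumes f: "f \<in> Cinf (total_space S N)" and x: "x \<in> pts S" "v \<in> fib N x" and \<nu>: "\<nu> x \<in> fib N x"
  shows "((\<lambda>t. f (x, v + t *\<^sub>R \<nu> x)) has_real_derivative vertical_lift S N \<nu> f (x, v)) (at 0)"
proof -
  obtain D \<phi> where D: "(D, \<phi>) \<in> atlas S" "x \<in> D" by (rule premanifold_cover[OF S x(1)])
  obtain U \<Phi> where U: "(U, \<Phi>) \<in> trivs N" "x \<in> U" by (rule triv_cover[OF S N x(1)])
  note d = fibre_line_derivative(1)[OF f D(1) U(1) D(2) U(2) x(2) \<nu>]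
  then show ?thesis using DERIV_imp_deriv[OF d] f x
    by (simp add: vertical_lift_def restrict_zero_def total_space_simps)
qed

lemma vertical_lift_eqI:
  assumes "f \<in> Cinf (total_space S N)" "x \<in> pts S" "v \<in> fib N x"
    and "((\<lambda>t. f (x, v + t *\<^sub>R \<nu> x)) has_real_derivative d) (at 0)"
  shows "vertical_lift S N \<nu> f (x, v) = d"
  using assms DERIV_imp_deriv[OF assms(4)]
  by (simp add: vertical_lift_def restrict_zero_def total_space_simps)

lemma vertical_lift_outside:
  "f \<notin> Cinf (total_space S N) \<or> y \<notin> pts (total_space S N) \<Longrightarrow> vertical_lift S N \<nu> f y = 0"
  by (auto simp: vertical_lift_def restrict_zero_def)

text \<open>In a chart the lift is a directional derivative whose direction varies with the base
  point. For constant directions such derivatives are smooth, and they are linear in the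
  direction.\<close>

lemma vertical_lift_smooth:
  assumes \<nu>: "\<nu> \<in> sections S N" and f: "f \<in> Cinf (total_space S N)"
  shows "vertical_lift S N \<nu> f \<in> Cinf (total_space S N)"
proof -
  have "smooth_fun (total_space S N) (pts (total_space S N)) (vertical_lift S N \<nu> f)"
    unfolding smooth_fun_def
  proof clarify
    fix K \<kappa> assume "(K, \<kappa>) \<in> atlas (total_space S N)"
    then obtain D \<phi> U \<Phi> where D: "(D, \<phi>) \<in> atlas S" and U: "(U, \<Phi>) \<in> trivs N"
      and K: "K = Sigma (D \<inter> U) (fib N)" "\<kappa> = (\<lambda>(x, v). (\<phi> x, \<Phi> x v))" by (rule total_atlasE)
    let ?V = "model S \<times> tmodel N" and ?W = "\<phi> ` (D \<inter> U) \<times> tmodel N"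
    have Upts: "U \<inter> pts S = U" using triv_pts[OF S N U] by auto
    have im: "\<kappa> ` (K \<inter> pts (total_space S N)) = ?W"
      using total_chart_image[OF D U, of "pts S"] unfolding K total_space_simps Upts .
    have sub: "subspace ?V" using premanifold_model[OF S] subspace_tmodel[OF S N] by (rule subspace_Times)
    have op: "openin (top_of_set ?V) ?W"
      by (rule openin_base_image[OF D triv_openin[OF S N U]])
    define F where "F = f \<circ> inv_into K \<kappa>"
    \<comment> \<open>The lifted section in coordinates: no base component, and a fibre component
      depending on the base point only.\<close>
    define w where "w = (\<lambda>z::'e \<times> 'g. (0::'e, \<Phi> (inv_into D \<phi> (fst z)) (\<nu> (inv_into D \<phi> (fst z)))))"
    have pt: "\<exists>x v. x \<in> D \<and> x \<in> U \<and> v \<in> fib N x \<and> z = (\<phi> x, \<Phi> x v)" if z: "z \<in> ?W" for z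
    proof -
      obtain x c where "x \<in> D" "x \<in> U" "c \<in> tmodel N" "z = (\<phi> x, c)" using z by auto
      then show ?thesis using triv_inv_in[OF S N U] by metis
    qed
    have "smooth_on ?V ?W F"
    proof -
      have "smooth_on (model (total_space S N)) (\<kappa> ` (K \<inter> pts (total_space S N))) F"
        using CinfD(1)[OF f] \<open>(K, \<kappa>) \<in> atlas (total_space S N)\<close> unfolding smooth_fun_def F_def by blast
      then show ?thesis unfolding im by (simp only: total_space_simps(2))
    qed
    have "smooth_on ?V ?W (\<lambda>z. dir_deriv F z (w z))"
    proof (rule smooth_on_linear_family[OF sub, where c = w and G = "dir_deriv F"])
      fix z assume z: "z \<in> ?W"
      note d = smooth_on_has_derivative[OF \<open>smooth_on ?V ?W F\<close> z]
      have "linear (frechet_derivative F (at z within ?W))"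
        using d has_derivative_bounded_linear bounded_linear.linear by blast
      then show "linear_map_on ?V (dir_deriv F z)"
        unfolding linear_map_on_def
        using dir_deriv_eq[OF sub op z _ d] sub by (simp add: subspace_add subspace_scale linear_add linear_scale)
      obtain x v where "x \<in> D" "x \<in> U" "z = (\<phi> x, \<Phi> x v)" using pt[OF z] by blast
      then show "w z \<in> ?V"
        using premanifold_chart(2)[OF S D] triv_in[OF S N U] sections_fib[OF S N \<nu>] triv_pts[OF S N U]
          subspace_0[OF premanifold_model[OF S]] by (simp add: w_def)
    next
      fix c assume "c \<in> ?V"
      then show "smooth_on ?V ?W (\<lambda>z. dir_deriv F z c)"
        by (rule smooth_on_dir_deriv[OF sub op \<open>smooth_on ?V ?W F\<close>])
    next
      show "smooth_on ?V ?W w" unfolding w_def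
        by (intro smooth_on_Pair smooth_on_const smooth_on_base_fun[OF D sections_smooth[OF S N \<nu> U]]) simp
    qed
    then show "smooth_on (model (total_space S N)) (\<kappa> ` (K \<inter> pts (total_space S N))) (vertical_lift S N \<nu> f \<circ> inv_into K \<kappa>)"
      unfolding im total_space_simps(2)
    proof (rule smooth_on_eqI)
      fix z assume z: "z \<in> ?W"
      obtain x v where x: "x \<in> D" "x \<in> U" "v \<in> fib N x" "z = (\<phi> x, \<Phi> x v)" using pt[OF z] by blast
      note xp = triv_pts[OF S N U x(2)]
      have i: "inv_into D \<phi> (\<phi> x) = x" using premanifold_chart(2)[OF S D] x(1) by simp
      have "inv_into K \<kappa> (\<kappa> (x, v)) = (x, v)"
        unfolding K by (rule inv_into_f_f[OF total_chart_inj[OF D U]]) (use x in auto)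
      then have "inv_into K \<kappa> z = (x, v)" by (simp add: K x(4))
      moreover have "vertical_lift S N \<nu> f (x, v) = dir_deriv F z (0, \<Phi> x (\<nu> x))"
        using fibre_line_derivative(1)[OF f D U x(1-3) sections_fib[OF S N \<nu> xp]] unfolding F_def K x(4)
        by (rule vertical_lift_eqI[OF f xp x(3)])
      ultimately show "(vertical_lift S N \<nu> f \<circ> inv_into K \<kappa>) z = dir_deriv F z (w z)"
        by (simp add: w_def x(4) i)
    qed
  qed
  then show ?thesis using vertical_lift_outside by (auto simp: Cinf_def)
qed

text \<open>The axioms of the canonical connection speak of vertical fields only; this membership
  gives access to them. The derivation laws are those of one-variable derivatives along fibre
  lines.\<close>

lemma vertical_lift_in_vertical_fields:
  assumes \<nu>: "\<nu> \<in> sections S N"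
  shows "vertical_lift S N \<nu> \<in> vertical_fields S N"
proof -
  note pm = premanifold_total_space and VL = vertical_lift_derivative[where \<nu> = \<nu>, OF _ _ _ sections_fib[OF S N \<nu>]]
  let ?E = "total_space S N" and ?X = "vertical_lift S N \<nu>"
  have ext: "F = G" if "\<And>x v. x \<in> pts S \<Longrightarrow> v \<in> fib N x \<Longrightarrow> F (x, v) = G (x, v)"
    "\<And>y. y \<notin> pts ?E \<Longrightarrow> F y = G y" for F G :: "'a \<times> 'v \<Rightarrow> real"
    using that by (auto simp: fun_eq_iff total_space_simps)
  have "?X (f + g) = ?X f + ?X g" if f: "f \<in> Cinf ?E" and g: "g \<in> Cinf ?E" for f g
  proof (rule ext)
    fix x v assume x: "x \<in> pts S" "v \<in> fib N x"
    show "?X (f + g) (x, v) = (?X f + ?X g) (x, v)"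
      using DERIV_add[OF VL[OF f x x(1)] VL[OF g x x(1)]]
      by (intro vertical_lift_eqI[OF Cinf_add[OF pm f g] x]) simp
  qed (simp add: vertical_lift_outside)
  moreover have "?X (c *\<^sub>R f) = c *\<^sub>R ?X f" if f: "f \<in> Cinf ?E" for c f
  proof (rule ext)
    fix x v assume x: "x \<in> pts S" "v \<in> fib N x"
    show "?X (c *\<^sub>R f) (x, v) = (c *\<^sub>R ?X f) (x, v)"
      using DERIV_cmult[OF VL[OF f x x(1)], of c]
      by (intro vertical_lift_eqI[OF Cinf_scaleR[OF pm f] x]) (simp add: scaleR_fun_def)
  qed (simp add: vertical_lift_outside scaleR_fun_def)
  moreover have "?X (f * g) = f * ?X g + g * ?X f" if f: "f \<in> Cinf ?E" and g: "g \<in> Cinf ?E" for f g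
  proof (rule ext)
    fix x v assume x: "x \<in> pts S" "v \<in> fib N x"
    show "?X (f * g) (x, v) = (f * ?X g + g * ?X f) (x, v)"
      using DERIV_mult[OF VL[OF f x x(1)] VL[OF g x x(1)]]
      by (intro vertical_lift_eqI[OF Cinf_mult[OF pm f g] x]) (simp add: algebra_simps)
  qed (simp add: vertical_lift_outside)
  moreover have "?X f = 0" if "f \<notin> Cinf ?E" for f using that by (simp add: fun_eq_iff vertical_lift_outside)
  ultimately have "?X \<in> vector_fields ?E"
    using vertical_lift_smooth[OF \<nu>] unfolding vector_fields_def linear_map_on_def by blast
  \<comment> \<open>A pulled-back function is constant along fibre lines. If it were not smooth, the
    lift would be 0 on it by normalisation, so the case distinction spares a proof that pull-backs
    are smooth.\<close>
  moreover have "?X (pull_vert S N f) = 0" for f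
  proof (cases "pull_vert S N f \<in> Cinf ?E")
    case True
    show ?thesis
    proof (rule ext)
      fix x v assume x: "x \<in> pts S" "v \<in> fib N x"
      have "v + t *\<^sub>R \<nu> x \<in> fib N x" for t
        using x sections_fib[OF S N \<nu>] subspace_fib[OF S N] by (simp add: subspace_add subspace_scale)
      then have "(\<lambda>t. pull_vert S N f (x, v + t *\<^sub>R \<nu> x)) = (\<lambda>t. f x)"
        using x(1) by (simp add: pull_vert_def restrict_zero_def total_space_simps)
      then show "?X (pull_vert S N f) (x, v) = (0 :: 'a \<times> 'v \<Rightarrow> real) (x, v)"
        by (intro vertical_lift_eqI[OF True x]) simp
    qed (simp add: vertical_lift_outside)
  qed (simp add: fun_eq_iff vertical_lift_outside)
  ultimately show ?thesis unfolding vertical_fields_def by blast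
qed

end

section \<open>The conormal embedding\<close>

text \<open>The fibre of \<open>l\<close> is a line, so \<alpha> is a linear functional times a
  frame vector. Read in a trivialisation of \<open>N\<close>, the functional becomes a function that
  is linear on fibres, hence zero on the zero section; the vector extends to a local frame. A bump
  function makes both global.\<close>

lemma conormal_as_df_tensor:
  assumes S: "premanifold S" and N: "vector_bundle S N" and l: "vector_bundle S l"
    and dim: "dim (tmodel l) = 1" and x: "x \<in> pts S" and bump: "bump_at (total_space S N) (x, 0)"
    and \<alpha>: "\<alpha> \<in> conormal N l x"
  shows "\<exists>f\<in>Cinf (total_space S N). \<exists>s\<in>sections (total_space S N) (bundle_over_total S N l).
    (\<forall>y\<in>pts S. f (y, 0) = 0) \<and> \<alpha> = df_tensor N x f s"
proof -
  let ?E = "total_space S N" and ?L = "bundle_over_total S N l"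
  note pm = premanifold_total_space[OF S N] and vb = vector_bundle_over_total[OF S N l]
  note N0 = subspace_0[OF subspace_fib[OF S N]]
  obtain U \<Phi> where U: "(U, \<Phi>) \<in> trivs N" "x \<in> U" by (rule triv_cover[OF S N x])
  obtain U' \<Psi> where U': "(U', \<Psi>) \<in> trivs l" "x \<in> U'" by (rule triv_cover[OF S l x])
  obtain c where c: "c \<in> tmodel l" "c \<noteq> 0" using dim dim_eq_0[of "tmodel l"] by fastforce
  define e where "e = inv_into (fib l x) (\<Psi> x) c"
  have e: "e \<in> fib l x" "\<Psi> x e = c" unfolding e_def using triv_inv_in[OF S l U' c(1)] by auto
  define a where "a = (\<lambda>v. (\<Psi> x (\<alpha> v) \<bullet> c) / (c \<bullet> c))"
  have \<alpha>lin: "linear_map_on (fib N x) \<alpha>" and \<alpha>fib: "\<And>v. v \<in> fib N x \<Longrightarrow> \<alpha> v \<in> fib l x"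
    and \<alpha>0: "\<And>v. v \<notin> fib N x \<Longrightarrow> \<alpha> v = 0"
    using \<alpha> unfolding conormal_def by auto
  note \<Psi>lin = triv_linear[OF S l U']
  have alin: "linear_map_on (fib N x) a"
    using \<alpha>lin \<alpha>fib \<Psi>lin
    by (simp add: linear_map_on_def a_def inner_add_left add_divide_distrib)
  have \<alpha>eq: "\<alpha> v = a v *\<^sub>R e" if v: "v \<in> fib N x" for v
  proof -
    have "tmodel l \<subseteq> span {c}" using c dim subspace_tmodel[OF S l]
      by (intro card_ge_dim_independent) auto
    then obtain k where k: "\<Psi> x (\<alpha> v) = k *\<^sub>R c"
      using triv_in[OF S l U' \<alpha>fib[OF v]] by (auto simp: span_singleton)
    then have "k = a v" using c(2) by (simp add: a_def)
    then have "\<Psi> x (\<alpha> v) = \<Psi> x (a v *\<^sub>R e)"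
      using k linear_map_on_scale[OF \<Psi>lin e(1)] e(2) by simp
    then show ?thesis
      using bij_betw_imp_inj_on[OF triv_bij[OF S l U']] \<alpha>fib[OF v] e(1) subspace_fib[OF S l x]
      by (auto simp: inj_on_def subspace_scale)
  qed
  let ?A = "Sigma U (fib N)" and ?A' = "{y \<in> pts ?E. fst y \<in> U'}"
  have trL: "(?A', \<lambda>y. \<Psi> (fst y)) \<in> trivs ?L"
    using U'(1) by (force simp: bundle_over_total_def pullback_def)
  have fibL: "fib ?L y = fib l (fst y)" "tmodel ?L = tmodel l" for y
    by (simp_all add: bundle_over_total_def pullback_def)
  have A: "openin (mtop ?E) ?A" "openin (mtop ?E) ?A'"
    using openin_total_space[OF S N triv_openin[OF S N U(1)]] triv_openin[OF pm vb trL] by auto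
  have x0: "(x, 0) \<in> ?A \<inter> ?A'" using U U' x N0 by (auto simp: total_space_simps[OF S N])
  obtain b C B where b: "b \<in> Cinf ?E" "closedin (mtop ?E) C" "C \<subseteq> ?A \<inter> ?A'" "\<And>y. y \<notin> C \<Longrightarrow> b y = 0"
    "(x, 0) \<in> B" "\<And>y. y \<in> B \<Longrightarrow> b y = 1"
    by (rule bump_atE[OF bump openin_Int[OF A] x0]) auto
  define k where "k = (\<lambda>d. a (inv_into (fib N x) (\<Phi> x) d))"
  have klin: "linear_map_on (tmodel N) k"
    using triv_inv_linear[OF S N U] triv_inv_in(1)[OF S N U] alin
    by (simp add: linear_map_on_def k_def)
  define f where "f = (\<lambda>y. if y \<in> ?A then b y * k (case y of (z, v) \<Rightarrow> \<Phi> z v) else 0)"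
  define s where "s = (\<lambda>y. if y \<in> ?A' then b y *\<^sub>R inv_into (fib ?L y) (\<Psi> (fst y)) c else 0)"
  have "smooth_fun ?E ?A (\<lambda>y. k (case y of (z, v) \<Rightarrow> \<Phi> z v))"
    by (rule smooth_fun_linear_family[OF pm subspace_tmodel[OF S N] klin smooth_fun_const[OF pm]
          smooth_fun_fibre_coordinate[OF S N U(1)]])
      (use triv_in[OF S N U(1)] in auto)
  from cutoff_function[OF pm this A(1) b(1,2) _ b(4)]
  have f: "f \<in> Cinf ?E" using b(3) by (simp add: f_def)
  have "local_section ?E ?L ?A' (\<lambda>y. inv_into (fib ?L y) (\<Psi> (fst y)) c)"
    by (rule local_section_frame[OF pm vb trL]) (simp add: fibL c)
  from cutoff_section[OF pm vb this A(2) b(1,2) _ b(4)]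
  have s: "s \<in> sections ?E ?L" using b(3) by (simp add: s_def)
  have "f (y, 0) = 0" if "y \<in> pts S" for y
    using linear_map_on_0[OF triv_linear[OF S N U(1)] subspace_fib[OF S N that]]
      linear_map_on_0[OF klin subspace_tmodel[OF S N]] by (simp add: f_def)
  moreover have "\<alpha> v = df_tensor N x f s v" for v
  proof (cases "v \<in> fib N x")
    case True
    have fx: "f (x, t *\<^sub>R v) = b (x, t *\<^sub>R v) * (t * a v)" for t
    proof -
      have tv: "t *\<^sub>R v \<in> fib N x" using True subspace_fib[OF S N x] by (simp add: subspace_scale)
      then have "k (\<Phi> x (t *\<^sub>R v)) = a (t *\<^sub>R v)" by (simp add: k_def triv_inv_triv[OF S N U])
      then show ?thesis using tv U linear_map_on_scale[OF alin True] by (simp add: f_def)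
    qed
    obtain D \<phi> where D: "(D, \<phi>) \<in> atlas S" "x \<in> D" by (rule premanifold_cover[OF S x])
    obtain d where d: "((\<lambda>t. b (x, 0 + t *\<^sub>R v)) has_real_derivative d) (at 0)"
      using fibre_line_derivative(1)[OF S N b(1) D(1) U(1) D(2) U(2) N0[OF x] True] by blast
    \<comment> \<open>The bump function does not disturb the derivative: its own derivative is
      multiplied by t = 0, and its value at the point is 1.\<close>
    have "((\<lambda>t. b (x, 0 + t *\<^sub>R v) * (t * a v)) has_real_derivative d * (0 * a v) + (1 * a v) * b (x, 0 + 0 *\<^sub>R v)) (at 0)"
      by (rule DERIV_mult[OF d]) (auto intro!: derivative_eq_intros)
    then have "((\<lambda>t. f (x, t *\<^sub>R v)) has_real_derivative a v) (at 0)"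
      using b(5,6) by (simp add: fx)
    moreover have "s (x, 0) = e" using x0 b(5,6) by (simp add: s_def e_def fibL)
    ultimately show ?thesis
      using True \<alpha>eq[OF True] DERIV_imp_deriv by (fastforce simp: df_tensor_def restrict_zero_def)
  qed (simp add: \<alpha>0 df_tensor_def restrict_zero_def)
  ultimately show ?thesis using f s by blast
qed

text \<open>Resolves the two nested choices. A pair \<open>f\<close>, \<open>s\<close> exists, so
  the chosen jet comes from such a pair; this jet contains \<open>fscale f s\<close>, so the chosen
  representative is an element of it. The subtracted term in \<open>gamma\<close> drops out because
  \<open>f\<close> vanishes on the zero section.\<close>

lemma gamma_representative:
  assumes S: "premanifold S" and N: "vector_bundle S N" and l: "vector_bundle S l"
    and dim: "dim (tmodel l) = 1" and x: "x \<in> pts S" and bump: "bump_at (total_space S N) (x, 0)"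
    and \<alpha>: "\<alpha> \<in> conormal N l x"
  obtains f s where "f \<in> Cinf (total_space S N)"
    "s \<in> sections (total_space S N) (bundle_over_total S N l)" "\<forall>y\<in>pts S. f (y, 0) = 0"
    "(SOME t. t \<in> gamma S N l x \<alpha>) \<in> sections (total_space S N) (bundle_over_total S N l)"
    "(SOME t. t \<in> gamma S N l x \<alpha>) - fscale f s \<in>
      span (jet_kernel (total_space S N) (bundle_over_total S N l) (x, 0))"
proof -
  let ?E = "total_space S N" and ?L = "bundle_over_total S N l"
  note pm = premanifold_total_space[OF S N] and vb = vector_bundle_over_total[OF S N l]
  define Q where "Q = (\<lambda>j. \<exists>f\<in>Cinf ?E. \<exists>s\<in>sections ?E ?L. (\<forall>y\<in>pts S. f (y, 0) = 0) \<and>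
    \<alpha> = df_tensor N x f s \<and> j = jet ?E ?L (x, 0) (fscale f s - f (x, 0) *\<^sub>R s))"
  have "\<exists>j. Q j" unfolding Q_def using conormal_as_df_tensor[OF assms] by blast
  then have "Q (gamma S N l x \<alpha>)" unfolding gamma_def Q_def[symmetric] by (rule someI_ex)
  then obtain f s where f: "f \<in> Cinf ?E" and s: "s \<in> sections ?E ?L" and 0: "\<forall>y\<in>pts S. f (y, 0) = 0"
    and j: "gamma S N l x \<alpha> = jet ?E ?L (x, 0) (fscale f s - f (x, 0) *\<^sub>R s)"
    unfolding Q_def by blast
  have j': "gamma S N l x \<alpha> = jet ?E ?L (x, 0) (fscale f s)" using 0 x by (simp add: j)
  have "\<exists>t. t \<in> gamma S N l x \<alpha>"
    unfolding j' jet_def using fscale_in_sections[OF pm vb f s]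
    by (intro exI[of _ "fscale f s"]) (simp add: span_zero)
  then have "(SOME t. t \<in> gamma S N l x \<alpha>) \<in> gamma S N l x \<alpha>" by (rule someI_ex)
  then show ?thesis using that[OF f s 0] unfolding j' jet_def jet_kernel_def by blast
qed

section \<open>Pushing sections forward\<close>

lemma Cinf_pullback:
  assumes M: "premanifold M" and M': "premanifold M'" and f: "smooth_map M (pts M) M' f" and b: "b \<in> Cinf M'"
  shows "restrict_zero (pts M) (\<lambda>y. b (f y)) \<in> Cinf M"
proof -
  have "{y \<in> pts M. f y \<in> pts M'} = pts M" using f unfolding smooth_map_def by blast
  then have "smooth_fun M (pts M) (\<lambda>y. b (f y))"
    using smooth_map_compose_fun[OF M M' f openin_mtop_pts[OF M'] CinfD(1)[OF b]] by simp
  then have "smooth_fun M (pts M) (restrict_zero (pts M) (\<lambda>y. b (f y)))"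
    by (rule smooth_fun_eqI[OF M]) (simp add: restrict_zero_def)
  then show ?thesis by (simp add: Cinf_def restrict_zero_def)
qed

text \<open>Smoothness of the bundle map is given on constant local frames only. Writing the section
  in a trivialisation and expanding its coordinates extends it to arbitrary sections; composing with
  the inverse embedding moves it to the image.\<close>

lemma local_section_push_forward:
  assumes M: "premanifold M" and M': "premanifold M'" and E: "vector_bundle M E" and E': "vector_bundle M' E'"
    and emb: "bundle_embedding M E M' E' f F" and s: "s \<in> sections M E"
  shows "local_section M' E' (f ` pts M) (\<lambda>p. F (inv_into (pts M) f p) (s (inv_into (pts M) f p)))"
proof -
  let ?i = "inv_into (pts M) f"
  have oe: "open_embedding M M' f"
    and lin: "\<And>y. y \<in> pts M \<Longrightarrow> linear_map_on (fib E y) (F y)"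
    and bij: "\<And>y. y \<in> pts M \<Longrightarrow> bij_betw (F y) (fib E y) (fib E' (f y))"
    and sm: "\<And>U \<Phi> U' \<Phi>' c. (U, \<Phi>) \<in> trivs E \<Longrightarrow> (U', \<Phi>') \<in> trivs E' \<Longrightarrow> c \<in> tmodel E \<Longrightarrow>
      smooth_fun M {y \<in> U. f y \<in> U'} (\<lambda>y. \<Phi>' (f y) (F y (inv_into (fib E y) (\<Phi> y) c)))"
    using emb unfolding bundle_embedding_def by fastforce+
  note inj = oe[unfolded open_embedding_def, THEN conjunct2, THEN conjunct1]
  have Fin: "F y v \<in> fib E' (f y)" if "y \<in> pts M" "v \<in> fib E y" for y v
    using bij[OF that(1)] that(2) bij_betwE by blast
  have smooth: "smooth_fun M' (U' \<inter> f ` pts M) (\<lambda>p. \<Phi>' p (F (?i p) (s (?i p))))"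
    if U': "(U', \<Phi>') \<in> trivs E'" for U' \<Phi>'
  proof -
    let ?V = "{y \<in> pts M. f y \<in> U'}"
    have V: "openin (mtop M) ?V"
      by (rule smooth_map_openin[OF M M' open_embedding_smooth_map[OF oe] triv_openin[OF M' E' U']])
    have "smooth_fun M ?V (\<lambda>y. \<Phi>' (f y) (F y (s y)))"
    proof (rule smooth_fun_local[OF M V])
      fix y assume y: "y \<in> ?V"
      then obtain U \<Phi> where U: "(U, \<Phi>) \<in> trivs E" "y \<in> U" using triv_cover[OF M E, of y] by blast
      let ?B = "?V \<inter> U"
      have "smooth_fun M ?B (\<lambda>y. \<Phi>' (f y) (F y (inv_into (fib E y) (\<Phi> y) (\<Phi> y (s y)))))"
      proof (rule smooth_fun_linear_family[OF M subspace_tmodel[OF M E], where c = "\<lambda>y. \<Phi> y (s y)"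
            and G = "\<lambda>y c. \<Phi>' (f y) (F y (inv_into (fib E y) (\<Phi> y) c))"])
        fix z assume z: "z \<in> ?B"
        then have zU: "z \<in> U" "z \<in> pts M" "f z \<in> U'" by auto
        show "linear_map_on (tmodel E) (\<lambda>c. \<Phi>' (f z) (F z (inv_into (fib E z) (\<Phi> z) c)))"
          using triv_inv_linear[OF M E U(1) zU(1)] triv_inv_in(1)[OF M E U(1) zU(1)] lin[OF zU(2)]
            Fin[OF zU(2)] triv_linear[OF M' E' U' zU(3)]
          by (simp add: linear_map_on_def)
        show "\<Phi> z (s z) \<in> tmodel E" using triv_in[OF M E U(1) zU(1) sections_fib[OF M E s zU(2)]] .
      next
        fix c assume "c \<in> tmodel E"
        from sm[OF U(1) U' this] show "smooth_fun M ?B (\<lambda>y. \<Phi>' (f y) (F y (inv_into (fib E y) (\<Phi> y) c)))"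
          by (rule smooth_fun_subset[OF M]) blast
      next
        show "smooth_fun M ?B (\<lambda>y. \<Phi> y (s y))"
          by (rule smooth_fun_subset[OF M sections_smooth[OF M E s U(1)]]) blast
      qed
      then have "smooth_fun M ?B (\<lambda>y. \<Phi>' (f y) (F y (s y)))"
        by (rule smooth_fun_eqI[OF M]) (simp add: triv_inv_triv[OF M E U(1)] sections_fib[OF M E s])
      then show "\<exists>A. openin (mtop M) A \<and> y \<in> A \<and> smooth_fun M (?V \<inter> A) (\<lambda>y. \<Phi>' (f y) (F y (s y)))"
        using triv_openin[OF M E U(1)] U(2) by blast
    qed
    from smooth_map_compose_fun[OF M' M open_embedding_inverse_smooth_map[OF M oe] V this]
    have "smooth_fun M' {p \<in> f ` pts M. ?i p \<in> ?V} (\<lambda>p. \<Phi>' (f (?i p)) (F (?i p) (s (?i p))))" .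
    moreover have "{p \<in> f ` pts M. ?i p \<in> ?V} = U' \<inter> f ` pts M" using inj by auto
    ultimately have "smooth_fun M' (U' \<inter> f ` pts M) (\<lambda>p. \<Phi>' (f (?i p)) (F (?i p) (s (?i p))))" by simp
    then show ?thesis by (rule smooth_fun_eqI[OF M']) (use inj in auto)
  qed
  have "F (?i p) (s (?i p)) \<in> fib E' p" if "p \<in> f ` pts M" for p
    using that inj Fin sections_fib[OF M E s] by fastforce
  then show ?thesis unfolding local_section_def using smooth by blast
qed

text \<open>The function \<open>h\<close> and the section \<open>s\<close> must each extend by zero
  to the ambient manifold, and each takes its own factor \<open>b\<close>. Extending them separately
  keeps the zeros of \<open>h\<close> visible in \<open>g\<close>.\<close>

lemma push_forward_product:
  assumes M: "premanifold M" and M': "premanifold M'" and E: "vector_bundle M E" and E': "vector_bundle M' E'"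
    and emb: "bundle_embedding M E M' E' f F" and s: "s \<in> sections M E" and h: "h \<in> Cinf M"
    and b: "b \<in> Cinf M'" "closedin (mtop M') C" "C \<subseteq> f ` pts M" "\<And>y. y \<notin> C \<Longrightarrow> b y = 0"
  obtains g u where "g \<in> Cinf M'" "u \<in> sections M' E'" "\<And>y. y \<in> pts M \<Longrightarrow> g (f y) = b (f y) * h y"
    "pull_section M E f F (fscale g u) =
      fscale (restrict_zero (pts M) (\<lambda>y. b (f y)) * restrict_zero (pts M) (\<lambda>y. b (f y)) * h) s"
proof -
  let ?i = "inv_into (pts M) f" and ?R = "f ` pts M"
  have oe: "open_embedding M M' f"
    and lin: "\<And>y. y \<in> pts M \<Longrightarrow> linear_map_on (fib E y) (F y)"
    and bij: "\<And>y. y \<in> pts M \<Longrightarrow> bij_betw (F y) (fib E y) (fib E' (f y))"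
    using emb unfolding bundle_embedding_def by blast+
  have inj: "inj_on f (pts M)" using oe unfolding open_embedding_def by blast
  have R: "openin (mtop M') ?R" by (rule open_embedding_open_map[OF M M' oe openin_mtop_pts[OF M]])
  define g where "g = (\<lambda>p. if p \<in> ?R then b p * h (?i p) else 0)"
  define u where "u = (\<lambda>p. if p \<in> ?R then b p *\<^sub>R F (?i p) (s (?i p)) else 0)"
  have "{p \<in> ?R. ?i p \<in> pts M} = ?R" using inj by auto
  then have "smooth_fun M' ?R (\<lambda>p. h (?i p))"
    using smooth_map_compose_fun[OF M' M open_embedding_inverse_smooth_map[OF M oe] openin_mtop_pts[OF M] CinfD(1)[OF h]]
    by simp
  then have g: "g \<in> Cinf M'" unfolding g_def using cutoff_function[OF M' _ R b] by blast
  have u: "u \<in> sections M' E'"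
    unfolding u_def by (rule cutoff_section[OF M' E' local_section_push_forward[OF M M' E E' emb s] R b])
  have gf: "g (f y) = b (f y) * h y" if "y \<in> pts M" for y using that inj by (simp add: g_def)
  have "pull_section M E f F (fscale g u) y =
      fscale (restrict_zero (pts M) (\<lambda>y. b (f y)) * restrict_zero (pts M) (\<lambda>y. b (f y)) * h) s y" for y
  proof (cases "y \<in> pts M")
    case True
    have "fscale g u (f y) = F y ((b (f y) * b (f y) * h y) *\<^sub>R s y)"
      using True inj linear_map_on_scale[OF lin[OF True] sections_fib[OF M E s True]]
      by (simp add: fscale_def g_def u_def)
    moreover have "(b (f y) * b (f y) * h y) *\<^sub>R s y \<in> fib E y"
      using subspace_fib[OF M E True] sections_fib[OF M E s True] by (simp add: subspace_scale)
    ultimately have "inv_into (fib E y) (F y) (fscale g u (f y)) = (b (f y) * b (f y) * h y) *\<^sub>R s y"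
      using bij_betw_inv_into_left[OF bij[OF True]] by simp
    then show ?thesis using True by (simp add: pull_section_def restrict_zero_def fscale_def)
  qed (simp add: pull_section_def restrict_zero_def fscale_def)
  then show ?thesis using that[OF g u gf] by blast
qed

section \<open>Vanishing of the Jacobi structure on conormal jets\<close>

lemma jacobi_first_order:
  assumes J: "jacobi_structure M L J" and s: "s \<in> sections M L"
  shows "first_order_op M L (\<lambda>t. J [s, t])" "first_order_op M L (\<lambda>t. J [t, s])"
proof -
  have *: "length as = 2 \<and> set as \<subseteq> sections M L \<Longrightarrow> i < 2 \<Longrightarrow> first_order_op M L (\<lambda>s. J (as[i := s]))" for as i
    using J unfolding jacobi_structure_def multi_diff_ops_def by blast
  show "first_order_op M L (\<lambda>t. J [s, t])" using *[of "[s, s]" 1] s by simp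
  show "first_order_op M L (\<lambda>t. J [t, s])" using *[of "[s, s]" 0] s by simp
qed

text \<open>
  For \<open>g\<close> vanishing on \<open>S\<close>, the vector field of \<open>\<Lambda>\<^sub>J\<^sup>#(dg \<otimes> u)\<close> on \<open>S\<close> is the symbol of
  \<open>{g u, -}\<close>; it is tangent to \<open>S\<close>, so it kills \<open>g'\<close>.
\<close>

lemma coisotropic_bracket_vanishes:
  assumes M: "smooth_manifold M" and L: "line_bundle M L" and J: "jacobi_structure M L J"
    and S: "submanifold M W S" and co: "coisotropic M L J W S" and x: "x \<in> S"
    and g: "g \<in> Cinf M" "g' \<in> Cinf M" "\<forall>y\<in>S. g y = 0" "\<forall>y\<in>S. g' y = 0"
    and u: "u \<in> sections M L" "u' \<in> sections M L"
  shows "J [fscale g u, fscale g' u'] x = 0"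
proof -
  note pm = smooth_manifold_imp_premanifold[OF M]
  have vb: "vector_bundle M L" and dim: "dim (tmodel L) = 1" using L unfolding line_bundle_def by auto
  have Spts: "S \<subseteq> pts M" using S unfolding submanifold_def by blast
  \<comment> \<open>A vector tangent to \<open>S\<close> acts on a function through its restriction
    to \<open>S\<close>, here the zero function.\<close>
  have zero: "v h = 0" if v: "v \<in> tangent_sub M W S x" and h: "h \<in> Cinf M" "\<forall>y\<in>S. h y = 0" for v h
  proof -
    obtain w where w: "w \<in> tangent (induced_manifold M W S) x" "v = (\<lambda>f. if f \<in> Cinf M then w (restrict_zero S f) else 0)"
      using v unfolding tangent_sub_def by blast
    have "restrict_zero S h = 0" using h(2) by (auto simp: restrict_zero_def fun_eq_iff)
    moreover have "w 0 = 0"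
      using w(1) linear_map_on_0[OF _ subspace_Cinf[OF premanifold_induced[OF pm S]]] unfolding tangent_def by blast
    ultimately show ?thesis using w(2) h(1) by simp
  qed
  note gu = fscale_in_sections[OF pm vb g(1) u(1)]
  \<comment> \<open>Existence makes the symbol chosen in \<open>hamiltonian\<close> an actual
    symbol.\<close>
  have "\<exists>X. has_symbol M L (\<lambda>t. J [fscale g u, t]) X"
    using first_order_op_symbol[OF pm vb dim bump_at_smooth_manifold[OF M] jacobi_first_order(1)[OF J gu]] by blast
  then have X: "has_symbol M L (\<lambda>t. J [fscale g u, t]) (hamiltonian M L J (fscale g u))"
    unfolding hamiltonian_def symbol_def by (rule someI_ex)
  \<comment> \<open>At \<open>x\<close> the second term of \<open>sharp\<close> carries the factor
    \<open>g x\<close> = 0, which leaves the Hamiltonian field of the product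
    \<open>g u\<close>.\<close>
  have "(\<lambda>h. sharp M L J g u h x) \<in> tangent_sub M W S x"
    using co x g u(1) zero unfolding coisotropic_def by blast
  from zero[OF this g(2,4)] have "hamiltonian M L J (fscale g u) g' x = 0"
    using g(3) x by (simp add: sharp_def)
  moreover have "J [fscale g u, fscale g' u'] =
      fscale (hamiltonian M L J (fscale g u) g') u' + fscale g' (J [fscale g u, u'])"
    using X g(2) u(2) unfolding has_symbol_def by blast
  ultimately show ?thesis using g(4) x by (simp add: fscale_def)
qed

lemma proj_P_jacobi_eq_0:
  assumes M: "smooth_manifold M" and L: "line_bundle M L" and JM: "jacobi_structure M L J\<^sub>M"
    and sub: "submanifold M W S\<^sub>0" and co: "coisotropic M L J\<^sub>M W S\<^sub>0"
    and S_def: "S = induced_manifold M W S\<^sub>0" and l_def: "l = restricted_bundle S\<^sub>0 L"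
    and N: "vector_bundle S N" and tub: "fat_tubular_nbhd M L S N \<tau>\<^sub>0 \<tau>"
    and ind: "induced_jacobi (total_space S N) (bundle_over_total S N l) M L \<tau>\<^sub>0 \<tau> J\<^sub>M J"
  shows "proj_P S N l J = 0"
proof -
  let ?E = "total_space S N" and ?L = "bundle_over_total S N l"
  note pmM = smooth_manifold_imp_premanifold[OF M]
  have vbM: "vector_bundle M L" and dimL: "dim (tmodel L) = 1" using L unfolding line_bundle_def by auto
  have S: "premanifold S" unfolding S_def by (rule premanifold_induced[OF pmM sub])
  have ptsS: "pts S = S\<^sub>0" by (simp add: S_def induced_manifold_def)
  have "smooth_map S (pts S) M (\<lambda>x. x)"
    using smooth_map_inclusion[OF pmM sub] ptsS by (simp add: S_def)
  then have l: "vector_bundle S l"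
    using vector_bundle_pullback[OF S pmM _ vbM] unfolding l_def restricted_bundle_def ptsS by blast
  have diml: "dim (tmodel l) = 1" using dimL by (simp add: l_def restricted_bundle_def pullback_def)
  note pm = premanifold_total_space[OF S N] and vb = vector_bundle_over_total[OF S N l]
  have emb: "bundle_embedding ?E ?L M L \<tau>\<^sub>0 \<tau>" and \<tau>0: "\<And>x. x \<in> S\<^sub>0 \<Longrightarrow> \<tau>\<^sub>0 (x, 0) = x"
    using tub unfolding fat_tubular_nbhd_def l_def ptsS by auto
  have oe: "open_embedding ?E M \<tau>\<^sub>0" using emb unfolding bundle_embedding_def by blast
  have x0: "(x, 0) \<in> pts ?E" if "x \<in> S\<^sub>0" for x
    using that subspace_0[OF subspace_fib[OF S N]] by (simp add: total_space_simps[OF S N] ptsS)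
  have \<tau>pts: "\<tau>\<^sub>0 y \<in> pts M" if "y \<in> pts ?E" for y using that oe unfolding open_embedding_def by blast
  have J: "jacobi_structure ?E ?L J" using ind unfolding induced_jacobi_def by blast
  have pull: "J [pull_section ?E ?L \<tau>\<^sub>0 \<tau> s, pull_section ?E ?L \<tau>\<^sub>0 \<tau> t] = pull_section ?E ?L \<tau>\<^sub>0 \<tau> (J\<^sub>M [s, t])"
    if "s \<in> sections M L" "t \<in> sections M L" for s t
    using ind that unfolding induced_jacobi_def by blast
  have main: "J [SOME t. t \<in> gamma S N l x \<alpha>, SOME t. t \<in> gamma S N l x \<beta>] (x, 0) = 0"
    if x: "x \<in> S\<^sub>0" and \<alpha>: "\<alpha> \<in> conormal N l x" and \<beta>: "\<beta> \<in> conormal N l x" for x \<alpha> \<beta>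
  proof -
    have xM: "x \<in> pts M" using \<tau>pts[OF x0[OF x]] \<tau>0[OF x] by simp
    have bumpE: "bump_at ?E (x, 0)"
      using bump_at_open_embedding[OF pm pmM oe x0[OF x]] bump_at_smooth_manifold[OF M xM] \<tau>0[OF x] by simp
    have R: "openin (mtop M) (\<tau>\<^sub>0 ` pts ?E)"
      by (rule open_embedding_open_map[OF pm pmM oe openin_mtop_pts[OF pm]])
    have xR: "x \<in> \<tau>\<^sub>0 ` pts ?E" using x0[OF x] \<tau>0[OF x] by (metis imageI)
    obtain b C B where b: "b \<in> Cinf M" "closedin (mtop M) C" "C \<subseteq> \<tau>\<^sub>0 ` pts ?E" "\<And>y. y \<notin> C \<Longrightarrow> b y = 0"
      "x \<in> B" "\<And>y. y \<in> B \<Longrightarrow> b y = 1"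
      by (rule bump_atE[OF bump_at_smooth_manifold[OF M xM] R xR]) auto
    define bE where "bE = restrict_zero (pts ?E) (\<lambda>y. b (\<tau>\<^sub>0 y))"
    have bE: "bE \<in> Cinf ?E" "bE (x, 0) = 1"
      unfolding bE_def using Cinf_pullback[OF pm pmM open_embedding_smooth_map[OF oe] b(1)] x0[OF x] \<tau>0[OF x] b(5,6)
      by (simp_all add: restrict_zero_def)
    \<comment> \<open>\<open>J\<close> is tied to \<open>J\<^sub>M\<close> on pulled-back sections
      only, so the chosen representative must be exchanged for the pull-back of a product without
      changing its jet at (x, 0).\<close>
    have rep: "\<exists>g u. g \<in> Cinf M \<and> u \<in> sections M L \<and> (\<forall>y\<in>S\<^sub>0. g y = 0) \<and>
        pull_section ?E ?L \<tau>\<^sub>0 \<tau> (fscale g u) \<in> sections ?E ?L \<and>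
        (SOME t. t \<in> gamma S N l x \<alpha>) \<in> sections ?E ?L \<and>
        (SOME t. t \<in> gamma S N l x \<alpha>) - pull_section ?E ?L \<tau>\<^sub>0 \<tau> (fscale g u) \<in> span (jet_kernel ?E ?L (x, 0))"
      if \<alpha>: "\<alpha> \<in> conormal N l x" for \<alpha>
    proof -
      let ?t = "SOME t. t \<in> gamma S N l x \<alpha>"
      obtain f s where f: "f \<in> Cinf ?E" "s \<in> sections ?E ?L" "\<forall>y\<in>pts S. f (y, 0) = 0"
        "?t \<in> sections ?E ?L" "?t - fscale f s \<in> span (jet_kernel ?E ?L (x, 0))"
        by (rule gamma_representative[OF S N l diml _ bumpE \<alpha>]) (use x ptsS in auto)
      obtain g u where g: "g \<in> Cinf M" "u \<in> sections M L" "\<And>y. y \<in> pts ?E \<Longrightarrow> g (\<tau>\<^sub>0 y) = b (\<tau>\<^sub>0 y) * f y"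
        and pu: "pull_section ?E ?L \<tau>\<^sub>0 \<tau> (fscale g u) = fscale (bE * bE * f) s"
        unfolding bE_def by (rule push_forward_product[OF pm pmM vb vbM emb f(2,1) b(1-4)]) auto
      have "g y = 0" if "y \<in> S\<^sub>0" for y
        using g(3)[OF x0[OF that]] \<tau>0[OF that] f(3) that ptsS by simp
      moreover have "fscale (bE * bE * f) s \<in> sections ?E ?L"
        by (intro fscale_in_sections[OF pm vb] Cinf_mult[OF pm] bE f(1,2))
      (* Both 1 - bE^2 and f vanish at (x, 0), so the cutoff does not change the jet. *)
      moreover have "?t - fscale (bE * bE * f) s \<in> span (jet_kernel ?E ?L (x, 0))"
      proof -
        define k where "k = restrict_zero (pts ?E) (\<lambda>x. 1) + (- 1) *\<^sub>R (bE * bE)"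
        have k: "k \<in> Cinf ?E" unfolding k_def
          by (intro Cinf_add[OF pm] Cinf_scaleR[OF pm] Cinf_mult[OF pm] bE(1) Cinf_restrict_const[OF pm])
        have "k (x, 0) = 0" using bE(2) x0[OF x] by (simp add: k_def restrict_zero_def scaleR_fun_def)
        moreover have "f (x, 0) = 0" using f(3) x ptsS by simp
        ultimately have "fscale (k * f) s \<in> jet_kernel ?E ?L (x, 0)"
          unfolding jet_kernel_def using k f(1,2) by blast
        then have "(?t - fscale f s) + fscale (k * f) s \<in> span (jet_kernel ?E ?L (x, 0))"
          using f(5) span_add span_base by blast
        moreover have "(?t - fscale f s) + fscale (k * f) s = ?t - fscale (bE * bE * f) s"
        proof
          fix y show "((?t - fscale f s) + fscale (k * f) s) y = (?t - fscale (bE * bE * f) s) y"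
            using CinfD(2)[OF f(1), of y]
            by (cases "y \<in> pts ?E") (simp_all add: fscale_def k_def restrict_zero_def scaleR_fun_def algebra_simps)
        qed
        ultimately show ?thesis by simp
      qed
      ultimately show ?thesis using g(1,2) f(4) unfolding pu[symmetric] by blast
    qed
    let ?s = "SOME t. t \<in> gamma S N l x \<alpha>" and ?t = "SOME t. t \<in> gamma S N l x \<beta>"
    obtain g u where g: "g \<in> Cinf M" "u \<in> sections M L" "\<forall>y\<in>S\<^sub>0. g y = 0"
      and p: "pull_section ?E ?L \<tau>\<^sub>0 \<tau> (fscale g u) \<in> sections ?E ?L" "?s \<in> sections ?E ?L"
        "?s - pull_section ?E ?L \<tau>\<^sub>0 \<tau> (fscale g u) \<in> span (jet_kernel ?E ?L (x, 0))"
      using rep[OF \<alpha>] by blast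
    obtain g' u' where g': "g' \<in> Cinf M" "u' \<in> sections M L" "\<forall>y\<in>S\<^sub>0. g' y = 0"
      and p': "pull_section ?E ?L \<tau>\<^sub>0 \<tau> (fscale g' u') \<in> sections ?E ?L" "?t \<in> sections ?E ?L"
        "?t - pull_section ?E ?L \<tau>\<^sub>0 \<tau> (fscale g' u') \<in> span (jet_kernel ?E ?L (x, 0))"
      using rep[OF \<beta>] by blast
    \<comment> \<open>\<open>J\<close> is of first order in each slot, so the representatives are
      exchanged one slot at a time.\<close>
    have "J [?s, ?t] (x, 0) = J [pull_section ?E ?L \<tau>\<^sub>0 \<tau> (fscale g u), ?t] (x, 0)"
      by (rule first_order_op_jet[OF pm vb jacobi_first_order(2)[OF J p'(2)] p])
    also have "\<dots> = J [pull_section ?E ?L \<tau>\<^sub>0 \<tau> (fscale g u), pull_section ?E ?L \<tau>\<^sub>0 \<tau> (fscale g' u')] (x, 0)"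
      by (rule first_order_op_jet[OF pm vb jacobi_first_order(1)[OF J p(1)] p'])
    also have "\<dots> = pull_section ?E ?L \<tau>\<^sub>0 \<tau> (J\<^sub>M [fscale g u, fscale g' u']) (x, 0)"
      using pull[OF fscale_in_sections[OF pmM vbM g(1,2)] fscale_in_sections[OF pmM vbM g'(1,2)]] by simp
    \<comment> \<open>Pulling back is pointwise, so it is enough that the ambient bracket vanishes
      at \<open>x\<close>; the inverse of a linear bijection of fibres sends 0 to 0.\<close>
    also have "\<dots> = inv_into (fib ?L (x, 0)) (\<tau> (x, 0)) 0"
      using coisotropic_bracket_vanishes[OF M L JM sub co x g(1) g'(1) g(3) g'(3) g(2) g'(2)] x0[OF x] \<tau>0[OF x]
      by (simp add: pull_section_def restrict_zero_def)
    also have "\<dots> = 0"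
    proof -
      have "linear_map_on (fib ?L (x, 0)) (\<tau> (x, 0))" "bij_betw (\<tau> (x, 0)) (fib ?L (x, 0)) (fib L (\<tau>\<^sub>0 (x, 0)))"
        using emb x0[OF x] unfolding bundle_embedding_def by blast+
      then show ?thesis
        using linear_map_on_0 subspace_fib[OF pm vb x0[OF x]] subspace_0 bij_betw_inv_into_left by metis
    qed
    finally show ?thesis .
  qed
  \<comment> \<open>\<open>proj_P\<close> accepts lists of every length; for lengths other than 2
    the normalisation of multi-differential operators gives 0.\<close>
  have J0: "J as = 0" if "length as \<noteq> 2" for as
    using J that unfolding jacobi_structure_def multi_diff_ops_def by blast
  have "proj_P S N l J x \<alpha>s = 0" for x \<alpha>s
  proof (cases "x \<in> pts S \<and> set \<alpha>s \<subseteq> conormal N l x \<and> length \<alpha>s = 2")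
    case True
    then obtain \<alpha> \<beta> where "\<alpha>s = [\<alpha>, \<beta>]" by (auto simp: numeral_2_eq_2 length_Suc_conv)
    then show ?thesis using True main[of x \<alpha> \<beta>] ptsS by (simp add: proj_P_def form_at_def)
  next
    case False
    then show ?thesis using J0 by (auto simp: proj_P_def form_at_def)
  qed
  then show ?thesis by (simp add: fun_eq_iff)
qed

section \<open>Brackets with unary operators\<close>

lemma sum_fun_apply: "(\<Sum>i\<in>A. f i) x = (\<Sum>i\<in>A. f i x)"
  by (induction A rule: infinite_finite_induct) simp_all

lemma permutes_2:
  assumes "\<tau> permutes {..<2::nat}"
  shows "\<tau> = id \<or> \<tau> = Transposition.transpose 0 1"
proof -
  have "{..<2::nat} = {0, 1}" by auto
  then have "\<tau> \<in> {p. p permutes {0, 1}}" using assms by simp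
  then show ?thesis by (simp add: permutes_doubleton_iff)
qed

lemma unshuffles_2_0: "unshuffles 2 0 = {id}"
proof
  show "unshuffles 2 0 \<subseteq> {id}"
  proof
    fix \<tau> assume \<tau>: "\<tau> \<in> unshuffles 2 0"
    then have "\<tau> 0 < \<tau> 1" unfolding unshuffles_def strict_mono_on_def by simp
    moreover have "\<tau> = id \<or> \<tau> = Transposition.transpose 0 1"
      using \<tau> permutes_2 by (simp add: unshuffles_def)
    ultimately show "\<tau> \<in> {id}" by auto
  qed
  show "{id} \<subseteq> unshuffles 2 0" by (auto simp: unshuffles_def permutes_id strict_mono_on_def)
qed

lemma unshuffles_1_1: "unshuffles 1 1 = {id, Transposition.transpose 0 1}"
proof
  show "unshuffles 1 1 \<subseteq> {id, Transposition.transpose 0 1}"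
    using permutes_2 by (auto simp: unshuffles_def numeral_2_eq_2)
  have "Transposition.transpose 0 1 permutes {..<2::nat}" by (rule permutes_swap_id) auto
  then show "{id, Transposition.transpose 0 1} \<subseteq> unshuffles 1 1"
    by (auto simp: unshuffles_def permutes_id strict_mono_on_def numeral_2_eq_2)
qed

text \<open>With arities 2 and 1 the sign exponent (p + 1)(q + 1) is 6 in either order, so the
  bracket is a plain commutator.\<close>

lemma SJ_antisym: "SJ M L 2 1 B B' = - SJ M L 1 2 B' B"
  by (simp add: SJ_def)

text \<open>The last term keeps the argument order produced by the transposition in
  \<open>op_comp\<close>. For skew-symmetric \<open>B\<close> this is the usual formula, with
  \<open>B [s, \<Delta> t]\<close> subtracted.\<close>

definition lie_derivative ::
  "('a, 'e::euclidean_space) manifold \<Rightarrow> ('a, 'f::euclidean_space, 'l::real_vector) vbundle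
    \<Rightarrow> (('a \<Rightarrow> 'l) \<Rightarrow> 'a \<Rightarrow> 'l) \<Rightarrow> ('a, 'l) multi_op \<Rightarrow> ('a, 'l) multi_op"
  where "lie_derivative M L \<Delta> B = (\<lambda>as. if length as = 2 \<and> set as \<subseteq> sections M L
    then \<Delta> (B as) - B [\<Delta> (as ! 0), as ! 1] + B [\<Delta> (as ! 1), as ! 0] else 0)"

text \<open>
  Oddness is the part of bilinearity that relates the brackets with \<open>I (- \<nu>)\<close> and \<open>I \<nu>\<close>.
\<close>

definition odd_binary_op ::
  "('a, 'e::euclidean_space) manifold \<Rightarrow> ('a, 'f::euclidean_space, 'l::real_vector) vbundle
    \<Rightarrow> ('a, 'l) multi_op \<Rightarrow> bool"
  where "odd_binary_op M L B \<longleftrightarrow> (\<forall>s\<in>sections M L. \<forall>t\<in>sections M L.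
    B [s, t] \<in> sections M L \<and> B [- s, t] = - B [s, t] \<and> B [s, - t] = - B [s, t])"

definition linear_op ::
  "('a, 'e::euclidean_space) manifold \<Rightarrow> ('a, 'f::euclidean_space, 'l::real_vector) vbundle
    \<Rightarrow> (('a \<Rightarrow> 'l) \<Rightarrow> 'a \<Rightarrow> 'l) \<Rightarrow> bool"
  where "linear_op M L \<Delta> \<longleftrightarrow> \<Delta> ` sections M L \<subseteq> sections M L \<and> linear_map_on (sections M L) \<Delta>"

lemma two_sections:
  assumes "length as = 2" "set as \<subseteq> sections M L"
  obtains s t where "as = [s, t]" "s \<in> sections M L" "t \<in> sections M L"
  using assms by (auto simp: numeral_2_eq_2 length_Suc_conv)

text \<open>Zero is its own negative, so oddness forces a value equal to its negative.\<close>

lemma odd_binary_op_zero: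
  assumes "odd_binary_op M L B" "subspace (sections M L)" "s \<in> sections M L"
  shows "B [0, s] = 0"
proof -
  have "B [- 0, s] = - B [0, s]"
    using assms subspace_0 unfolding odd_binary_op_def by blast
  then have "B [0, s] y = - B [0, s] y" for y by (metis minus_zero uminus_apply)
  then have "2 *\<^sub>R B [0, s] y = 0" for y by (simp add: scaleR_2 eq_neg_iff_add_eq_0)
  then show ?thesis by (simp add: fun_eq_iff)
qed

text \<open>With \<open>B\<close> inside, the identity is the only unshuffle; with the unary
  operator inside there are two, the transposition having sign -1. Membership of the intermediate
  values in \<open>sections\<close> keeps the normalisations from interfering.\<close>

lemma SJ_unary:
  assumes B: "odd_binary_op M L B" and \<Delta>: "linear_op M L \<Delta>"
  shows "SJ M L 1 2 (unary M L \<Delta>) B = lie_derivative M L \<Delta> B"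
proof
  fix as
  show "SJ M L 1 2 (unary M L \<Delta>) B as = lie_derivative M L \<Delta> B as"
  proof (cases "length as = 2 \<and> set as \<subseteq> sections M L")
    case True
    then obtain s t where as: "as = [s, t]" and s: "s \<in> sections M L" and t: "t \<in> sections M L"
      using two_sections by blast
    have m: "map ((!) [s, t]) [0..<2] = [s, t]" by (simp add: numeral_2_eq_2)
    have Bst: "B [s, t] \<in> sections M L" using B s t unfolding odd_binary_op_def by blast
    have "op_comp M L 1 2 (unary M L \<Delta>) B as = \<Delta> (B as)"
      using Bst s t by (simp add: op_comp_def unshuffles_2_0 as m unary_def sign_id)
    moreover have "op_comp M L 2 1 B (unary M L \<Delta>) as = B [\<Delta> s, t] - B [\<Delta> t, s]"
    proof -
      have "(id :: nat \<Rightarrow> nat) \<noteq> Transposition.transpose 0 1" by (metis id_apply transpose_apply_first zero_neq_one)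
      then show ?thesis
        using s t unshuffles_1_1
        by (simp add: op_comp_def as unary_def sign_id sign_swap_id numeral_2_eq_2)
    qed
    ultimately show ?thesis using s t by (simp add: SJ_def lie_derivative_def as)
  qed (auto simp: SJ_def lie_derivative_def op_comp_def)
qed

context
  fixes M :: "('a, 'e::euclidean_space) manifold"
    and L :: "('a, 'f::euclidean_space, 'l::real_vector) vbundle"
  assumes sub: "subspace (sections M L)"
begin

lemma odd_binary_op_lie_derivative:
  assumes B: "odd_binary_op M L B" and \<Delta>: "linear_op M L \<Delta>"
  shows "odd_binary_op M L (lie_derivative M L \<Delta> B)"
  unfolding odd_binary_op_def
proof (intro ballI)
  fix s t assume s: "s \<in> sections M L" and t: "t \<in> sections M L"
  have neg: "- u \<in> sections M L" if "u \<in> sections M L" for u using that sub by (rule_tac subspace_neg)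
  have \<Delta>neg: "\<Delta> (- u) = - \<Delta> u" if "u \<in> sections M L" for u
    using \<Delta> linear_map_on_scale[of "sections M L" \<Delta> u "- 1"] that unfolding linear_op_def by simp
  have \<Delta>in: "\<Delta> u \<in> sections M L" if "u \<in> sections M L" for u using \<Delta> that unfolding linear_op_def by blast
  have Bin: "B [u, v] \<in> sections M L" "B [- u, v] = - B [u, v]" "B [u, - v] = - B [u, v]"
    if "u \<in> sections M L" "v \<in> sections M L" for u v
    using B that unfolding odd_binary_op_def by blast+
  show "lie_derivative M L \<Delta> B [s, t] \<in> sections M L \<and>
      lie_derivative M L \<Delta> B [- s, t] = - lie_derivative M L \<Delta> B [s, t] \<and>
      lie_derivative M L \<Delta> B [s, - t] = - lie_derivative M L \<Delta> B [s, t]"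
    using s t by (simp add: lie_derivative_def neg \<Delta>neg \<Delta>in Bin subspace_add subspace_diff sub)
qed

lemma odd_binary_op_sum:
  assumes "\<And>i. i \<in> A \<Longrightarrow> odd_binary_op M L (B i)"
  shows "odd_binary_op M L (\<Sum>i\<in>A. B i)"
  unfolding odd_binary_op_def
proof (intro ballI)
  fix s t assume s: "s \<in> sections M L" and t: "t \<in> sections M L"
  have "\<And>i. i \<in> A \<Longrightarrow> B i [s, t] \<in> sections M L \<and> B i [- s, t] = - B i [s, t] \<and> B i [s, - t] = - B i [s, t]"
    using assms s t unfolding odd_binary_op_def by blast
  then show "(\<Sum>i\<in>A. B i) [s, t] \<in> sections M L \<and> (\<Sum>i\<in>A. B i) [- s, t] = - (\<Sum>i\<in>A. B i) [s, t] \<and>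
      (\<Sum>i\<in>A. B i) [s, - t] = - (\<Sum>i\<in>A. B i) [s, t]"
    by (simp add: sum_fun_apply sum_negf subspace_sum[OF sub])
qed

text \<open>Two of the terms are additive in \<open>B\<close> by evaluation. The first needs
  \<Delta> to be additive, which is known on sections only, hence the condition on the
  summands.\<close>

lemma lie_derivative_sum:
  assumes \<Delta>: "linear_op M L \<Delta>" and B: "\<And>i. i \<in> A \<Longrightarrow> odd_binary_op M L (B i)"
  shows "lie_derivative M L \<Delta> (\<Sum>i\<in>A. B i) = (\<Sum>i\<in>A. lie_derivative M L \<Delta> (B i))"
proof
  fix as
  show "lie_derivative M L \<Delta> (\<Sum>i\<in>A. B i) as = (\<Sum>i\<in>A. lie_derivative M L \<Delta> (B i)) as"
  proof (cases "length as = 2 \<and> set as \<subseteq> sections M L")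
    case True
    then obtain s t where as: "as = [s, t]" "s \<in> sections M L" "t \<in> sections M L"
      using two_sections by blast
    have "\<Delta> (\<Sum>i\<in>A. B i as) = (\<Sum>i\<in>A. \<Delta> (B i as))"
      using \<Delta> B as unfolding linear_op_def odd_binary_op_def
      by (intro linear_map_on_sum[OF _ sub]) auto
    then show ?thesis
      using True by (simp add: lie_derivative_def sum_fun_apply sum.distrib sum_subtractf)
  next
    case False
    then have "lie_derivative M L \<Delta> X as = 0" for X by (auto simp: lie_derivative_def)
    then show ?thesis by (simp add: sum_fun_apply)
  qed
qed

lemma lie_derivative_0: "linear_op M L \<Delta> \<Longrightarrow> lie_derivative M L \<Delta> 0 = 0"
  using lie_derivative_sum[of \<Delta> "{}"] by simp

text \<open>The sign passes through \<open>B\<close> because \<open>B\<close> is odd in its first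
  slot, the only slot in which \<Delta> appears in this form of the formula.\<close>

lemma lie_derivative_minus:
  assumes B: "odd_binary_op M L B" and \<Delta>: "linear_op M L \<Delta>"
    and neg: "\<And>s. s \<in> sections M L \<Longrightarrow> \<Delta>' s = - \<Delta> s"
  shows "lie_derivative M L \<Delta>' B = - lie_derivative M L \<Delta> B"
proof
  fix as
  show "lie_derivative M L \<Delta>' B as = (- lie_derivative M L \<Delta> B) as"
  proof (cases "length as = 2 \<and> set as \<subseteq> sections M L")
    case True
    then obtain s t where as: "as = [s, t]" "s \<in> sections M L" "t \<in> sections M L"
      using two_sections by blast
    have "\<Delta> s \<in> sections M L" "\<Delta> t \<in> sections M L" using \<Delta> as unfolding linear_op_def by auto
    then show ?thesis
      using as B neg by (simp add: lie_derivative_def odd_binary_op_def)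
  qed (auto simp: lie_derivative_def)
qed

lemma lie_derivative_zero:
  assumes B: "odd_binary_op M L B" and 0: "\<And>s. s \<in> sections M L \<Longrightarrow> \<Delta> s = 0"
  shows "lie_derivative M L \<Delta> B = 0"
proof
  fix as
  show "lie_derivative M L \<Delta> B as = 0 as"
  proof (cases "length as = 2 \<and> set as \<subseteq> sections M L")
    case True
    then obtain s t where as: "as = [s, t]" "s \<in> sections M L" "t \<in> sections M L"
      using two_sections by blast
    then show ?thesis
      using 0 B odd_binary_op_zero[OF B sub] by (simp add: lie_derivative_def odd_binary_op_def)
  qed (auto simp: lie_derivative_def)
qed

abbreviation iterated_lie ::
  "(nat \<Rightarrow> ('a \<Rightarrow> 'l) \<Rightarrow> 'a \<Rightarrow> 'l) \<Rightarrow> ('a, 'l) multi_op \<Rightarrow> nat list \<Rightarrow> ('a, 'l) multi_op"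
  where "iterated_lie \<Delta> B is \<equiv> foldl (\<lambda>B i. lie_derivative M L (\<Delta> i) B) B is"

lemma odd_binary_op_iterated_lie:
  assumes "\<And>i. linear_op M L (\<Delta> i)"
  shows "odd_binary_op M L B \<Longrightarrow> odd_binary_op M L (iterated_lie \<Delta> B is)"
  by (induction "is" arbitrary: B) (simp_all add: odd_binary_op_lie_derivative assms)

text \<open>With \<Delta> 0 coming from s_0 = 0, this removes every term that uses the constant
  coefficient of the deformation, and so makes the coefficients of the exponential finite
  sums.\<close>

lemma iterated_lie_eq_0:
  assumes \<Delta>: "\<And>i. linear_op M L (\<Delta> i)" and 0: "\<And>s. s \<in> sections M L \<Longrightarrow> \<Delta> 0 s = 0"
  shows "odd_binary_op M L B \<Longrightarrow> 0 \<in> set is \<Longrightarrow> iterated_lie \<Delta> B is = 0"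
proof (induction "is" arbitrary: B)
  case (Cons i "is")
  show ?case
  proof (cases "i = 0")
    case True
    \<comment> \<open>Once an intermediate operator is zero, all further brackets stay zero.\<close>
    have "iterated_lie \<Delta> 0 js = 0" for js
      by (induction js) (simp_all only: foldl.simps lie_derivative_0[OF \<Delta>])
    then show ?thesis using True lie_derivative_zero[OF Cons.prems(1) 0] by simp
  qed (use Cons odd_binary_op_lie_derivative \<Delta> in auto)
qed simp

end

section \<open>Formal power series\<close>

text \<open>Weak compositions, with parts 0 allowed: they index the contributions of order
  \<open>n\<close> to a multilinear expression in \<open>k\<close> power series.\<close>

definition compositions :: "nat \<Rightarrow> nat \<Rightarrow> nat list set"
  where "compositions k n = {is. length is = k \<and> sum_list is = n}"

lemma finite_compositions: "finite (compositions k n)"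
proof (rule finite_subset)
  show "compositions k n \<subseteq> {is. set is \<subseteq> {..n} \<and> length is = k}"
    using member_le_sum_list by (fastforce simp: compositions_def)
qed (simp add: finite_lists_length_eq)

text \<open>The last part is split off, not the first, because \<open>foldl\<close> applies the last
  index as the outermost bracket.\<close>

lemma sum_compositions_Suc:
  fixes g :: "nat list \<Rightarrow> 'b::comm_monoid_add"
  shows "(\<Sum>is\<in>compositions (Suc k) n. g is) = (\<Sum>i\<le>n. \<Sum>is\<in>compositions k (n - i). g (is @ [i]))"
proof -
  have "(\<Sum>i\<le>n. \<Sum>is\<in>compositions k (n - i). g (is @ [i])) =
      (\<Sum>(i, is)\<in>Sigma {..n} (\<lambda>i. compositions k (n - i)). g (is @ [i]))"
    by (rule sum.Sigma) (simp_all add: finite_compositions)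
  also have "\<dots> = (\<Sum>is\<in>compositions (Suc k) n. g is)"
    by (rule sum.reindex_bij_witness[of _ "\<lambda>is. (last is, butlast is)" "\<lambda>(i, is). is @ [i]"])
      (auto simp: compositions_def length_Suc_conv_rev)
  finally show ?thesis by simp
qed

lemma zero_in_composition: "is \<in> compositions k n \<Longrightarrow> n < k \<Longrightarrow> 0 \<in> set is"
proof (rule ccontr)
  assume "is \<in> compositions k n" "n < k" "0 \<notin> set is"
  have "length is \<le> sum_list is" if "0 \<notin> set is" for "is" :: "nat list"
    using that by (induction "is") auto
  then show False using \<open>is \<in> compositions k n\<close> \<open>n < k\<close> \<open>0 \<notin> set is\<close> by (fastforce simp: compositions_def)
qed

context
  fixes M :: "('a, 'e::euclidean_space) manifold"
    and L :: "('a, 'f::euclidean_space, 'l::real_vector) vbundle"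
  assumes sub: "subspace (sections M L)"
begin

text \<open>Each application of the operator appends one index to the list. Oddness of all partial
  sums is carried along, since the bracket has its explicit form on odd operators.\<close>

lemma lie_op_power:
  assumes \<Delta>: "\<And>i. linear_op M L (\<Delta> i)" and J: "odd_binary_op M L J"
  shows "(lie_op M L 2 (\<lambda>i. unary M L (\<Delta> i)) ^^ k) (const_series J) n =
    (\<Sum>is\<in>compositions k n. iterated_lie M L \<Delta> J is)"
proof (induction k arbitrary: n)
  case 0
  have "compositions 0 n = (if n = 0 then {[]} else {})" by (auto simp: compositions_def)
  then show ?case by (simp add: const_series_def zero_fun_def)
next
  case (Suc k)
  let ?B = "(lie_op M L 2 (\<lambda>i. unary M L (\<Delta> i)) ^^ k) (const_series J)"
  note odd = odd_binary_op_iterated_lie[OF sub \<Delta> J]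
  have "odd_binary_op M L (?B m)" for m
    unfolding Suc.IH by (rule odd_binary_op_sum[OF sub odd])
  then have "lie_op M L 2 (\<lambda>i. unary M L (\<Delta> i)) ?B n = (\<Sum>i\<le>n. lie_derivative M L (\<Delta> i) (?B (n - i)))"
    unfolding lie_op_def by (intro sum.cong refl SJ_unary \<Delta>)
  also have "\<dots> = (\<Sum>i\<le>n. \<Sum>is\<in>compositions k (n - i). iterated_lie M L \<Delta> J (is @ [i]))"
    unfolding Suc.IH by (simp add: lie_derivative_sum[OF sub \<Delta> odd])
  finally show ?case by (simp add: sum_compositions_Suc)
qed

end

text \<open>\<open>form_at\<close> chooses its representatives from the jets alone, independently of
  the operator; additivity therefore holds for arbitrary operators.\<close>

lemma proj_P_sum: "proj_P S N l (\<Sum>i\<in>A. B i) = (\<Sum>i\<in>A. proj_P S N l (B i))"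
proof (intro ext)
  fix x \<alpha>s
  show "proj_P S N l (\<Sum>i\<in>A. B i) x \<alpha>s = (\<Sum>i\<in>A. proj_P S N l (B i)) x \<alpha>s"
  proof (cases "x \<in> pts S \<and> set \<alpha>s \<subseteq> conormal N l x")
    case False
    then have "proj_P S N l B x \<alpha>s = 0" for B by (auto simp: proj_P_def)
    then show ?thesis by (simp add: sum_fun_apply)
  qed (simp add: proj_P_def form_at_def sum_fun_apply)
qed

lemma proj_P_scaleR: "proj_P S N l (c *\<^sub>R B) = c *\<^sub>R proj_P S N l B"
  by (simp add: fun_eq_iff proj_P_def form_at_def scaleR_fun_def)

lemma proj_P_0: "proj_P S N l 0 = 0"
  by (simp add: fun_eq_iff proj_P_def form_at_def)

lemma jacobi_structure_odd:
  assumes M: "premanifold M" and L: "vector_bundle M L" and J: "jacobi_structure M L J"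
  shows "odd_binary_op M L J"
  unfolding odd_binary_op_def
proof (intro ballI)
  fix s t assume s: "s \<in> sections M L" and t: "t \<in> sections M L"
  note a = jacobi_first_order(1)[OF J s] and b = jacobi_first_order(2)[OF J t]
  show "J [s, t] \<in> sections M L \<and> J [- s, t] = - J [s, t] \<and> J [s, - t] = - J [s, t]"
    using first_order_op_sections[OF M L a t]
      linear_map_on_scale[OF first_order_op_linear[OF M L a] t, of "- 1"]
      linear_map_on_scale[OF first_order_op_linear[OF M L b] s, of "- 1"] by simp
qed

section \<open>The canonical connection and the comparison of the two series\<close>

context
  fixes S :: "('a, 'e::euclidean_space) manifold"
    and N :: "('a, 'g::euclidean_space, 'v::real_vector) vbundle"
    and l :: "('a, 'f::euclidean_space, 'l::real_vector) vbundle"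
    and \<D> :: "(('a \<times> 'v \<Rightarrow> real) \<Rightarrow> 'a \<times> 'v \<Rightarrow> real) \<Rightarrow> ('a \<times> 'v \<Rightarrow> 'l) \<Rightarrow> 'a \<times> 'v \<Rightarrow> 'l"
  assumes S: "premanifold S" and N: "vector_bundle S N" and l: "vector_bundle S l"
    and \<D>: "canonical_connection S N l \<D>"
begin

lemma connection_linear_op:
  assumes "\<nu> \<in> sections S N"
  shows "linear_op (total_space S N) (bundle_over_total S N l) (\<D> (vertical_lift S N \<nu>))"
  using \<D> vertical_lift_in_vertical_fields[OF S N assms]
  unfolding canonical_connection_def derivation_with_symbol_def linear_op_def by blast

text \<open>Homogeneity over the reals is extracted from linearity over functions, with the scalar
  as a function constant on the total space.\<close>

lemma connection_scale:
  assumes \<nu>: "\<nu> \<in> sections S N"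
    and s: "s \<in> sections (total_space S N) (bundle_over_total S N l)"
  shows "\<D> (\<lambda>h. c *\<^sub>R vertical_lift S N \<nu> h) s = c *\<^sub>R \<D> (vertical_lift S N \<nu>) s"
proof -
  let ?E = "total_space S N" and ?X = "vertical_lift S N \<nu>"
  note pm = premanifold_total_space[OF S N] and X = vertical_lift_in_vertical_fields[OF S N \<nu>]
  define k where "k = restrict_zero (pts ?E) (\<lambda>_. c)"
  \<comment> \<open>The axiom concerns combinations of two fields; the second is the same field with
    coefficient 0.\<close>
  have kX: "k * ?X h + 0 * ?X h = c *\<^sub>R ?X h" for h
    by (auto simp: fun_eq_iff k_def restrict_zero_def scaleR_fun_def vertical_lift_outside[OF S N])
  have "\<D> (\<lambda>h. k * ?X h + 0 * ?X h) s = fscale k (\<D> ?X s) + fscale 0 (\<D> ?X s)"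
    using \<D> X s Cinf_restrict_const[OF pm, of c] Cinf_0[OF pm]
    unfolding canonical_connection_def k_def by blast
  moreover have "\<D> ?X s \<in> sections ?E (bundle_over_total S N l)"
    using connection_linear_op[OF \<nu>] s unfolding linear_op_def by blast
  then have "fscale k (\<D> ?X s) + fscale 0 (\<D> ?X s) = c *\<^sub>R \<D> ?X s"
    using sections_outside[OF pm vector_bundle_over_total[OF S N l]]
    by (auto simp: fun_eq_iff fscale_def k_def restrict_zero_def scaleR_fun_def)
  ultimately show ?thesis by (simp only: kX)
qed

text \<open>Equality is needed for every argument \<open>h\<close>, smooth or not, because the
  connection takes the whole function as its argument.\<close>

lemma vertical_lift_scale:
  assumes \<nu>: "\<nu> \<in> sections S N"
  shows "vertical_lift S N (c *\<^sub>R \<nu>) = (\<lambda>h. c *\<^sub>R vertical_lift S N \<nu> h)"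
proof
  fix h
  have "vertical_lift S N (c *\<^sub>R \<nu>) h y = (c *\<^sub>R vertical_lift S N \<nu> h) y" for y
  proof (cases "h \<in> Cinf (total_space S N) \<and> y \<in> pts (total_space S N)")
    case True
    then obtain x v where y: "y = (x, v)" "x \<in> pts S" "v \<in> fib N x"
      by (auto simp: total_space_simps[OF S N])
    \<comment> \<open>The base point is written \<open>0 * c\<close> to match the chain rule for the
      reparametrisation by \<open>c\<close>.\<close>
    have d: "((\<lambda>t. h (x, v + t *\<^sub>R \<nu> x)) has_real_derivative vertical_lift S N \<nu> h (x, v)) (at (0 * c))"
      using vertical_lift_derivative[where \<nu> = \<nu>, OF S N _ y(2,3) sections_fib[OF S N \<nu> y(2)]] True by simp
    have "((\<lambda>t. t * c) has_real_derivative c) (at 0)" by (auto intro!: derivative_eq_intros)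
    from DERIV_chain2[OF d this]
    have "((\<lambda>t. h (x, v + t *\<^sub>R (c *\<^sub>R \<nu>) x)) has_real_derivative c * vertical_lift S N \<nu> h (x, v)) (at 0)"
      by (simp add: scaleR_fun_def mult.commute)
    then show ?thesis
      using vertical_lift_eqI[OF S N _ y(2,3)] True by (simp add: y(1) scaleR_fun_def)
  qed (auto simp: vertical_lift_outside[OF S N] scaleR_fun_def)
  then show "vertical_lift S N (c *\<^sub>R \<nu>) h = c *\<^sub>R vertical_lift S N \<nu> h" by blast
qed

lemma SJ_I_map_uminus:
  assumes \<nu>: "\<nu> \<in> sections S N" and B: "odd_binary_op (total_space S N) (bundle_over_total S N l) B"
  shows "SJ (total_space S N) (bundle_over_total S N l) 2 1 B (I_map S N l \<D> (- \<nu>)) =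
    lie_derivative (total_space S N) (bundle_over_total S N l) (\<D> (vertical_lift S N \<nu>)) B"
proof -
  let ?E = "total_space S N" and ?L = "bundle_over_total S N l"
  note sub = subspace_sections[OF premanifold_total_space[OF S N] vector_bundle_over_total[OF S N l]]
  have "- \<nu> \<in> sections S N" using \<nu> subspace_sections[OF S N] by (rule_tac subspace_neg)
  then have "SJ ?E ?L 1 2 (I_map S N l \<D> (- \<nu>)) B = lie_derivative ?E ?L (\<D> (vertical_lift S N (- \<nu>))) B"
    unfolding I_map_def by (rule SJ_unary[OF B connection_linear_op])
  \<comment> \<open>The connection axioms hold on sections only, so the two derivations are compared
    there and not as functions.\<close>
  also have "\<dots> = - lie_derivative ?E ?L (\<D> (vertical_lift S N \<nu>)) B"
  proof (rule lie_derivative_minus[OF sub B connection_linear_op[OF \<nu>]])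
    fix s assume "s \<in> sections ?E ?L"
    then show "\<D> (vertical_lift S N (- \<nu>)) s = - \<D> (vertical_lift S N \<nu>) s"
      using connection_scale[OF \<nu>, of s "- 1"] vertical_lift_scale[OF \<nu>, of "- 1"] by simp
  qed
  finally show ?thesis unfolding SJ_antisym by simp
qed

lemma MC_eq_exp_lie:
  assumes J: "jacobi_structure (total_space S N) (bundle_over_total S N l) J"
    and PJ: "proj_P S N l J = 0" and s: "formal_deformation S N s"
  shows "proj_P S N l (exp_lie (total_space S N) (bundle_over_total S N l) 2
    (\<lambda>i. I_map S N l \<D> (s i)) (const_series J) n) = MC S N l \<D> J (- s) n"
proof -
  let ?E = "total_space S N" and ?L = "bundle_over_total S N l"
  note pm = premanifold_total_space[OF S N] and vb = vector_bundle_over_total[OF S N l]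
  note sub = subspace_sections[OF pm vb]
  define \<Delta> where "\<Delta> = (\<lambda>i. \<D> (vertical_lift S N (s i)))"
  have si: "s i \<in> sections S N" for i using s unfolding formal_deformation_def by blast
  have \<Delta>: "linear_op ?E ?L (\<Delta> i)" for i unfolding \<Delta>_def by (rule connection_linear_op[OF si])
  note odd = jacobi_structure_odd[OF pm vb J]
  have \<Delta>0: "\<Delta> 0 t = 0" if "t \<in> sections ?E ?L" for t
  proof -
    \<comment> \<open>Written as a multiple of itself, so that the scaling rules for the lift and
      the connection give zero.\<close>
    have "s 0 = 0 *\<^sub>R s 0" using s unfolding formal_deformation_def by simp
    then show ?thesis
      unfolding \<Delta>_def using vertical_lift_scale[OF si[of 0], of 0] connection_scale[OF si[of 0] that, of 0]
      by (metis scaleR_zero_left)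
  qed
  \<comment> \<open>The coefficient of order \<open>n\<close> of the \<open>k\<close>-th power
    applied to \<open>J\<close>, before division by the factorial.\<close>
  define T where "T = (\<lambda>k. \<Sum>is\<in>compositions k n. iterated_lie ?E ?L \<Delta> J is)"
  \<comment> \<open>More than \<open>n\<close> indices with sum \<open>n\<close> include an index 0,
    that is, a bracket with the zero derivation.\<close>
  have T_large: "T k = 0" if "n < k" for k
    unfolding T_def
    by (rule sum.neutral) (use iterated_lie_eq_0[where \<Delta> = \<Delta>, OF sub \<Delta> \<Delta>0 odd zero_in_composition[OF _ that]] in blast)
  \<comment> \<open>The exponential series has a term for k = 0 that the Maurer-Cartan series lacks;
    it is \<open>J\<close> in order 0 and zero in all others.\<close>
  have T0: "proj_P S N l (T 0) = 0"
  proof -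
    have "compositions 0 n = (if n = 0 then {[]} else {})" by (auto simp: compositions_def)
    then show ?thesis by (simp add: T_def PJ proj_P_0)
  qed
  have bracket: "m_bracket S N l \<D> J (map (- s) is) = proj_P S N l (iterated_lie ?E ?L \<Delta> J is)" for "is"
  proof -
    have "foldl (\<lambda>B \<xi>. SJ ?E ?L 2 1 B (I_map S N l \<D> \<xi>)) B (map (- s) is) = iterated_lie ?E ?L \<Delta> B is"
      if "odd_binary_op ?E ?L B" for B
      using that
    proof (induction "is" arbitrary: B)
      case (Cons i "is")
      have "SJ ?E ?L 2 1 B (I_map S N l \<D> ((- s) i)) = lie_derivative ?E ?L (\<Delta> i) B"
        using SJ_I_map_uminus[OF si Cons.prems, of i] by (simp only: \<Delta>_def uminus_apply)
      then show ?case
        by (simp only: list.map foldl.simps Cons.IH[OF odd_binary_op_lie_derivative[OF sub Cons.prems \<Delta>]])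
    qed simp
    then show ?thesis using odd by (simp add: m_bracket_def)
  qed
  have formal: "m_bracket_formal S N l \<D> J (replicate k (- s)) n = proj_P S N l (T k)" for k
  proof -
    have "map (\<lambda>(\<xi>, i). \<xi> i) (zip (replicate k (- s)) is) = map (- s) is" if "is \<in> compositions k n" for "is"
      using that by (intro nth_equalityI) (auto simp: compositions_def)
    then show ?thesis
      unfolding m_bracket_formal_def T_def proj_P_sum length_replicate compositions_def[symmetric]
      by (intro sum.cong refl) (simp add: bracket)
  qed
  have "exp_lie ?E ?L 2 (\<lambda>i. I_map S N l \<D> (s i)) (const_series J) n = Sum_any (\<lambda>k. (1 / fact k :: real) *\<^sub>R T k)"
    unfolding exp_lie_def I_map_def \<Delta>_def[symmetric] T_def
    using lie_op_power[OF sub \<Delta> odd] by (simp add: \<Delta>_def)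
  also have "\<dots> = (\<Sum>k\<le>n. (1 / fact k :: real) *\<^sub>R T k)"
    by (rule Sum_any.expand_superset) (auto intro: ccontr simp: T_large)
  finally have "proj_P S N l (exp_lie ?E ?L 2 (\<lambda>i. I_map S N l \<D> (s i)) (const_series J) n) =
      (\<Sum>k\<le>n. (1 / fact k :: real) *\<^sub>R proj_P S N l (T k))"
    by (simp add: proj_P_sum proj_P_scaleR)
  also have "\<dots> = (\<Sum>k\<le>n. if 1 \<le> k then (1 / fact k :: real) *\<^sub>R proj_P S N l (T k) else 0)"
  proof (rule sum.cong[OF refl])
    fix k
    show "(1 / fact k :: real) *\<^sub>R proj_P S N l (T k) = (if 1 \<le> k then (1 / fact k :: real) *\<^sub>R proj_P S N l (T k) else 0)"
      using T0 by (cases k) simp_all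
  qed
  also have "\<dots> = Sum_any (\<lambda>k. if 1 \<le> k then (1 / fact k :: real) *\<^sub>R proj_P S N l (T k) else 0)"
    by (rule Sum_any.expand_superset[symmetric])
      (auto intro: ccontr simp: T_large proj_P_0 split: if_splits)
  finally show ?thesis by (simp only: MC_def formal)
qed

end

theorem proposition4p9:
  fixes M :: "('a, 'e::euclidean_space) manifold"
    and L :: "('a, 'f::euclidean_space, 'l::real_vector) vbundle"
    and J\<^sub>M :: "('a, 'l) multi_op"
    and W :: "'e set" and S\<^sub>0 :: "'a set" and S :: "('a, 'e) manifold"
    and l :: "('a, 'f, 'l) vbundle"
    and N :: "('a, 'g::euclidean_space, 'v::real_vector) vbundle"
    and q :: "'a \<Rightarrow> (('a \<Rightarrow> real) \<Rightarrow> real) \<Rightarrow> 'v"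
    and \<tau>\<^sub>0 :: "'a \<times> 'v \<Rightarrow> 'a" and \<tau> :: "'a \<times> 'v \<Rightarrow> 'l \<Rightarrow> 'l"
    and J :: "('a \<times> 'v, 'l) multi_op"
    and \<D> :: "(('a \<times> 'v \<Rightarrow> real) \<Rightarrow> 'a \<times> 'v \<Rightarrow> real) \<Rightarrow> ('a \<times> 'v \<Rightarrow> 'l) \<Rightarrow> 'a \<times> 'v \<Rightarrow> 'l"
    and s :: "nat \<Rightarrow> 'a \<Rightarrow> 'v"
  assumes "smooth_manifold M" and "line_bundle M L" and "jacobi_structure M L J\<^sub>M"
    and "submanifold M W S\<^sub>0" and "closedin (mtop M) S\<^sub>0" and "coisotropic M L J\<^sub>M W S\<^sub>0"
    and "S = induced_manifold M W S\<^sub>0" and "l = restricted_bundle S\<^sub>0 L"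
    and "normal_bundle M W S\<^sub>0 N q"
    and "fat_tubular_nbhd M L S N \<tau>\<^sub>0 \<tau>"
    and "induced_jacobi (total_space S N) (bundle_over_total S N l) M L \<tau>\<^sub>0 \<tau> J\<^sub>M J"
    and "canonical_connection S N l \<D>"
    and "formal_deformation S N s"
  shows "formally_coisotropic S N l \<D> J s \<longleftrightarrow> (\<forall>n. MC S N l \<D> J (- s) n = 0)"
proof -
  have N: "vector_bundle S N" using assms(7,9) unfolding normal_bundle_def by blast
  note pm = smooth_manifold_imp_premanifold[OF assms(1)]
  have S: "premanifold S" unfolding assms(7) by (rule premanifold_induced[OF pm assms(4)])
  have ptsS: "pts S = S\<^sub>0" by (simp add: assms(7) induced_manifold_def)
  have "smooth_map S (pts S) M (\<lambda>x. x)"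
    using smooth_map_inclusion[OF pm assms(4)] ptsS by (simp add: assms(7))
  then have l: "vector_bundle S l"
    using vector_bundle_pullback[OF S pm] assms(2) ptsS
    unfolding assms(8) restricted_bundle_def line_bundle_def by metis
  have J: "jacobi_structure (total_space S N) (bundle_over_total S N l) J"
    using assms(11) unfolding induced_jacobi_def by blast
  have "proj_P S N l J = 0"
    by (rule proj_P_jacobi_eq_0[OF assms(1-4,6-8) N assms(10,11)])
  then show ?thesis
    unfolding formally_coisotropic_def using MC_eq_exp_lie[OF S N l assms(12) J _ assms(13)] by simp
qed

end
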